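(* Let $\ell$ be an odd prime and $n\ge1$. Let $G$ be a finite abelian $\ell$-group satisfying $G[\ell^n]\cong\bigoplus_{i=1}^n(\mathbb Z/\ell^i\mathbb Z)^{m_i}$. Then $$\mu(G)=\frac{\prod_{i=1}^\infty(1+\ell^{-i})^{-1}}{|\mathrm{Aut}(G)|}\cdot|\wedge^2G[\ell^n]|\cdot(\ell^{-1};\ell^{-1})_{m_n}\cdot\prod_{i=1}^{n-1}(\ell^{-1};\ell^{-2})_{\lceil m_i/2\rceil},$$ where $\mu(G)$ is the total $\mu$-measure of all isomorphism classes in $\mathcal C_{\ell,n}$ whose underlying group is isomorphic to $G$.
   Context: The Pochhammer symbol is $(a;q)_k=\prod_{j=0}^{k-1}(1-aq^j)$. For a finite abelian $\ell$-group $G$ ($\ell$ odd), let $G^\vee=\mathrm{Hom}(G,\mathbb Q/\mathbb Z)$, and let $\wedge^2G$ be the subgroup of $G\otimes G$ generated by $x\wedge y:=x\otimes y-y\otimes x$. For $\omega=\sum_k x_k\otimes y_k\in\wedge^2G$ and $m\ge0$, define $\omega_m:G^\vee[\ell^m]\times G^\vee[\ell^m]\to\frac1{\ell^m}\mathbb Z/\mathbb Z$ by $\omega_m(\alpha,\beta)=\ell^m\sum_k\tilde\alpha(x_k)\tilde\beta(y_k)\bmod\mathbb Z$, where tildes denote lifts of values from $\ell^{-m}\mathbb Z/\mathbb Z$ to $\ell^{-m}\mathbb Z$. An $\ell^n$-BEG is a triple $(G,\omega,\psi)$ with $G$ a finite abelian $\ell$-group, $\omega\in(\wedge^2G)[\ell^n]$,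 $\psi:G^\vee[\ell^n]\to G[\ell^n]$ a homomorphism, such that with $\langle\gamma,\delta\rangle:=\delta(\psi(\gamma))$ one has $\langle\ell^r\alpha,\beta\rangle=\langle\ell^r\beta,\alpha\rangle+2\omega_{n+r}(\alpha,\beta)$ for all $r\ge0$, $\alpha,\beta\in G^\vee[\ell^{n+r}]$. $\mathcal C_{\ell,n}$ is the category of $\ell^n$-BEGs, a morphism $(G,\omega_G,\psi_G)\to(H,\omega_H,\psi_H)$ being a homomorphism $f:G\to H$ with $f_*\omega_G=\omega_H$ and $f\circ\psi_G\circ f^\vee=\psi_H$ on $H^\vee[\ell^n]$. $\mu$ is the probability measure on the set of isomorphism classes of $\mathcal C_{\ell,n}$ with $\mu(G,\omega_G,\psi_G)=\dfrac{\prod_{i\ge0}(1-\ell^{-(2i+1)})}{|\mathrm{Aut}(G,\omega_G,\psi_G)|\,|\mathrm{Sym}^2G[\ell^n]|}$ if $\psi_G$ is an isomorphism and $0$ otherwise, where $\mathrm{Aut}(G,\omega_G,\psi_G)$ is the automorphism group in $\mathcal C_{\ell,n}$. *)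

theory Defs
  imports
    "HOL-Analysis.Infinite_Products"
    "HOL-Analysis.Nonnegative_Lebesgue_Integration"
    "HOL-Computational_Algebra.Primes"
    "HOL-Algebra.Bij"
    "HOL-Algebra.Free_Abelian_Groups"
begin

text \<open>
  Abelian groups are HOL-Algebra groups and hence written multiplicatively. A homomorphism that is
  to be counted or compared is required to be extensional on its domain, so that
  equality of functions is equality of maps.
\<close>

definition qpochhammer :: "real \<Rightarrow> real \<Rightarrow> nat \<Rightarrow> real" where
  "qpochhammer a q k = (\<Prod>j<k. 1 - a * q ^ j)"

definition finite_abelian_primary :: "nat \<Rightarrow> ('a, 'b) monoid_scheme \<Rightarrow> bool" where
  "finite_abelian_primary l G \<longleftrightarrow> comm_group G \<and> finite (carrier G) \<and> (\<exists>k. order G = l ^ k)"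

definition torsion :: "('a, 'b) monoid_scheme \<Rightarrow> nat \<Rightarrow> ('a, 'b) monoid_scheme" where
  "torsion G k = G\<lparr>carrier := {x \<in> carrier G. x [^]\<^bsub>G\<^esub> k = \<one>\<^bsub>G\<^esub>}\<rparr>"


subsection \<open>Dual group\<close>

definition rat_group :: "rat monoid" where
  "rat_group = \<lparr>carrier = UNIV, monoid.mult = (+), one = 0\<rparr>"

definition Q_mod_Z :: "rat set monoid" where
  "Q_mod_Z = rat_group Mod \<int>"

definition rat_class :: "rat \<Rightarrow> rat set" where
  "rat_class q = \<int> #>\<^bsub>rat_group\<^esub> q"

definition rat_lift :: "rat set \<Rightarrow> rat" where
  "rat_lift c = (SOME q. q \<in> c)"

definition dual :: "('a, 'b) monoid_scheme \<Rightarrow> ('a \<Rightarrow> rat set) monoid" where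
  "dual G =
    \<lparr>carrier = hom G Q_mod_Z \<inter> extensional (carrier G),
     monoid.mult = (\<lambda>\<alpha> \<beta>. \<lambda>x\<in>carrier G. \<alpha> x \<otimes>\<^bsub>Q_mod_Z\<^esub> \<beta> x),
     one = (\<lambda>x\<in>carrier G. \<one>\<^bsub>Q_mod_Z\<^esub>)\<rparr>"

definition dual_map :: "('a, 'b) monoid_scheme \<Rightarrow> ('a \<Rightarrow> 'c) \<Rightarrow> ('c \<Rightarrow> rat set) \<Rightarrow> 'a \<Rightarrow> rat set" where
  "dual_map G f \<beta> = compose (carrier G) \<beta> f"


subsection \<open>Tensor, exterior and symmetric square\<close>

definition bilinear_relations :: "('a, 'b) monoid_scheme \<Rightarrow> (('a \<times> 'a) \<Rightarrow>\<^sub>0 int) set" where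
  "bilinear_relations G =
    {frag_of (x \<otimes>\<^bsub>G\<^esub> x', y) - frag_of (x, y) - frag_of (x', y) | x x' y.
       x \<in> carrier G \<and> x' \<in> carrier G \<and> y \<in> carrier G} \<union>
    {frag_of (x, y \<otimes>\<^bsub>G\<^esub> y') - frag_of (x, y) - frag_of (x, y') | x y y'.
       x \<in> carrier G \<and> y \<in> carrier G \<and> y' \<in> carrier G}"

definition bilinear_kernel :: "('a, 'b) monoid_scheme \<Rightarrow> (('a \<times> 'a) \<Rightarrow>\<^sub>0 int) set" where
  "bilinear_kernel G =
    generate (free_Abelian_group (carrier G \<times> carrier G)) (bilinear_relations G)"

definition tensor_square :: "('a, 'b) monoid_scheme \<Rightarrow> (('a \<times> 'a) \<Rightarrow>\<^sub>0 int) set monoid" where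
  "tensor_square G = free_Abelian_group (carrier G \<times> carrier G) Mod bilinear_kernel G"

definition tensor :: "('a, 'b) monoid_scheme \<Rightarrow> 'a \<Rightarrow> 'a \<Rightarrow> (('a \<times> 'a) \<Rightarrow>\<^sub>0 int) set" where
  "tensor G x y = bilinear_kernel G #>\<^bsub>free_Abelian_group (carrier G \<times> carrier G)\<^esub> frag_of (x, y)"

definition wedge :: "('a, 'b) monoid_scheme \<Rightarrow> 'a \<Rightarrow> 'a \<Rightarrow> (('a \<times> 'a) \<Rightarrow>\<^sub>0 int) set" where
  "wedge G x y = tensor G x y \<otimes>\<^bsub>tensor_square G\<^esub> inv\<^bsub>tensor_square G\<^esub> tensor G y x"

definition wedge_square :: "('a, 'b) monoid_scheme \<Rightarrow> (('a \<times> 'a) \<Rightarrow>\<^sub>0 int) set monoid" where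
  "wedge_square G =
    subgroup_generated (tensor_square G) {wedge G x y | x y. x \<in> carrier G \<and> y \<in> carrier G}"

definition sym_square :: "('a, 'b) monoid_scheme \<Rightarrow> (('a \<times> 'a) \<Rightarrow>\<^sub>0 int) set set monoid" where
  "sym_square G = tensor_square G Mod carrier (wedge_square G)"

definition tensor_sum :: "('a, 'b) monoid_scheme \<Rightarrow> ('a \<times> 'a) list \<Rightarrow> (('a \<times> 'a) \<Rightarrow>\<^sub>0 int) set" where
  "tensor_sum G zs =
    foldr (\<lambda>(x, y) w. tensor G x y \<otimes>\<^bsub>tensor_square G\<^esub> w) zs \<one>\<^bsub>tensor_square G\<^esub>"

text \<open>
  An expression of a tensor as a finite sum of pure tensors. Every element of the tensor square has
  one, and the two constructions below do not depend on which one is chosen.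
\<close>

definition tensor_expansion ::
    "('a, 'b) monoid_scheme \<Rightarrow> (('a \<times> 'a) \<Rightarrow>\<^sub>0 int) set \<Rightarrow> ('a \<times> 'a) list" where
  "tensor_expansion G \<omega> =
    (SOME zs. set zs \<subseteq> carrier G \<times> carrier G \<and> \<omega> = tensor_sum G zs)"

definition tensor_map ::
    "('a, 'b) monoid_scheme \<Rightarrow> ('c, 'd) monoid_scheme \<Rightarrow> ('a \<Rightarrow> 'c) \<Rightarrow>
     (('a \<times> 'a) \<Rightarrow>\<^sub>0 int) set \<Rightarrow> (('c \<times> 'c) \<Rightarrow>\<^sub>0 int) set" where
  "tensor_map G H f \<omega> = tensor_sum H (map (map_prod f f) (tensor_expansion G \<omega>))"

text \<open>
  The form \<open>\<omega>\<^sub>m\<close>, meant for \<open>\<alpha>\<close> and \<open>\<beta>\<close> in the \<open>l^m\<close>-torsion of the dual. Their values then lie in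
  \<open>(1/l^m) \<int> / \<int>\<close>, so every rational lift of a value lies in \<open>(1/l^m) \<int>\<close>.
\<close>

definition tensor_form ::
    "nat \<Rightarrow> ('a, 'b) monoid_scheme \<Rightarrow> (('a \<times> 'a) \<Rightarrow>\<^sub>0 int) set \<Rightarrow> nat \<Rightarrow>
     ('a \<Rightarrow> rat set) \<Rightarrow> ('a \<Rightarrow> rat set) \<Rightarrow> rat set" where
  "tensor_form l G \<omega> m \<alpha> \<beta> =
    rat_class (of_nat (l ^ m) *
      (\<Sum>(x, y) \<leftarrow> tensor_expansion G \<omega>. rat_lift (\<alpha> x) * rat_lift (\<beta> y)))"


subsection \<open>The category of BEGs\<close>

type_synonym 'a beg =
  "'a monoid \<times> (('a \<times> 'a) \<Rightarrow>\<^sub>0 int) set \<times> (('a \<Rightarrow> rat set) \<Rightarrow> 'a)"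

definition is_beg :: "nat \<Rightarrow> nat \<Rightarrow> 'a beg \<Rightarrow> bool" where
  "is_beg l n = (\<lambda>(G, \<omega>, \<psi>).
     finite_abelian_primary l G \<and>
     \<omega> \<in> carrier (torsion (wedge_square G) (l ^ n)) \<and>
     \<psi> \<in> hom (torsion (dual G) (l ^ n)) (torsion G (l ^ n)) \<and>
     \<psi> \<in> extensional (carrier (torsion (dual G) (l ^ n))) \<and>
     (\<forall>r. \<forall>\<alpha> \<in> carrier (torsion (dual G) (l ^ (n + r))).
          \<forall>\<beta> \<in> carrier (torsion (dual G) (l ^ (n + r))).
        \<beta> (\<psi> (\<alpha> [^]\<^bsub>dual G\<^esub> (l ^ r))) =
        \<alpha> (\<psi> (\<beta> [^]\<^bsub>dual G\<^esub> (l ^ r))) \<otimes>\<^bsub>Q_mod_Z\<^esub>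
          (tensor_form l G \<omega> (n + r) \<alpha> \<beta> [^]\<^bsub>Q_mod_Z\<^esub> (2::nat))))"

definition beg_hom :: "nat \<Rightarrow> nat \<Rightarrow> 'a beg \<Rightarrow> 'b beg \<Rightarrow> ('a \<Rightarrow> 'b) set" where
  "beg_hom l n = (\<lambda>(G, \<omega>G, \<psi>G) (H, \<omega>H, \<psi>H).
     {f \<in> hom G H \<inter> extensional (carrier G).
        tensor_map G H f \<omega>G = \<omega>H \<and>
        (\<forall>\<beta> \<in> carrier (torsion (dual H) (l ^ n)). f (\<psi>G (dual_map G f \<beta>)) = \<psi>H \<beta>)})"

definition beg_iso :: "nat \<Rightarrow> nat \<Rightarrow> 'a beg \<Rightarrow> 'b beg \<Rightarrow> ('a \<Rightarrow> 'b) set" where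
  "beg_iso l n A B =
    {f \<in> beg_hom l n A B. \<exists>g \<in> beg_hom l n B A.
       compose (carrier (fst A)) g f = (\<lambda>x\<in>carrier (fst A). x) \<and>
       compose (carrier (fst B)) f g = (\<lambda>y\<in>carrier (fst B). y)}"

definition beg_aut :: "nat \<Rightarrow> nat \<Rightarrow> 'a beg \<Rightarrow> ('a \<Rightarrow> 'a) set" where
  "beg_aut l n B = beg_iso l n B B"

text \<open>
  A finite group is isomorphic to one whose carrier is a set of natural numbers, so the isomorphism
  classes of the category are represented by the BEGs on such groups.
\<close>

definition begs :: "nat \<Rightarrow> nat \<Rightarrow> nat beg set" where
  "begs l n = {B. is_beg l n B}"

definition beg_classes :: "nat \<Rightarrow> nat \<Rightarrow> nat beg set set" where
  "beg_classes l n = begs l n // {(A, B). A \<in> begs l n \<and> B \<in> begs l n \<and> beg_iso l n A B \<noteq> {}}"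


subsection \<open>The measure\<close>

definition beg_weight :: "nat \<Rightarrow> nat \<Rightarrow> 'a beg \<Rightarrow> real" where
  "beg_weight l n = (\<lambda>(G, \<omega>, \<psi>).
     if \<psi> \<in> iso (torsion (dual G) (l ^ n)) (torsion G (l ^ n))
     then prodinf (\<lambda>i. 1 - inverse (real l) ^ (2 * i + 1)) /
          (real (card (beg_aut l n (G, \<omega>, \<psi>))) *
           real (card (carrier (torsion (sym_square G) (l ^ n)))))
     else 0)"

text \<open>The weight is invariant under isomorphism, so any representative of a class gives its mass.\<close>

definition beg_measure :: "nat \<Rightarrow> nat \<Rightarrow> nat beg set measure" where
  "beg_measure l n =
    point_measure (beg_classes l n) (\<lambda>C. ennreal (beg_weight l n (SOME B. B \<in> C)))"

end

theory Submission
  imports Defs "HOL-Number_Theory.Cong" "HOL-Algebra.Weak_Morphisms"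
begin

text \<open>
  By the orbit-stabilizer theorem the measure of \<open>G\<close> is the number of BEG structures on \<open>G\<close> with
  bijective \<open>\<psi>\<close>, divided by \<open>|Aut(G)| |Sym^2 G[l^n]|\<close>. In terms of a basis of \<open>G\<close> with orders
  \<open>l^a(i)\<close>, the compatibility of \<open>\<omega>\<close> and \<open>\<psi>\<close> amounts to one congruence for each pair \<open>i < j\<close>, so the
  structures are in bijection with a product of sets of residues, of total size
  \<open>|Wedge^2 G[l^n]| |Sym^2 G[l^n]|\<close>. Modulo \<open>l\<close> the matrix of \<open>\<psi>\<close> is block triangular. Its diagonal
  block belonging to the exponent \<open>min(a(i), n) = v\<close> is a uniformly distributed matrix if \<open>v = n\<close> and a
  uniformly distributed symmetric matrix if \<open>v < n\<close>, and \<open>\<psi>\<close> is bijective iff all these blocks are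
  nonsingular. The constants match by Euler's identity between \<open>\<Prod>(1 + q^i)^(-1)\<close> and
  \<open>\<Prod>(1 - q^(2i+1))\<close>.
\<close>

text \<open>For i < j the congruence reads \<open>l ^ (dd i - dd j) * u (j, i) - u (i, j) + 2 * l ^
  (n - bb i) * w (i, j) = 0\<close> modulo \<open>l ^ bb j\<close>, with \<open>u\<close> and
  \<open>w\<close> the matrices of \<psi> and \<omega>. It explains both kinds of blocks. In the
  block of an exponent v < n one has \<open>dd = 0\<close> and \<open>n - bb i > 0\<close>, so
  modulo l it says that \<open>u\<close> is symmetric. In the top block the coefficient of
  \<open>w (i, j)\<close> is the unit 2, so \<open>w\<close> absorbs every asymmetry and
  \<open>u\<close> is arbitrary. Two features of the definitions stand in the way of counting.
  Tensors are expanded and character values lifted by arbitrary choice; the universal property of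
  the tensor square shows that the choices do not matter. And the identity is required for all r at
  once; for each pair one value of r, with suitable characters, is as strong as all of them. The
  dual, the tensor, wedge and symmetric squares and their torsion are handled through one notion,
  \<open>presents\<close>: an additive surjection from integer families with diagonal
  kernel.\<close>

subsection \<open>Euler's product identity\<close>

text \<open>Since 1 - x^2 = (1 - x)(1 + x), the product of all 1 - q^i is that of the 1 / (1 + q^i)
  times that of the 1 - q^(2i). Splitting the exponents by parity gives the odd product times the
  same even product, which is nonzero and cancels.\<close>

lemma prodinf_inverse_one_plus_power:
  fixes q :: real
  assumes "0 < q" "q < 1"
  shows "prodinf (\<lambda>i. inverse (1 + q ^ (i + 1))) = prodinf (\<lambda>i. 1 - q ^ (2 * i + 1))"
proof -
  define A where "A n = (\<Prod>i<n. 1 - q ^ (i + 1))" for n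
  define B where "B n = (\<Prod>i<n. 1 - q ^ (2 * i + 2))" for n
  define D where "D n = (\<Prod>i<n. 1 - q ^ (2 * i + 1))" for n
  define P where "P n = (\<Prod>i<n. inverse (1 + q ^ (i + 1)))" for n
  have pos: "q ^ k > 0" for k using assms by simp
  have lt: "q ^ k < 1" if "k > 0" for k
    using assms that by (simp add: power_less_one_iff)
  have summ: "summable (\<lambda>i. q ^ (c * i + d))" if "c > 0" for c d
  proof -
    have "q ^ c < 1" using lt that by blast
    then have "summable (\<lambda>i. (q ^ c) ^ i * q ^ d)"
      using assms by (intro summable_mult2 summable_geometric) (simp add: abs_of_pos pos)
    then show ?thesis by (simp add: power_add power_mult)
  qed
  have cv: "convergent_prod (\<lambda>i. 1 - q ^ (c * i + d))" if "c > 0" for c d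
    using summ[OF that] assms
    by (intro abs_convergent_prod_imp_convergent_prod)
       (simp add: abs_convergent_prod_conv_summable)
  have cvP: "convergent_prod (\<lambda>i. inverse (1 + q ^ (i + 1)))"
  proof -
    have "convergent_prod (\<lambda>i. 1 + q ^ (i + 1))"
      using summ[of 1 1] assms
      by (intro abs_convergent_prod_imp_convergent_prod)
         (simp add: abs_convergent_prod_conv_summable)
    then show ?thesis by (rule convergent_prod_inverse)
  qed
  have lim: "(\<lambda>n. \<Prod>i<n. f i) \<longlonglongrightarrow> prodinf f" if "convergent_prod f" for f :: "nat \<Rightarrow> real"
    using convergent_prod_LIMSEQ[OF that] LIMSEQ_lessThan_iff_atMost[of "\<lambda>S. prod f S"]
    by blast
  have limA: "A \<longlonglongrightarrow> prodinf (\<lambda>i. 1 - q ^ (i + 1))"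
    unfolding A_def using lim[OF cv[of 1 1]] by simp
  have limB: "B \<longlonglongrightarrow> prodinf (\<lambda>i. 1 - q ^ (2 * i + 2))"
    unfolding B_def using lim[OF cv[of 2 2]] by simp
  have limD: "D \<longlonglongrightarrow> prodinf (\<lambda>i. 1 - q ^ (2 * i + 1))"
    unfolding D_def using lim[OF cv[of 2 1]] by simp
  have limP: "P \<longlonglongrightarrow> prodinf (\<lambda>i. inverse (1 + q ^ (i + 1)))"
    unfolding P_def using lim[OF cvP] by simp
  have nz: "prodinf (\<lambda>i. 1 - q ^ (2 * i + 2)) \<noteq> 0"
  proof (rule prodinf_nonzero)
    show "convergent_prod (\<lambda>i. 1 - q ^ (2 * i + 2))" by (rule cv) simp
    show "1 - q ^ (2 * i + 2) \<noteq> 0" for i using lt[of "2 * i + 2"] by simp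
  qed
  have AP: "A n = P n * B n" for n
    unfolding A_def P_def B_def prod.distrib[symmetric]
  proof (rule prod.cong[OF refl])
    fix i
    define x where "x = q ^ (i + 1)"
    have "1 + x \<noteq> 0" using pos[of "i + 1"] unfolding x_def by linarith
    moreover have "q ^ (2 * i + 2) = x * x"
      unfolding x_def power_add[symmetric] by (simp add: mult_2)
    ultimately show "1 - q ^ (i + 1) = inverse (1 + q ^ (i + 1)) * (1 - q ^ (2 * i + 2))"
      unfolding x_def[symmetric] by (simp add: field_simps)
  qed
  \<comment> \<open>Only partial products of even length split exactly into odd and even exponents,
    whence the subsequence below.\<close>
  have AD: "A (2 * n) = D n * B n" for n
    unfolding A_def D_def B_def
    by (induction n) (simp_all add: algebra_simps)
  have "(\<lambda>n. A (2 * n)) \<longlonglongrightarrow> prodinf (\<lambda>i. 1 - q ^ (i + 1))"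
    using LIMSEQ_subseq_LIMSEQ[OF limA, of "(*) 2"] by (simp add: strict_mono_def o_def)
  then have "prodinf (\<lambda>i. 1 - q ^ (i + 1))
      = prodinf (\<lambda>i. 1 - q ^ (2 * i + 1)) * prodinf (\<lambda>i. 1 - q ^ (2 * i + 2))"
    using tendsto_mult[OF limD limB] LIMSEQ_unique AD by fastforce
  moreover have "prodinf (\<lambda>i. 1 - q ^ (i + 1))
      = prodinf (\<lambda>i. inverse (1 + q ^ (i + 1))) * prodinf (\<lambda>i. 1 - q ^ (2 * i + 2))"
    using LIMSEQ_unique[OF limA] tendsto_mult[OF limP limB] unfolding AP[symmetric] by blast
  ultimately show ?thesis using nz by simp
qed

subsection \<open>Counting nonsingular matrices modulo a prime\<close>

text \<open>Triviality of the left kernel over the field with l elements. Integer entries and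
  arbitrary index sets make reduction modulo l implicit and let minors and diagonal blocks arise by
  shrinking the index sets.\<close>

definition nonsing :: "nat \<Rightarrow> 'i set \<Rightarrow> 'j set \<Rightarrow> ('i \<times> 'j \<Rightarrow> int) \<Rightarrow> bool" where
  "nonsing l I J M \<longleftrightarrow>
    (\<forall>x. (\<forall>j\<in>J. int l dvd (\<Sum>i\<in>I. x i * M (i, j))) \<longrightarrow> (\<forall>i\<in>I. int l dvd x i))"

lemma nonsing_cong:
  assumes "\<And>i j. i \<in> I \<Longrightarrow> j \<in> J \<Longrightarrow> [M (i, j) = M' (i, j)] (mod int l)"
  shows "nonsing l I J M \<longleftrightarrow> nonsing l I J M'"
proof -
  have "int l dvd (\<Sum>i\<in>I. x i * M (i, j)) \<longleftrightarrow> int l dvd (\<Sum>i\<in>I. x i * M' (i, j))"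
    if "j \<in> J" for x j
    by (rule cong_dvd_iff, rule cong_sum, rule cong_mult[OF cong_refl assms[OF _ that]])
  then show ?thesis unfolding nonsing_def by simp
qed

text \<open>One step of Gaussian elimination: the matrix on the right is the Schur complement of the
  entry at \<open>(i0, j0)\<close>, whose inverse modulo l is \<open>v\<close>.\<close>

lemma nonsing_pivot:
  fixes M :: "'i \<times> 'j \<Rightarrow> int"
  assumes "finite I" "i0 \<in> I" "j0 \<in> J" and v: "[v * M (i0, j0) = 1] (mod int l)"
  shows "nonsing l I J M \<longleftrightarrow>
    nonsing l (I - {i0}) (J - {j0}) (\<lambda>(i, j). M (i, j) - M (i, j0) * v * M (i0, j))"
proof -
  define S where "S x j = (\<Sum>i\<in>I-{i0}. x i * M (i, j))" for x :: "'i \<Rightarrow> int" and j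
  have vd: "int l dvd v * M (i0, j0) - 1"
    using v by (simp add: cong_iff_dvd_diff)
  have S1: "(\<Sum>i\<in>I. x i * M (i, j)) = x i0 * M (i0, j) + S x j" for x j
    unfolding S_def using assms by (simp add: sum.remove)
  have S2: "(\<Sum>i\<in>I-{i0}. x i * (M (i, j) - M (i, j0) * v * M (i0, j)))
      = S x j - S x j0 * v * M (i0, j)" for x j
    unfolding S_def by (simp add: algebra_simps sum_subtractf sum_distrib_left sum_distrib_right)
  show ?thesis
  proof
    assume L: "nonsing l I J M"
    show "nonsing l (I - {i0}) (J - {j0}) (\<lambda>(i, j). M (i, j) - M (i, j0) * v * M (i0, j))"
      unfolding nonsing_def prod.case S2
    proof (intro allI impI)
      fix x :: "'i \<Rightarrow> int"
      assume x: "\<forall>j\<in>J - {j0}. int l dvd S x j - S x j0 * v * M (i0, j)"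
      \<comment> \<open>The coordinate at \<open>i0\<close> is forced by the equation of column
        \<open>j0\<close>; with this value the other columns give the equations of the Schur
        complement.\<close>
      define y where "y = x(i0 := - v * S x j0)"
      have Sy: "S y j = S x j" for j unfolding S_def y_def by (rule sum.cong) auto
      have "int l dvd (\<Sum>i\<in>I. y i * M (i, j))" if "j \<in> J" for j
      proof (cases "j = j0")
        case True
        have "(\<Sum>i\<in>I. y i * M (i, j)) = - S x j0 * (v * M (i0, j0) - 1)"
          unfolding S1 Sy True by (simp add: y_def algebra_simps)
        then show ?thesis using vd by simp
      next
        case False
        have "(\<Sum>i\<in>I. y i * M (i, j)) = S x j - S x j0 * v * M (i0, j)"
          unfolding S1 Sy by (simp add: y_def algebra_simps)
        then show ?thesis using x that False by simp
      qed
      then have "\<forall>i\<in>I. int l dvd y i" using L unfolding nonsing_def by blast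
      moreover have "y i = x i" if "i \<in> I - {i0}" for i using that by (simp add: y_def)
      ultimately show "\<forall>i\<in>I - {i0}. int l dvd x i" by fastforce
    qed
  next
    assume R: "nonsing l (I - {i0}) (J - {j0}) (\<lambda>(i, j). M (i, j) - M (i, j0) * v * M (i0, j))"
    show "nonsing l I J M"
      unfolding nonsing_def S1
    proof (intro allI impI)
      fix x :: "'i \<Rightarrow> int"
      assume x: "\<forall>j\<in>J. int l dvd x i0 * M (i0, j) + S x j"
      have "int l dvd S x j - S x j0 * v * M (i0, j)" if "j \<in> J - {j0}" for j
      proof -
        have "S x j - S x j0 * v * M (i0, j) = (x i0 * M (i0, j) + S x j)
            - v * M (i0, j) * (x i0 * M (i0, j0) + S x j0)
            + x i0 * M (i0, j) * (v * M (i0, j0) - 1)"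
          by (simp add: algebra_simps)
        then show ?thesis using x vd that assms by (metis DiffD1 dvd_add dvd_diff dvd_mult)
      qed
      then have I': "\<forall>i\<in>I - {i0}. int l dvd x i"
        using R unfolding nonsing_def prod.case S2 by blast
      then have "int l dvd S x j0" unfolding S_def by (intro dvd_sum) auto
      moreover have "x i0 = v * (x i0 * M (i0, j0) + S x j0) - v * S x j0
          - x i0 * (v * M (i0, j0) - 1)"
        by (simp add: algebra_simps)
      ultimately have "int l dvd x i0"
        using x vd assms(3) by (metis dvd_diff dvd_mult)
      then show "\<forall>i\<in>I. int l dvd x i" using I' by blast
    qed
  qed
qed

lemma nonsing_zero_row:
  assumes "l > 1" "finite I" "i0 \<in> I" "\<And>j. j \<in> J \<Longrightarrow> M (i0, j) = 0"
  shows "\<not> nonsing l I J M"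
proof
  assume N: "nonsing l I J M"
  define x where "x i = (if i = i0 then 1 else 0 :: int)" for i
  have "(\<Sum>i\<in>I. x i * M (i, j)) = 0" if "j \<in> J" for j
    by (rule sum.neutral) (auto simp: x_def assms(4)[OF that])
  then have "int l dvd x i0"
    using N assms(3) unfolding nonsing_def by (metis dvd_0_right)
  then show False using assms(1) by (simp add: x_def)
qed

definition merge_on :: "'i set \<Rightarrow> ('i \<Rightarrow> 'v) \<Rightarrow> ('i \<Rightarrow> 'v) \<Rightarrow> 'i \<Rightarrow> 'v" where
  "merge_on A g h = (\<lambda>x. if x \<in> A then g x else h x)"

text \<open>Conditioning on the restriction to \<open>A\<close>. It is applied with \<open>A\<close>
  a row, a column or a block for which the inner count is known.\<close>

lemma card_PiE_split:
  assumes "finite C" "A \<subseteq> C" "\<And>i. i \<in> C \<Longrightarrow> finite (X i)"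
  shows "card {f \<in> PiE C X. \<Phi> f} =
    (\<Sum>g\<in>PiE A X. card {h \<in> PiE (C - A) X. \<Phi> (merge_on A g h)})"
proof -
  have fA: "finite A" using assms finite_subset by blast
  have "bij_betw (\<lambda>f. (restrict f A, restrict f (C - A))) {f \<in> PiE C X. \<Phi> f}
     (Sigma (PiE A X) (\<lambda>g. {h \<in> PiE (C - A) X. \<Phi> (merge_on A g h)}))"
  proof (rule bij_betw_byWitness[where f' = "\<lambda>(g, h). merge_on A g h"])
    have *: "merge_on A (restrict f A) (restrict f (C - A)) = f" if "f \<in> PiE C X" for f
      using that by (auto simp: merge_on_def fun_eq_iff PiE_def extensional_def)
    then show "\<forall>a\<in>{f \<in> PiE C X. \<Phi> f}.
        (case (restrict a A, restrict a (C - A)) of (g, h) \<Rightarrow> merge_on A g h) = a"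
      by simp
    show "(\<lambda>f. (restrict f A, restrict f (C - A))) ` {f \<in> PiE C X. \<Phi> f}
      \<subseteq> (SIGMA g:PiE A X. {h \<in> PiE (C - A) X. \<Phi> (merge_on A g h)})"
      using * assms(2) by (auto simp: PiE_def Pi_def)
    show "\<forall>a'\<in>(SIGMA g:PiE A X. {h \<in> PiE (C - A) X. \<Phi> (merge_on A g h)}).
       (restrict (case a' of (g, h) \<Rightarrow> merge_on A g h) A,
        restrict (case a' of (g, h) \<Rightarrow> merge_on A g h) (C - A)) = a'"
      by (auto simp: merge_on_def fun_eq_iff PiE_def extensional_def)
    show "(\<lambda>(g, h). merge_on A g h) ` (SIGMA g:PiE A X. {h \<in> PiE (C - A) X. \<Phi> (merge_on A g h)})
      \<subseteq> {f \<in> PiE C X. \<Phi> f}"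
      using assms(2) by (auto simp: merge_on_def PiE_def extensional_def Pi_def)
  qed
  then have "card {f \<in> PiE C X. \<Phi> f} =
     card (Sigma (PiE A X) (\<lambda>g. {h \<in> PiE (C - A) X. \<Phi> (merge_on A g h)}))"
    by (rule bij_betw_same_card)
  also have "\<dots> = (\<Sum>g\<in>PiE A X. card {h \<in> PiE (C - A) X. \<Phi> (merge_on A g h)})"
    using assms fA
    by (intro card_SigmaI) (auto intro!: finite_PiE finite_Collect_conjI)
  finally show ?thesis .
qed

text \<open>Translation permutes the families of residues. It absorbs the correction term of a Schur
  complement, so that the matrix left by an elimination is again uniformly distributed.\<close>

lemma card_PiE_shift:
  fixes t :: "'i \<Rightarrow> int"
  assumes "l > 0"
  shows "card {h \<in> PiE B (\<lambda>_. {0..<int l}). \<Phi> (\<lambda>x\<in>B. (h x - t x) mod int l)}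
       = card {h \<in> PiE B (\<lambda>_. {0..<int l}). \<Phi> h}"
proof -
  have "bij_betw (\<lambda>h. \<lambda>x\<in>B. (h x - t x) mod int l)
     {h \<in> PiE B (\<lambda>_. {0..<int l}). \<Phi> (\<lambda>x\<in>B. (h x - t x) mod int l)}
     {h \<in> PiE B (\<lambda>_. {0..<int l}). \<Phi> h}"
  proof (rule bij_betw_byWitness[where f' = "\<lambda>h. \<lambda>x\<in>B. (h x + t x) mod int l"])
    have eq: "(\<lambda>x\<in>B. ((\<lambda>x\<in>B. (h x + t x) mod int l) x - t x) mod int l) = h"
      if "h \<in> PiE B (\<lambda>_. {0..<int l})" for h
      using that by (auto simp: fun_eq_iff PiE_def extensional_def Pi_def mod_simps)
    show "\<forall>a'\<in>{h \<in> PiE B (\<lambda>_. {0..<int l}). \<Phi> h}.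
       (\<lambda>x\<in>B. ((\<lambda>x\<in>B. (a' x + t x) mod int l) x - t x) mod int l) = a'"
      using eq by blast
    show "(\<lambda>h. \<lambda>x\<in>B. (h x + t x) mod int l) ` {h \<in> PiE B (\<lambda>_. {0..<int l}). \<Phi> h}
      \<subseteq> {h \<in> PiE B (\<lambda>_. {0..<int l}). \<Phi> (\<lambda>x\<in>B. (h x - t x) mod int l)}"
    proof (clarify, intro conjI)
      fix h assume h: "h \<in> PiE B (\<lambda>_. {0..<int l})" "\<Phi> h"
      show "(\<lambda>x\<in>B. (h x + t x) mod int l) \<in> PiE B (\<lambda>_. {0..<int l})"
        using assms by auto
      show "\<Phi> (\<lambda>x\<in>B. ((\<lambda>x\<in>B. (h x + t x) mod int l) x - t x) mod int l)"
        using eq[OF h(1)] h(2) by simp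
    qed
    show "\<forall>a\<in>{h \<in> PiE B (\<lambda>_. {0..<int l}). \<Phi> (\<lambda>x\<in>B. (h x - t x) mod int l)}.
       (\<lambda>x\<in>B. ((\<lambda>x\<in>B. (a x - t x) mod int l) x + t x) mod int l) = a"
      by (auto simp: fun_eq_iff PiE_def extensional_def Pi_def mod_simps)
    show "(\<lambda>h. \<lambda>x\<in>B. (h x - t x) mod int l) `
        {h \<in> PiE B (\<lambda>_. {0..<int l}). \<Phi> (\<lambda>x\<in>B. (h x - t x) mod int l)}
      \<subseteq> {h \<in> PiE B (\<lambda>_. {0..<int l}). \<Phi> h}"
      using assms by auto
  qed
  then show ?thesis by (rule bij_betw_same_card)
qed

lemma card_PiE_residues:
  "finite A \<Longrightarrow> card (PiE A (\<lambda>_. {0..<int l})) = l ^ card A"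
  by (simp add: card_PiE)

lemma prime_residue_inverse:
  fixes a :: int
  assumes "prime l" "a \<in> {0..<int l}" "a \<noteq> 0"
  obtains v where "[v * a = 1] (mod int l)"
proof -
  have "\<not> int l dvd a" using assms by (auto dest: zdvd_imp_le)
  then have "coprime a (int l)"
    using assms(1) prime_imp_coprime[of "int l" a] by (simp add: coprime_commute)
  then obtain v where "[a * v = 1] (mod int l)" using cong_solve_coprime_int by blast
  then show thesis using that by (simp add: mult.commute)
qed

text \<open>The other entries of the pivot column are free, which gives the factor; for each choice
  of them the Schur complement is a translate of the remaining entries.\<close>

lemma card_nonsing_pivot_row:
  fixes I :: "'i set" and J :: "'j set"
  assumes l: "prime l" and fin: "finite I" "finite J" and ij: "i0 \<in> I" "j0 \<in> J"
    and g: "g \<in> PiE ({i0} \<times> J) (\<lambda>_. {0..<int l})" "g (i0, j0) \<noteq> 0"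
  shows "card {h \<in> PiE (I \<times> J - {i0} \<times> J) (\<lambda>_. {0..<int l}).
            nonsing l I J (merge_on ({i0} \<times> J) g h)} =
    l ^ (card I - 1) * card {M \<in> PiE ((I - {i0}) \<times> (J - {j0})) (\<lambda>_. {0..<int l}).
       nonsing l (I - {i0}) (J - {j0}) M}"
proof -
  let ?X = "\<lambda>_. {0..<int l}"
  let ?A = "{i0} \<times> J" let ?B = "(I - {i0}) \<times> {j0}"
  let ?C = "(I - {i0}) \<times> (J - {j0})"
  have l0: "l > 0" using l prime_gt_0_nat by blast
  have "g (i0, j0) \<in> {0..<int l}" using g(1) ij by auto
  then obtain v where v: "[v * g (i0, j0) = 1] (mod int l)"
    using prime_residue_inverse[OF l _ g(2)] by blast
  have D: "(I \<times> J - ?A) - ?B = ?C" by auto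
  have BC: "?B \<subseteq> I \<times> J - ?A" using ij by auto
  have "card {h \<in> PiE (I \<times> J - ?A) ?X. nonsing l I J (merge_on ?A g h)}
     = (\<Sum>c\<in>PiE ?B ?X. card {h \<in> PiE ?C ?X. nonsing l I J (merge_on ?A g (merge_on ?B c h))})"
    unfolding D[symmetric] using fin BC by (intro card_PiE_split) auto
  also have "\<dots> = (\<Sum>c\<in>PiE ?B ?X. card {M \<in> PiE ?C ?X. nonsing l (I - {i0}) (J - {j0}) M})"
  proof (rule sum.cong[OF refl])
    fix c assume "c \<in> PiE ?B ?X"
    \<comment> \<open>The Schur correction involves the pivot row \<open>g\<close> and the pivot
      column \<open>c\<close> but not \<open>h\<close>, so it is a constant translation.\<close>
    define t where "t = (\<lambda>(i, j). c (i, j0) * v * g (i0, j))"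
    have "nonsing l I J (merge_on ?A g (merge_on ?B c h)) \<longleftrightarrow>
        nonsing l (I - {i0}) (J - {j0}) (\<lambda>x\<in>?C. (h x - t x) mod int l)" for h
    proof -
      let ?M = "merge_on ?A g (merge_on ?B c h)"
      have "nonsing l I J ?M \<longleftrightarrow> nonsing l (I - {i0}) (J - {j0})
          (\<lambda>(i, j). ?M (i, j) - ?M (i, j0) * v * ?M (i0, j))"
        using fin ij v by (intro nonsing_pivot) (auto simp: merge_on_def)
      also have "\<dots> \<longleftrightarrow> nonsing l (I - {i0}) (J - {j0}) (\<lambda>x\<in>?C. (h x - t x) mod int l)"
        using ij by (intro nonsing_cong) (auto simp: merge_on_def t_def cong_def mod_simps)
      finally show ?thesis .
    qed
    then show "card {h \<in> PiE ?C ?X. nonsing l I J (merge_on ?A g (merge_on ?B c h))}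
        = card {M \<in> PiE ?C ?X. nonsing l (I - {i0}) (J - {j0}) M}"
      using card_PiE_shift[OF l0, of ?C "nonsing l (I - {i0}) (J - {j0})" t] by simp
  qed
  also have "\<dots> = l ^ (card I - 1) * card {M \<in> PiE ?C ?X. nonsing l (I - {i0}) (J - {j0}) M}"
    using fin ij card_PiE_residues[of ?B l] by (simp add: card_cartesian_product)
  finally show ?thesis .
qed

text \<open>The order of GL_m over the field with l elements, found from one row: only the zero row
  is excluded, and each of the other l^m - 1 rows leaves l^(m-1) times the count for size m -
  1.\<close>

lemma card_nonsing:
  fixes I :: "'i set" and J :: "'j set"
  assumes l: "prime l" and "finite I" "finite J" "card I = m" "card J = m"
  shows "real (card {M \<in> PiE (I \<times> J) (\<lambda>_. {0..<int l}). nonsing l I J M}) =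
    real l ^ (m * m) * qpochhammer (inverse (real l)) (inverse (real l)) m"
  using assms(2-)
proof (induction m arbitrary: I J)
  case 0
  then have "{M \<in> PiE (I \<times> J) (\<lambda>_. {0..<int l}). nonsing l I J M} = {\<lambda>_. undefined}"
    by (auto simp: nonsing_def)
  then show ?case by (simp add: qpochhammer_def)
next
  case (Suc m)
  let ?X = "\<lambda>_. {0..<int l}"
  have l1: "l > 1" using l prime_gt_1_nat by blast
  obtain i0 where i0: "i0 \<in> I" using Suc.prems by fastforce
  let ?A = "{i0} \<times> J"
  let ?F = "\<lambda>g. card {h \<in> PiE (I \<times> J - ?A) ?X. nonsing l I J (merge_on ?A g h)}"
  let ?Z = "\<lambda>x\<in>?A. 0 :: int"
  let ?c = "real l ^ (m * m) * qpochhammer (inverse (real l)) (inverse (real l)) m"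
  have Z: "?Z \<in> PiE ?A ?X" using l1 by auto
  have finA: "finite (PiE ?A ?X)" using Suc.prems by (intro finite_PiE) auto
  have "card {M \<in> PiE (I \<times> J) ?X. nonsing l I J M} = (\<Sum>g\<in>PiE ?A ?X. ?F g)"
    using Suc.prems i0 by (intro card_PiE_split) auto
  then have "real (card {M \<in> PiE (I \<times> J) ?X. nonsing l I J M}) = (\<Sum>g\<in>PiE ?A ?X. real (?F g))"
    by simp
  also have "\<dots> = (\<Sum>g\<in>PiE ?A ?X. if g = ?Z then 0 else real l ^ m * ?c)"
  proof (rule sum.cong[OF refl])
    fix g assume g: "g \<in> PiE ?A ?X"
    show "real (?F g) = (if g = ?Z then 0 else real l ^ m * ?c)"
    proof (cases "g = ?Z")
      case True
      have "\<not> nonsing l I J (merge_on ?A g h)" for h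
        using l1 Suc.prems i0 True by (intro nonsing_zero_row[of l I i0]) (auto simp: merge_on_def)
      then show ?thesis using True by simp
    next
      case False
      then obtain j0 where j0: "j0 \<in> J" "g (i0, j0) \<noteq> 0"
        using g by (fastforce simp: fun_eq_iff PiE_def extensional_def)
      have "real (card {M \<in> PiE ((I - {i0}) \<times> (J - {j0})) ?X.
          nonsing l (I - {i0}) (J - {j0}) M}) = ?c"
        using Suc.prems i0 j0 by (intro Suc.IH) auto
      then show ?thesis
        using card_nonsing_pivot_row[OF l Suc.prems(1,2) i0 j0(1) g j0(2)] False Suc.prems
        by simp
    qed
  qed
  also have "\<dots> = (\<Sum>g\<in>PiE ?A ?X - {?Z}. real l ^ m * ?c)"
    using finA Z by (subst sum.remove[OF finA Z]) (auto intro!: sum.cong)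
  also have "\<dots> = (real l ^ Suc m - 1) * (real l ^ m * ?c)"
    using card_PiE_residues[of ?A l] Suc.prems finA Z l1
    by (simp add: card_Diff_singleton of_nat_diff)
  also have "\<dots> = real l ^ (Suc m * Suc m) * qpochhammer (inverse (real l)) (inverse (real l)) (Suc m)"
  proof -
    have 1: "real l ^ Suc m - 1 = real l ^ Suc m * (1 - inverse (real l) * inverse (real l) ^ m)"
      using l1 by (simp add: field_simps)
    have 2: "real l ^ (Suc m * Suc m) = real l ^ Suc m * real l ^ m * real l ^ (m * m)"
      by (simp add: power_add[symmetric])
    have 3: "qpochhammer (inverse (real l)) (inverse (real l)) (Suc m)
        = qpochhammer (inverse (real l)) (inverse (real l)) m
          * (1 - inverse (real l) * inverse (real l) ^ m)"
      by (simp add: qpochhammer_def)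
    show ?thesis unfolding 1 2 3 by (simp only: mult_ac)
  qed
  finally show ?case .
qed

section \<open>Counting nonsingular symmetric matrices\<close>

definition upairs :: "'i set \<Rightarrow> 'i set set" where
  "upairs I = (\<lambda>(i, j). {i, j}) ` (I \<times> I)"

definition urow :: "'i \<Rightarrow> 'i set \<Rightarrow> 'i set set" where
  "urow i I = (\<lambda>j. {i, j}) ` I"

text \<open>Symmetric matrices are encoded as functions on unordered pairs, singletons being the
  diagonal positions, so that the independent entries range over a product set.\<close>

definition symm :: "('i set \<Rightarrow> int) \<Rightarrow> 'i \<times> 'i \<Rightarrow> int" where
  "symm f = (\<lambda>(i, j). f {i, j})"

lemma upairs_mem: "i \<in> I \<Longrightarrow> j \<in> I \<Longrightarrow> {i, j} \<in> upairs I"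
  by (auto simp: upairs_def)

lemma urow_mem: "{i, j} \<in> urow k I \<longleftrightarrow> (i = k \<and> j \<in> I) \<or> (j = k \<and> i \<in> I)"
  by (auto simp: urow_def doubleton_eq_iff)

lemma urow_subset: "i \<in> I \<Longrightarrow> urow i I \<subseteq> upairs I"
  by (auto simp: upairs_def urow_def)

lemma upairs_Diff_urow: "i0 \<in> I \<Longrightarrow> upairs I - urow i0 I = upairs (I - {i0})"
proof (intro equalityI subsetI)
  fix s assume "i0 \<in> I" and s: "s \<in> upairs I - urow i0 I"
  then obtain i j where "i \<in> I" "j \<in> I" "s = {i, j}" unfolding upairs_def by blast
  then show "s \<in> upairs (I - {i0})" using s urow_mem[of i j i0 I] by (simp add: upairs_mem)
next
  fix s assume "i0 \<in> I" and s: "s \<in> upairs (I - {i0})"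
  then obtain i j where "i \<in> I - {i0}" "j \<in> I - {i0}" "s = {i, j}" unfolding upairs_def by blast
  then show "s \<in> upairs I - urow i0 I" using urow_mem[of i j i0 I] by (simp add: upairs_mem)
qed

lemma finite_upairs [simp]: "finite I \<Longrightarrow> finite (upairs I)"
  by (simp add: upairs_def)

lemma finite_urow [simp]: "finite I \<Longrightarrow> finite (urow i I)"
  by (simp add: urow_def)

lemma card_urow: "card (urow i I) = card I"
  unfolding urow_def by (rule card_image) (auto simp: inj_on_def doubleton_eq_iff)

text \<open>Lets a correction term that is symmetric in two indices be written as a function of the
  unordered pair, as \<open>card_PiE_shift\<close> requires.\<close>

lemma symmetric_Min_Max:
  fixes i j :: nat
  assumes "\<And>i j. E i j = E j i"
  shows "E (Min {i, j}) (Max {i, j}) = E i j"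
  using assms by (cases "i \<le> j") (auto simp: min_def max_def)

text \<open>With a diagonal pivot the Schur complement is symmetric again. Symmetry already fixes
  the pivot column, so no factor for free column entries appears.\<close>

lemma card_nonsing_symm_pivot1:
  fixes I :: "nat set"
  assumes l: "prime l" and fin: "finite I" and i0: "i0 \<in> I"
    and g: "g \<in> PiE (urow i0 I) (\<lambda>_. {0..<int l})" "g {i0} \<noteq> 0"
  shows "card {h \<in> PiE (upairs I - urow i0 I) (\<lambda>_. {0..<int l}).
            nonsing l I I (symm (merge_on (urow i0 I) g h))} =
    card {h \<in> PiE (upairs (I - {i0})) (\<lambda>_. {0..<int l}).
       nonsing l (I - {i0}) (I - {i0}) (symm h)}"
proof -
  let ?X = "\<lambda>_. {0..<int l}" let ?C = "upairs (I - {i0})"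
  have l0: "l > 0" using l prime_gt_0_nat by blast
  have "{i0} \<in> urow i0 I" using urow_mem[of i0 i0 i0 I] i0 by simp
  then have "g {i0} \<in> {0..<int l}" using g(1) by (rule PiE_mem[rotated])
  then obtain v where v: "[v * g {i0} = 1] (mod int l)"
    using prime_residue_inverse[OF l _ g(2)] by blast
  define E where "E i j = g {i0, i} * v * g {i0, j}" for i j
  define t where "t s = E (Min s) (Max s)" for s
  have t: "t {i, j} = E i j" for i j
    unfolding t_def by (rule symmetric_Min_Max) (simp add: E_def)
  have "nonsing l I I (symm (merge_on (urow i0 I) g h)) \<longleftrightarrow>
      nonsing l (I - {i0}) (I - {i0}) (symm (\<lambda>x\<in>?C. (h x - t x) mod int l))" for h
  proof -
    let ?M = "symm (merge_on (urow i0 I) g h)"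
    have "nonsing l I I ?M \<longleftrightarrow> nonsing l (I - {i0}) (I - {i0})
        (\<lambda>(i, j). ?M (i, j) - ?M (i, i0) * v * ?M (i0, j))"
      using fin i0 v urow_mem[of i0 i0 i0 I] by (intro nonsing_pivot) (auto simp: merge_on_def symm_def)
    also have "\<dots> \<longleftrightarrow> nonsing l (I - {i0}) (I - {i0}) (symm (\<lambda>x\<in>?C. (h x - t x) mod int l))"
    proof (intro nonsing_cong)
      fix i j assume ij: "i \<in> I - {i0}" "j \<in> I - {i0}"
      have "?M (i, j) = h {i, j}" "?M (i, i0) = g {i0, i}" "?M (i0, j) = g {i0, j}"
        using ij i0 by (auto simp: symm_def merge_on_def urow_mem insert_commute)
      then show "[(\<lambda>(i, j). ?M (i, j) - ?M (i, i0) * v * ?M (i0, j)) (i, j) =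
         symm (\<lambda>x\<in>?C. (h x - t x) mod int l) (i, j)] (mod int l)"
        using upairs_mem[OF ij] by (simp add: symm_def t E_def cong_def mod_simps)
    qed
    finally show ?thesis .
  qed
  then show ?thesis
    using card_PiE_shift[OF l0, of ?C "\<lambda>h. nonsing l (I - {i0}) (I - {i0}) (symm h)" t]
    unfolding upairs_Diff_urow[OF i0] by simp
qed

text \<open>When the diagonal entry vanishes, the pivots \<open>(i0, p)\<close> and
  \<open>(p, i0)\<close> are used in turn. The entries of row \<open>p\<close> outside column
  \<open>i0\<close> are free, which gives the factor, and a symmetric matrix smaller by two
  remains.\<close>

lemma card_nonsing_symm_pivot2:
  fixes I :: "nat set"
  assumes l: "prime l" and fin: "finite I" and i0: "i0 \<in> I" and p: "p \<in> I"
    and g: "g \<in> PiE (urow i0 I) (\<lambda>_. {0..<int l})" "g {i0} = 0" "g {i0, p} \<noteq> 0"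
  shows "card {h \<in> PiE (upairs I - urow i0 I) (\<lambda>_. {0..<int l}).
            nonsing l I I (symm (merge_on (urow i0 I) g h))} =
    l ^ (card I - 1) * card {h \<in> PiE (upairs (I - {i0} - {p})) (\<lambda>_. {0..<int l}).
       nonsing l (I - {i0} - {p}) (I - {i0} - {p}) (symm h)}"
proof -
  let ?X = "\<lambda>_. {0..<int l}" let ?I = "I - {i0}" let ?C = "upairs (?I - {p})"
  let ?A = "urow i0 I" and ?B = "urow p ?I"
  have l0: "l > 0" using l prime_gt_0_nat by blast
  have pI: "p \<in> ?I" using g p by auto
  have "{i0, p} \<in> urow i0 I" using urow_mem[of i0 p i0 I] p by simp
  then have "g {i0, p} \<in> {0..<int l}" using g(1) by (rule PiE_mem[rotated])
  then obtain v where v: "[v * g {i0, p} = 1] (mod int l)"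
    using prime_residue_inverse[OF l _ g(3)] by blast
  have "card {h \<in> PiE (upairs I - ?A) ?X. nonsing l I I (symm (merge_on ?A g h))}
     = (\<Sum>c\<in>PiE ?B ?X. card {h \<in> PiE ?C ?X. nonsing l I I (symm (merge_on ?A g (merge_on ?B c h)))})"
    unfolding upairs_Diff_urow[OF i0] upairs_Diff_urow[OF pI, symmetric]
    using fin pI by (intro card_PiE_split) (auto simp: urow_subset)
  also have "\<dots> = (\<Sum>c\<in>PiE ?B ?X. card {h \<in> PiE ?C ?X. nonsing l (?I - {p}) (?I - {p}) (symm h)})"
  proof (rule sum.cong[OF refl])
    fix c assume "c \<in> PiE ?B ?X"
    \<comment> \<open>Total correction of the two eliminations, the last term stemming from the
      diagonal entry \<open>c {p}\<close>. The sum is symmetric in \<open>i\<close> and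
      \<open>j\<close>, although the correction of the first elimination alone is not.\<close>
    define E where "E i j = c {p, i} * v * g {i0, j} + g {i0, i} * v * c {p, j}
        - g {i0, i} * v * c {p} * v * g {i0, j}" for i j
    define t where "t s = E (Min s) (Max s)" for s
    have t: "t {i, j} = E i j" for i j
      unfolding t_def by (rule symmetric_Min_Max) (simp add: E_def algebra_simps)
    have "nonsing l I I (symm (merge_on ?A g (merge_on ?B c h))) \<longleftrightarrow>
        nonsing l (?I - {p}) (?I - {p}) (symm (\<lambda>x\<in>?C. (h x - t x) mod int l))" for h
    proof -
      let ?M = "symm (merge_on ?A g (merge_on ?B c h))"
      let ?M1 = "\<lambda>(i, j). ?M (i, j) - ?M (i, p) * v * ?M (i0, j)"
      have M0: "?M (i, i0) = g {i0, i}" "?M (i0, i) = g {i0, i}" if "i \<in> I" for i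
        using that i0 by (auto simp: symm_def merge_on_def urow_mem insert_commute)
      have Mp: "?M (i, p) = c {p, i}" "?M (p, i) = c {p, i}" if "i \<in> ?I" for i
        using that i0 pI by (auto simp: symm_def merge_on_def urow_mem insert_commute)
      have Mij: "?M (i, j) = h {i, j}" if "i \<in> ?I - {p}" "j \<in> ?I - {p}" for i j
        using that by (auto simp: symm_def merge_on_def urow_mem)
      have "nonsing l I I ?M \<longleftrightarrow> nonsing l ?I (I - {p}) ?M1"
        using fin i0 p v M0[OF p] by (intro nonsing_pivot) simp_all
      \<comment> \<open>Second pivot \<open>(p, i0)\<close>: since \<open>g {i0} = 0\<close>, the
        first elimination leaves this entry equal to \<open>g {i0, p}\<close>, and the same
        \<open>v\<close> inverts it.\<close>
      also have "\<dots> \<longleftrightarrow> nonsing l (?I - {p}) (I - {p} - {i0})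
         (\<lambda>(i, j). ?M1 (i, j) - ?M1 (i, i0) * v * ?M1 (p, j))"
        using fin i0 pI v M0[OF p] M0[OF i0] g(2) by (intro nonsing_pivot) auto
      also have "\<dots> \<longleftrightarrow> nonsing l (?I - {p}) (?I - {p})
         (\<lambda>(i, j). ?M1 (i, j) - ?M1 (i, i0) * v * ?M1 (p, j))"
        by (simp add: Diff_insert2[symmetric] insert_commute)
      also have "\<dots> \<longleftrightarrow> nonsing l (?I - {p}) (?I - {p}) (symm (\<lambda>x\<in>?C. (h x - t x) mod int l))"
      proof (intro nonsing_cong)
        fix i j assume ij: "i \<in> ?I - {p}" "j \<in> ?I - {p}"
        then have ij': "i \<in> I" "j \<in> I" "i \<in> ?I" "j \<in> ?I" by auto
        have "?M1 (i, j) - ?M1 (i, i0) * v * ?M1 (p, j) = h {i, j} - E i j"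
          using g(2) by (simp add: M0[OF ij'(1)] M0[OF ij'(2)] M0[OF i0] Mp[OF ij'(3)] Mp[OF ij'(4)]
              Mp[OF pI] Mij[OF ij] E_def algebra_simps)
        then show "[(\<lambda>(i, j). ?M1 (i, j) - ?M1 (i, i0) * v * ?M1 (p, j)) (i, j) =
           symm (\<lambda>x\<in>?C. (h x - t x) mod int l) (i, j)] (mod int l)"
          using upairs_mem[OF ij] by (simp add: symm_def t cong_def mod_simps)
      qed
      finally show ?thesis .
    qed
    then show "card {h \<in> PiE ?C ?X. nonsing l I I (symm (merge_on ?A g (merge_on ?B c h)))}
        = card {h \<in> PiE ?C ?X. nonsing l (?I - {p}) (?I - {p}) (symm h)}"
      using card_PiE_shift[OF l0, of ?C "\<lambda>h. nonsing l (?I - {p}) (?I - {p}) (symm h)" t] by simp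
  qed
  also have "\<dots> = l ^ (card I - 1) *
      card {h \<in> PiE ?C ?X. nonsing l (?I - {p}) (?I - {p}) (symm h)}"
    using fin i0 card_PiE_residues[of ?B l] by (simp add: card_urow)
  finally show ?thesis .
qed

text \<open>The classical number of nonsingular symmetric matrices of size m over a field with L
  elements: the first factor counts all symmetric matrices, the second is the proportion of
  nonsingular ones, with m / 2 rounded up.\<close>

definition nonsing_symm_count :: "real \<Rightarrow> nat \<Rightarrow> real" where
  "nonsing_symm_count L m =
    L ^ (m * (m + 1) div 2) * qpochhammer (inverse L) (inverse L ^ 2) ((m + 1) div 2)"

text \<open>The terms count by one row: (L - 1) L^(m-1) rows have a nonzero diagonal entry; L^(m-1)
  - 1 nonzero rows have a zero one, each with the factor L^(m-1) of the double elimination. For m =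
  1 the second term vanishes, so the truncated m - 2 is harmless.\<close>

lemma nonsing_symm_count_rec:
  assumes "L > 0" "m > 0"
  shows "nonsing_symm_count L m = (L - 1) * L ^ (m - 1) * nonsing_symm_count L (m - 1)
    + (L ^ (m - 1) - 1) * L ^ (m - 1) * nonsing_symm_count L (m - 2)"
proof -
  define P where "P t = qpochhammer (inverse L) (inverse L ^ 2) t" for t
  have PS: "P (Suc t) = P t * (1 - 1 / (L * (L ^ t)\<^sup>2))" for t
    using assms by (simp add: P_def qpochhammer_def field_simps power_mult[symmetric])
  show ?thesis
  proof (cases "odd m")
    case True
    then obtain t where t: "m = 2 * t + 1" by (elim oddE)
    define Y where "Y = L ^ t"
    have Y: "L ^ (2 * t) = Y\<^sup>2" "Y > 0"
      using assms by (simp_all add: Y_def power_mult[symmetric] mult.commute)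
    show ?thesis
    proof (cases "t = 0")
      case True
      then show ?thesis using t assms
        by (simp add: nonsing_symm_count_def qpochhammer_def field_simps)
    next
      case False
      then obtain u where u: "t = Suc u" using not0_implies_Suc by blast
      define E where "E = L ^ (t * (2 * t - 1))"
      have e: "(2 * t + 1) * (2 * t + 1 + 1) div 2 = t * (2 * t - 1) + 2 * t + 2 * t + 1"
        "(2 * t) * (2 * t + 1) div 2 = t * (2 * t - 1) + 2 * t"
        "(2 * t - 1) * (2 * t - 1 + 1) div 2 = t * (2 * t - 1)"
        "(2 * t + 1 + 1) div 2 = Suc t" "(2 * t + 1) div 2 = t" "(2 * t - 1 + 1) div 2 = t"
        by (simp_all add: u algebra_simps)
      have 1: "nonsing_symm_count L (2 * t + 1) = E * Y\<^sup>2 * Y\<^sup>2 * L * (P t * (1 - 1 / (L * Y\<^sup>2)))"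
        unfolding nonsing_symm_count_def P_def[symmetric] e PS Y_def[symmetric]
        by (simp only: power_add Y E_def power_one_right)
      have 2: "nonsing_symm_count L (2 * t) = E * Y\<^sup>2 * P t"
        unfolding nonsing_symm_count_def P_def[symmetric] e by (simp only: power_add Y E_def)
      have 3: "nonsing_symm_count L (2 * t - 1) = E * P t"
        unfolding nonsing_symm_count_def P_def[symmetric] e E_def ..
      have m: "m - 1 = 2 * t" "m - 2 = 2 * t - 1" using t by auto
      have 1: "nonsing_symm_count L m = E * Y\<^sup>2 * Y\<^sup>2 * L * (P t * (1 - 1 / (L * Y\<^sup>2)))"
        using 1 t by simp
      show ?thesis unfolding 1 m 2 3 Y(1)
        using Y(2) assms(1) by (simp add: field_simps power2_eq_square)
    qed
  next
    case False
    then obtain t where t: "m = 2 * t + 2"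
      using assms(2) by (metis dvdE even_Suc oddE old.nat.exhaust less_numeral_extra(3) Suc_1 add_Suc_right Suc_eq_plus1)
    define Y where "Y = L ^ t"
    have Y: "L ^ (2 * t) = Y\<^sup>2" "Y > 0"
      using assms by (simp_all add: Y_def power_mult[symmetric] mult.commute)
    define E where "E = L ^ (t * (2 * t + 1))"
    have e: "(2 * t + 2) * (2 * t + 2 + 1) div 2 = t * (2 * t + 1) + 2 * t + 2 * t + 3"
      "(2 * t + 1) * (2 * t + 1 + 1) div 2 = t * (2 * t + 1) + 2 * t + 1"
      "(2 * t) * (2 * t + 1) div 2 = t * (2 * t + 1)"
      "(2 * t + 2 + 1) div 2 = Suc t" "(2 * t + 1 + 1) div 2 = Suc t" "(2 * t + 1) div 2 = t"
      by (simp_all add: algebra_simps)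
    have m: "m - 1 = 2 * t + 1" "m - 2 = 2 * t" using t by simp_all
    have 1: "nonsing_symm_count L m = E * Y\<^sup>2 * Y\<^sup>2 * L ^ 3 * (P t * (1 - 1 / (L * Y\<^sup>2)))"
      unfolding nonsing_symm_count_def P_def[symmetric] t e PS Y_def[symmetric]
      by (simp only: power_add Y E_def)
    have 2: "nonsing_symm_count L (m - 1) = E * Y\<^sup>2 * L * (P t * (1 - 1 / (L * Y\<^sup>2)))"
      unfolding nonsing_symm_count_def P_def[symmetric] m e PS Y_def[symmetric]
      by (simp only: power_add Y E_def power_one_right)
    have 3: "nonsing_symm_count L (m - 2) = E * P t"
      unfolding nonsing_symm_count_def P_def[symmetric] m e E_def ..
    have 4: "L ^ (m - 1) = L * Y\<^sup>2" by (simp add: t Y)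
    show ?thesis unfolding 1 2 3 4
      using Y assms by (simp add: field_simps power2_eq_square power3_eq_cube)
  qed
qed

text \<open>Strong induction, because elimination lowers the size by one or by two according to
  whether the diagonal entry of row \<open>i0\<close> is a pivot; a zero row contributes
  nothing.\<close>

lemma card_nonsing_symm:
  fixes I :: "nat set"
  assumes l: "prime l" and "finite I"
  shows "real (card {h \<in> PiE (upairs I) (\<lambda>_. {0..<int l}). nonsing l I I (symm h)}) =
    nonsing_symm_count (real l) (card I)"
  using assms(2)
proof (induction "card I" arbitrary: I rule: less_induct)
  case less
  let ?X = "\<lambda>_. {0..<int l}"
  have l1: "l > 1" using l prime_gt_1_nat by blast
  show ?case
  proof (cases "I = {}")
    case True
    then have "{h \<in> PiE (upairs I) ?X. nonsing l I I (symm h)} = {\<lambda>_. undefined}"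
      by (auto simp: nonsing_def upairs_def)
    then show ?thesis using True by (simp add: nonsing_symm_count_def qpochhammer_def)
  next
    case False
    then obtain i0 where i0: "i0 \<in> I" by blast
    define m where "m = card I"
    have m0: "m > 0" using False less.prems m_def by auto
    let ?A = "urow i0 I"
    have r0: "{i0} \<in> ?A" using urow_mem[of i0 i0 i0 I] i0 by simp
    let ?F = "\<lambda>g. card {h \<in> PiE (upairs I - ?A) ?X. nonsing l I I (symm (merge_on ?A g h))}"
    let ?Z = "\<lambda>x\<in>?A. 0 :: int"
    let ?c1 = "nonsing_symm_count (real l) (m - 1)"
    let ?c2 = "real l ^ (m - 1) * nonsing_symm_count (real l) (m - 2)"
    let ?P = "PiE ?A ?X"
    have finA: "finite ?P" using less.prems by (intro finite_PiE) auto
    have "card {h \<in> PiE (upairs I) ?X. nonsing l I I (symm h)} = (\<Sum>g\<in>?P. ?F g)"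
      using less.prems i0 by (intro card_PiE_split) (auto simp: urow_subset)
    then have "real (card {h \<in> PiE (upairs I) ?X. nonsing l I I (symm h)})
        = (\<Sum>g\<in>?P. real (?F g))" by simp
    also have "\<dots> = (\<Sum>g\<in>?P. if g {i0} \<noteq> 0 then ?c1 else if g = ?Z then 0 else ?c2)"
    proof (rule sum.cong[OF refl])
      fix g assume g: "g \<in> ?P"
      consider (1) "g {i0} \<noteq> 0" | (2) "g = ?Z" | (3) "g {i0} = 0" "g \<noteq> ?Z" by blast
      then show "real (?F g) = (if g {i0} \<noteq> 0 then ?c1 else if g = ?Z then 0 else ?c2)"
      proof cases
        case 1
        have "card (I - {i0}) < card I" using i0 less.prems m0 m_def by (simp add: card_Diff_singleton)
        then show ?thesis
          using card_nonsing_symm_pivot1[OF l less.prems i0 g 1] 1 less.hyps[of "I - {i0}"]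
            less.prems i0 by (simp add: m_def)
      next
        case 2
        have "\<not> nonsing l I I (symm (merge_on ?A g h))" for h
          using l1 less.prems i0 2
          by (intro nonsing_zero_row[of l I i0]) (auto simp: merge_on_def symm_def urow_mem)
        then show ?thesis using 2 r0 by simp
      next
        case 3
        then obtain s where "s \<in> ?A" "g s \<noteq> 0"
          using g by (fastforce simp: fun_eq_iff PiE_def extensional_def)
        then obtain p where p: "p \<in> I" "g {i0, p} \<noteq> 0" unfolding urow_def by blast
        then have pn: "p \<noteq> i0" using 3 by auto
        have c: "card (I - {i0} - {p}) = m - 2"
          using i0 p pn less.prems by (simp add: m_def)
        then show ?thesis
          using card_nonsing_symm_pivot2[OF l less.prems i0 p(1) g 3(1) p(2)] 3
            less.hyps[of "I - {i0} - {p}"] less.prems m0 m_def by simp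
      qed
    qed
    also have "\<dots> = (\<Sum>g\<in>{g\<in>?P. g {i0} \<noteq> 0}. ?c1)
        + (\<Sum>g\<in>{g\<in>?P. g {i0} = 0}. if g = ?Z then 0 else ?c2)"
      using finA by (simp add: sum.If_cases Int_def conj_commute)
    also have "\<dots> = (real l - 1) * real l ^ (m - 1) * ?c1 + (real l ^ (m - 1) - 1) * ?c2"
    proof -
      have "{g\<in>?P. g {i0} = 0} = PiE ?A (\<lambda>r. if r = {i0} then {0} else {0..<int l})"
      proof (rule Set.set_eqI, rule iffI)
        fix f assume "f \<in> {g\<in>?P. g {i0} = 0}"
        then show "f \<in> PiE ?A (\<lambda>r. if r = {i0} then {0} else {0..<int l})"
          by (simp add: PiE_iff)
      next
        fix f assume f: "f \<in> PiE ?A (\<lambda>r. if r = {i0} then {0} else {0..<int l})"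
        have "f r \<in> {0..<int l}" if "r \<in> ?A" for r
          using PiE_mem[OF f that] l1 by (cases "r = {i0}") simp_all
        then show "f \<in> {g\<in>?P. g {i0} = 0}"
          using f PiE_mem[OF f r0] by (simp add: PiE_iff)
      qed
      moreover have "card (PiE ?A (\<lambda>r. if r = {i0} then {0} else {0..<int l})) = l ^ (m - 1)"
        using less.prems r0
        by (simp add: card_PiE prod.remove[of ?A "{i0}"] card_urow m_def)
      ultimately have n0: "card {g\<in>?P. g {i0} = 0} = l ^ (m - 1)" by simp
      have "card ?P = card {g\<in>?P. g {i0} = 0} + card {g\<in>?P. g {i0} \<noteq> 0}"
        using finA by (subst card_Un_disjoint[symmetric]) (auto intro: arg_cong[of _ _ card])
      then have "l ^ m = l ^ (m - 1) + card {g\<in>?P. g {i0} \<noteq> 0}"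
        unfolding n0 using less.prems card_PiE_residues[of ?A l]
        by (simp only: finite_urow card_urow m_def)
      then have "real l ^ m = real l ^ (m - 1) + real (card {g\<in>?P. g {i0} \<noteq> 0})"
        unfolding of_nat_power[symmetric] of_nat_add[symmetric] by (rule arg_cong)
      then have n1: "real (card {g\<in>?P. g {i0} \<noteq> 0}) = (real l - 1) * real l ^ (m - 1)"
        using power_Suc[of "real l" "m - 1"] m0 by (simp add: algebra_simps del: power_Suc)
      have Z: "?Z \<in> {g\<in>?P. g {i0} = 0}" using l1 r0 by auto
      have "(\<Sum>g\<in>{g\<in>?P. g {i0} = 0}. if g = ?Z then 0 else ?c2)
          = (\<Sum>g\<in>{g\<in>?P. g {i0} = 0} - {?Z}. ?c2)"
        using finA Z by (subst sum.remove[OF _ Z]) (auto intro!: sum.cong)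
      also have "\<dots> = (real l ^ (m - 1) - 1) * ?c2"
        using n0 finA Z l1 by (simp add: card_Diff_singleton of_nat_diff)
      finally show ?thesis using n1 by simp
    qed
    also have "\<dots> = nonsing_symm_count (real l) m"
      using nonsing_symm_count_rec[of "real l" m] l1 m0 by (simp add: mult.assoc)
    finally show ?thesis by (simp add: m_def)
  qed
qed

text \<open>An injective map between finite sets of equal size is surjective. This supplies the
  vector that extends a kernel vector of one block in
  \<open>nonsing_block_triangular\<close>.\<close>

lemma nonsing_solvable:
  assumes l: "l > 0" and fin: "finite I" "finite J" "card I = card J" and N: "nonsing l I J M"
  shows "\<exists>x. \<forall>j\<in>J. [(\<Sum>i\<in>I. x i * M (i, j)) = y j] (mod int l)"
proof -
  let ?X = "\<lambda>_. {0..<int l}"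
  define T where "T x = (\<lambda>j\<in>J. (\<Sum>i\<in>I. x i * M (i, j)) mod int l)" for x
  have TJ: "T ` PiE I ?X \<subseteq> PiE J ?X" using l by (auto simp: T_def)
  have inj: "inj_on T (PiE I ?X)"
  proof (rule inj_onI)
    fix x x' assume x: "x \<in> PiE I ?X" "x' \<in> PiE I ?X" and eq: "T x = T x'"
    have "int l dvd (\<Sum>i\<in>I. (x i - x' i) * M (i, j))" if "j \<in> J" for j
    proof -
      have "(\<Sum>i\<in>I. x i * M (i, j)) mod int l = (\<Sum>i\<in>I. x' i * M (i, j)) mod int l"
        using fun_cong[OF eq, of j] that by (simp add: T_def)
      then show ?thesis
        by (simp add: left_diff_distrib sum_subtractf mod_eq_dvd_iff)
    qed
    then have d: "int l dvd x i - x' i" if "i \<in> I" for i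
      using spec[OF N[unfolded nonsing_def], of "\<lambda>i. x i - x' i"] that by blast
    have "x i = x' i" for i
    proof (cases "i \<in> I")
      case True
      then have "x i \<in> {0..<int l}" "x' i \<in> {0..<int l}" using x by auto
      then show ?thesis using d[OF True] by (metis atLeastLessThan_iff mod_eq_dvd_iff mod_pos_pos_trivial)
    next
      case False
      then show ?thesis using x by (simp add: PiE_def extensional_def)
    qed
    then show "x = x'" by blast
  qed
  have "card (T ` PiE I ?X) = card (PiE J ?X)"
    using card_image[OF inj] fin by (simp add: card_PiE_residues)
  then have surj: "T ` PiE I ?X = PiE J ?X"
    using TJ fin by (intro card_subset_eq finite_PiE) auto
  have "(\<lambda>j\<in>J. y j mod int l) \<in> PiE J ?X" using l by auto
  then obtain x where x: "T x = (\<lambda>j\<in>J. y j mod int l)" using surj by (metis imageE)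
  have "[(\<Sum>i\<in>I. x i * M (i, j)) = y j] (mod int l)" if "j \<in> J" for j
    using fun_cong[OF x, of j] that by (simp add: T_def cong_def)
  then show ?thesis by blast
qed

section \<open>Integral combinations and presentations of abelian groups\<close>

definition lin :: "('k, 'z) monoid_scheme \<Rightarrow> 'i set \<Rightarrow> ('i \<Rightarrow> 'k) \<Rightarrow> ('i \<Rightarrow> int) \<Rightarrow> 'k" where
  "lin K I x c = finprod K (\<lambda>i. x i [^]\<^bsub>K\<^esub> c i) I"

context comm_group
begin

lemma lin_closed: "x \<in> I \<rightarrow> carrier G \<Longrightarrow> lin G I x c \<in> carrier G"
  unfolding lin_def by (rule finprod_closed) auto

lemma lin_add:
  "x \<in> I \<rightarrow> carrier G \<Longrightarrow> lin G I x (\<lambda>i. c i + d i) = lin G I x c \<otimes> lin G I x d"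
proof -
  assume x: "x \<in> I \<rightarrow> carrier G"
  have "lin G I x (\<lambda>i. c i + d i) = finprod G (\<lambda>i. x i [^] c i \<otimes> x i [^] d i) I"
    unfolding lin_def using x by (intro finprod_cong) (auto simp: simp_implies_def int_pow_mult Pi_iff)
  also have "\<dots> = lin G I x c \<otimes> lin G I x d"
    unfolding lin_def using x by (intro finprod_multf) auto
  finally show ?thesis .
qed

lemma lin_zero: "lin G I x (\<lambda>_. 0) = \<one>"
  by (simp add: lin_def)

lemma lin_empty [simp]: "lin G {} x c = \<one>"
  by (simp add: lin_def)

lemma lin_insert:
  "finite I \<Longrightarrow> i \<notin> I \<Longrightarrow> x \<in> insert i I \<rightarrow> carrier G \<Longrightarrow>
    lin G (insert i I) x c = x i [^] c i \<otimes> lin G I x c"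
  unfolding lin_def by (rule finprod_insert) auto

lemma lin_cong:
  assumes "x \<in> I \<rightarrow> carrier G" "\<And>i. i \<in> I \<Longrightarrow> x i = y i" "\<And>i. i \<in> I \<Longrightarrow> c i = d i"
  shows "lin G I x c = lin G I y d"
  unfolding lin_def
  by (rule finprod_cong') (use assms in \<open>auto simp: Pi_iff\<close>)

lemma lin_hom:
  assumes "comm_group K" "h \<in> hom G K" "finite I" "x \<in> I \<rightarrow> carrier G"
  shows "h (lin G I x c) = lin K I (\<lambda>i. h (x i)) c"
  using assms(3,4)
proof (induction I rule: finite_induct)
  case empty
  then show ?case
    using hom_one[OF assms(2)] assms(1) by (simp add: comm_group.lin_empty comm_group.axioms(2))
next
  case (insert i I)
  have "h (lin G (insert i I) x c) = h (x i [^] c i \<otimes> lin G I x c)"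
    using insert by (simp add: lin_insert)
  also have "\<dots> = h (x i) [^]\<^bsub>K\<^esub> c i \<otimes>\<^bsub>K\<^esub> lin K I (\<lambda>i. h (x i)) c"
    using insert assms(1,2)
    by (auto simp: hom_mult lin_closed hom_int_pow comm_group.axioms(2))
  also have "\<dots> = lin K (insert i I) (\<lambda>i. h (x i)) c"
    using insert assms(2)
    by (subst comm_group.lin_insert[OF assms(1)]) (auto simp: hom_in_carrier Pi_iff)
  finally show ?case .
qed

lemma lin_subgroup:
  assumes "subgroup H G" "finite I" "x \<in> I \<rightarrow> H"
  shows "lin G I x c \<in> H"
  using assms(2,3)
proof (induction I rule: finite_induct)
  case empty
  then show ?case using subgroup.one_closed[OF assms(1)] by simp
next
  case (insert i I)
  have "x \<in> insert i I \<rightarrow> carrier G" using insert(4) subgroup.mem_carrier[OF assms(1)] by auto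
  moreover have "x i [^] c i \<in> H" using insert(4) subgroup_int_pow_closed[OF assms(1)] by auto
  ultimately show ?case using insert subgroup.m_closed[OF assms(1)] by (simp add: lin_insert)
qed

lemma lin_delta:
  assumes "finite I" "i \<in> I" "x \<in> I \<rightarrow> carrier G"
  shows "lin G I x (\<lambda>j. if j = i then z else 0) = x i [^] z"
proof -
  have xi: "x \<in> insert i (I - {i}) \<rightarrow> carrier G" "insert i (I - {i}) = I" using assms by auto
  have "lin G (insert i (I - {i})) x (\<lambda>j. if j = i then z else 0)
      = x i [^] z \<otimes> lin G (I - {i}) x (\<lambda>j. if j = i then z else 0)"
    using lin_insert[of "I - {i}" i x "\<lambda>j. if j = i then z else 0"] assms xi by simp
  also have "lin G (I - {i}) x (\<lambda>j. if j = i then z else 0) = lin G (I - {i}) x (\<lambda>_. 0)"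
    using assms by (intro lin_cong) auto
  finally show ?thesis using xi assms by (auto simp: lin_zero)
qed

lemma additive_zero:
  fixes \<Phi> :: "('i \<Rightarrow> int) \<Rightarrow> 'a"
  assumes cl: "\<And>c. \<Phi> c \<in> carrier G" and ad: "\<And>c d. \<Phi> (\<lambda>i. c i + d i) = \<Phi> c \<otimes> \<Phi> d"
  shows "\<Phi> (\<lambda>_. 0) = \<one>"
  using ad[of "\<lambda>_. 0" "\<lambda>_. 0"] cl[of "\<lambda>_. 0"] by simp

lemma additive_int_pow:
  fixes \<Phi> :: "('i \<Rightarrow> int) \<Rightarrow> 'a"
  assumes cl: "\<And>c. \<Phi> c \<in> carrier G" and ad: "\<And>c d. \<Phi> (\<lambda>i. c i + d i) = \<Phi> c \<otimes> \<Phi> d"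
  shows "\<Phi> (\<lambda>i. z * c i) = \<Phi> c [^] z"
proof -
  have zero: "\<Phi> (\<lambda>_. 0) = \<one>" by (rule additive_zero[OF assms])
  have nat: "\<Phi> (\<lambda>i. int t * c i) = \<Phi> c [^] t" for t
  proof (induction t)
    case 0
    then show ?case by (simp add: zero)
  next
    case (Suc t)
    then show ?case using ad[of "\<lambda>i. int t * c i" c] by (simp add: algebra_simps)
  qed
  show ?thesis
  proof (cases z rule: int_cases2)
    case (nonneg t)
    then show ?thesis using nat by (simp add: int_pow_int)
  next
    case (nonpos t)
    have "\<Phi> (\<lambda>i. z * c i) \<otimes> \<Phi> (\<lambda>i. int t * c i) = \<one>"
      using ad[of "\<lambda>i. z * c i" "\<lambda>i. int t * c i"] zero nonpos by simp
    then have "\<Phi> (\<lambda>i. z * c i) = inv (\<Phi> (\<lambda>i. int t * c i))"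
      using cl by (metis inv_equality inv_inv)
    then show ?thesis using nat nonpos cl by (simp add: int_pow_neg_int)
  qed
qed

lemma lin_int_pow:
  "x \<in> I \<rightarrow> carrier G \<Longrightarrow> lin G I x (\<lambda>i. z * c i) = lin G I x c [^] z"
  by (rule additive_int_pow[of "lin G I x"]) (auto simp: lin_closed lin_add)

lemma lin_nat_pow:
  "x \<in> I \<rightarrow> carrier G \<Longrightarrow> lin G I x (\<lambda>i. int z * c i) = lin G I x c [^] z"
  using lin_int_pow[of x I "int z" c] by (simp add: int_pow_int)

lemma lin_neg: "x \<in> I \<rightarrow> carrier G \<Longrightarrow> lin G I x (\<lambda>i. - c i) = inv (lin G I x c)"
  using lin_int_pow[of x I "-1" c] by (simp add: int_pow_neg lin_closed)

end

text \<open>An isomorphism of the direct sum of the Z / N i with K, written as an additive map on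
  integer families so that coordinates need not be reduced. The kernel condition does not see
  entries outside \<open>I\<close>, so these are irrelevant.\<close>

definition presents ::
    "('k, 'z) monoid_scheme \<Rightarrow> 'i set \<Rightarrow> ('i \<Rightarrow> nat) \<Rightarrow> (('i \<Rightarrow> int) \<Rightarrow> 'k) \<Rightarrow> bool" where
  "presents K I N \<Phi> \<longleftrightarrow>
    (\<forall>c. \<Phi> c \<in> carrier K) \<and> (\<forall>c d. \<Phi> (\<lambda>i. c i + d i) = \<Phi> c \<otimes>\<^bsub>K\<^esub> \<Phi> d) \<and>
    (\<forall>x\<in>carrier K. \<exists>c. x = \<Phi> c) \<and> (\<forall>c. \<Phi> c = \<one>\<^bsub>K\<^esub> \<longleftrightarrow> (\<forall>i\<in>I. int (N i) dvd c i))"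

lemma presentsD:
  assumes "presents K I N \<Phi>"
  shows "\<Phi> c \<in> carrier K" "\<Phi> (\<lambda>i. c i + d i) = \<Phi> c \<otimes>\<^bsub>K\<^esub> \<Phi> d"
    "x \<in> carrier K \<Longrightarrow> \<exists>c. x = \<Phi> c" "\<Phi> c = \<one>\<^bsub>K\<^esub> \<longleftrightarrow> (\<forall>i\<in>I. int (N i) dvd c i)"
  using assms by (auto simp: presents_def)

lemma presents_int_pow:
  assumes "presents K I N \<Phi>" "comm_group K"
  shows "\<Phi> (\<lambda>i. z * c i) = \<Phi> c [^]\<^bsub>K\<^esub> z"
  by (rule comm_group.additive_int_pow[OF assms(2)]) (use presentsD[OF assms(1)] in auto)

lemma presents_nat_pow:
  assumes "presents K I N \<Phi>" "comm_group K"
  shows "\<Phi> (\<lambda>i. int z * c i) = \<Phi> c [^]\<^bsub>K\<^esub> z"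
  using presents_int_pow[OF assms, of "int z"] by (simp add: int_pow_int)

lemma presents_eq:
  assumes "presents K I N \<Phi>" "comm_group K"
  shows "\<Phi> c = \<Phi> d \<longleftrightarrow> (\<forall>i\<in>I. [c i = d i] (mod int (N i)))"
proof -
  interpret comm_group K by fact
  have "\<Phi> c = \<Phi> (\<lambda>i. c i - d i) \<otimes>\<^bsub>K\<^esub> \<Phi> d"
    using presentsD(2)[OF assms(1), of "\<lambda>i. c i - d i" d] by simp
  then have "\<Phi> c = \<Phi> d \<longleftrightarrow> \<Phi> (\<lambda>i. c i - d i) = \<one>\<^bsub>K\<^esub>"
    using r_cancel_one[of "\<Phi> d" "\<Phi> (\<lambda>i. c i - d i)"] presentsD(1)[OF assms(1)] by simp
  then show ?thesis
    using presentsD(4)[OF assms(1)] by (simp add: cong_iff_dvd_diff)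
qed

lemma presents_sum:
  assumes P: "presents K I N \<Phi>" and K: "comm_group K" and "finite J"
  shows "\<Phi> (\<lambda>i. \<Sum>j\<in>J. c j * p j i) = lin K J (\<lambda>j. \<Phi> (p j)) c"
  using assms(3)
proof (induction J rule: finite_induct)
  case empty
  then show ?case
    using presentsD(4)[OF P] by (simp add: comm_group.lin_empty[OF K])
next
  case (insert j J)
  have "\<Phi> (\<lambda>i. \<Sum>j\<in>insert j J. c j * p j i)
      = \<Phi> (\<lambda>i. c j * p j i) \<otimes>\<^bsub>K\<^esub> \<Phi> (\<lambda>i. \<Sum>j\<in>J. c j * p j i)"
    using insert(1,2) presentsD(2)[OF P, of "\<lambda>i. c j * p j i"] by simp
  also have "\<dots> = \<Phi> (p j) [^]\<^bsub>K\<^esub> c j \<otimes>\<^bsub>K\<^esub> lin K J (\<lambda>j. \<Phi> (p j)) c"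
    using insert(3) presents_int_pow[OF P K] by simp
  also have "\<dots> = lin K (insert j J) (\<lambda>j. \<Phi> (p j)) c"
    using insert(1,2) presentsD(1)[OF P] by (subst comm_group.lin_insert[OF K]) auto
  finally show ?case .
qed

text \<open>Reduced residues are normal forms of the coordinates; the cardinalities of presented
  groups come from here.\<close>

lemma presents_bij:
  assumes P: "presents K I N \<Phi>" and K: "comm_group K" and N: "\<And>i. i \<in> I \<Longrightarrow> N i > 0"
  shows "bij_betw \<Phi> (PiE I (\<lambda>i. {0..<int (N i)})) (carrier K)"
  unfolding bij_betw_def
proof
  show "inj_on \<Phi> (PiE I (\<lambda>i. {0..<int (N i)}))"
  proof (rule inj_onI)
    fix c d assume cd: "c \<in> PiE I (\<lambda>i. {0..<int (N i)})" "d \<in> PiE I (\<lambda>i. {0..<int (N i)})"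
      and "\<Phi> c = \<Phi> d"
    then have cong: "\<forall>i\<in>I. [c i = d i] (mod int (N i))" using presents_eq[OF P K] by simp
    show "c = d"
    proof
      fix i show "c i = d i"
      proof (cases "i \<in> I")
        case True
        then have "c i \<in> {0..<int (N i)}" "d i \<in> {0..<int (N i)}" using cd by auto
        then have m: "c i mod int (N i) = c i" "d i mod int (N i) = d i"
          by (auto intro: mod_pos_pos_trivial)
        show ?thesis
          using bspec[OF cong True] unfolding cong_def m .
      next
        case False
        then show ?thesis using cd by (simp add: PiE_def extensional_def)
      qed
    qed
  qed
  show "\<Phi> ` PiE I (\<lambda>i. {0..<int (N i)}) = carrier K"
  proof (intro equalityI subsetI)
    fix x assume "x \<in> carrier K"
    then obtain c where c: "x = \<Phi> c" using presentsD(3)[OF P] by blast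
    define d where "d = (\<lambda>i\<in>I. c i mod int (N i))"
    have "d \<in> PiE I (\<lambda>i. {0..<int (N i)})" unfolding d_def using N by auto
    moreover have "\<Phi> c = \<Phi> d" unfolding presents_eq[OF P K] d_def by (simp add: cong_def)
    ultimately show "x \<in> \<Phi> ` PiE I (\<lambda>i. {0..<int (N i)})" using c by blast
  qed (use presentsD(1)[OF P] in auto)
qed

lemma presents_card:
  assumes "presents K I N \<Phi>" "comm_group K" "finite I" "\<And>i. i \<in> I \<Longrightarrow> N i > 0"
  shows "card (carrier K) = (\<Prod>i\<in>I. N i)"
  using bij_betw_same_card[OF presents_bij[OF assms(1,2,4)]] assms(3) by (simp add: card_PiE)

lemma presents_finite:
  assumes "presents K I N \<Phi>" "comm_group K" "finite I" "\<And>i. i \<in> I \<Longrightarrow> N i > 0"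
  shows "finite (carrier K)"
  using bij_betw_finite[OF presents_bij[OF assms(1,2,4)]] assms(3) by (auto intro: finite_PiE)

lemma carrier_torsion: "carrier (torsion K t) = {x \<in> carrier K. x [^]\<^bsub>K\<^esub> t = \<one>\<^bsub>K\<^esub>}"
  by (simp add: torsion_def)

lemma torsion_simps [simp]:
  "mult (torsion K t) = mult K" "one (torsion K t) = one K"
  by (simp_all add: torsion_def)

lemma subgroup_torsion:
  assumes "comm_group K"
  shows "subgroup (carrier (torsion K t)) K"
proof -
  interpret comm_group K by fact
  show ?thesis
    by (rule subgroupI) (auto simp: carrier_torsion nat_pow_distrib nat_pow_inv intro!: exI[of _ "\<one>\<^bsub>K\<^esub>"])
qed

lemma comm_group_torsion:
  assumes "comm_group K"
  shows "comm_group (torsion K t)"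
proof -
  interpret comm_group K by fact
  have "torsion K t = K\<lparr>carrier := carrier (torsion K t)\<rparr>" by (simp add: torsion_def)
  then have "group (torsion K t)"
    using subgroup_imp_group[OF subgroup_torsion[OF assms]] by metis
  then show ?thesis
    by (rule group.group_comm_groupI) (auto simp: carrier_torsion m_comm)
qed

text \<open>An element is killed by t exactly when its i-th coordinate is a multiple of
  \<open>s i\<close>; the \<open>s i\<close>-th power of the i-th basis element then has order
  \<open>N' i\<close>.\<close>

lemma presents_torsion:
  fixes \<Phi> :: "('i \<Rightarrow> int) \<Rightarrow> 'k"
  assumes P: "presents K I N \<Phi>" and K: "comm_group K"
    and s: "\<And>i. i \<in> I \<Longrightarrow> N i = s i * N' i \<and> s i > 0"
    and t: "\<And>i x. i \<in> I \<Longrightarrow> int (N i) dvd int t * x \<longleftrightarrow> int (s i) dvd x"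
  shows "presents (torsion K t) I N' (\<lambda>c. \<Phi> (\<lambda>i. int (s i) * c i))"
  unfolding presents_def
proof (intro conjI allI ballI)
  fix c d :: "'i \<Rightarrow> int"
  show "\<Phi> (\<lambda>i. int (s i) * c i) \<in> carrier (torsion K t)"
    using presentsD(1)[OF P] presentsD(4)[OF P] t
    by (simp add: carrier_torsion presents_nat_pow[OF P K, symmetric])
  show "\<Phi> (\<lambda>i. int (s i) * (c i + d i)) =
      \<Phi> (\<lambda>i. int (s i) * c i) \<otimes>\<^bsub>torsion K t\<^esub> \<Phi> (\<lambda>i. int (s i) * d i)"
    using presentsD(2)[OF P] by (simp add: distrib_left)
  show "(\<Phi> (\<lambda>i. int (s i) * c i) = \<one>\<^bsub>torsion K t\<^esub>) = (\<forall>i\<in>I. int (N' i) dvd c i)"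
  proof -
    have "int (N i) dvd int (s i) * c i \<longleftrightarrow> int (N' i) dvd c i" if "i \<in> I" for i
      using s[OF that] by simp
    then show ?thesis using presentsD(4)[OF P] by simp
  qed
next
  fix x assume x: "x \<in> carrier (torsion K t)"
  then obtain c where c: "x = \<Phi> c" using presentsD(3)[OF P] by (auto simp: carrier_torsion)
  have "\<Phi> (\<lambda>i. int t * c i) = \<one>\<^bsub>K\<^esub>"
    using x c by (simp add: carrier_torsion presents_nat_pow[OF P K])
  then have d: "\<forall>i\<in>I. int (s i) dvd c i" using presentsD(4)[OF P] t by simp
  have "x = \<Phi> (\<lambda>i. int (s i) * (c i div int (s i)))"
    unfolding c presents_eq[OF P K] using d by simp
  then show "\<exists>c. x = \<Phi> (\<lambda>i. int (s i) * c i)"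
    by (rule exI[of _ "\<lambda>i. c i div int (s i)"])
qed

text \<open>Truncated subtraction covers the case \<open>a \<le> t\<close>, where the right-hand
  side is divisibility by 1.\<close>

lemma prime_power_dvd_mult_iff:
  assumes "l > (0::nat)"
  shows "int (l ^ a) dvd int (l ^ t) * x \<longleftrightarrow> int (l ^ (a - t)) dvd x"
proof (cases "a \<le> t")
  case True
  then have "int (l ^ a) dvd int (l ^ t)" by (simp add: le_imp_power_dvd)
  then show ?thesis using True by simp
next
  case False
  then have "int (l ^ a) = int (l ^ t) * int (l ^ (a - t))"
    by (simp flip: power_add)
  then show ?thesis using assms by simp
qed

lemma presents_prime_power_torsion:
  assumes P: "presents K I (\<lambda>i. l ^ a i) \<Phi>" and K: "comm_group K" and l: "l > 0"
  shows "presents (torsion K (l ^ t)) I (\<lambda>i. l ^ min (a i) t)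
    (\<lambda>c. \<Phi> (\<lambda>i. int (l ^ (a i - t)) * c i))"
proof (rule presents_torsion[OF P K])
  fix i
  have "a i - t + min (a i) t = a i" by simp
  then show "l ^ a i = l ^ (a i - t) * l ^ min (a i) t \<and> 0 < l ^ (a i - t)"
    using l by (metis power_add zero_less_power)
  show "int (l ^ a i) dvd int (l ^ t) * x \<longleftrightarrow> int (l ^ (a i - t)) dvd x" for x
    by (rule prime_power_dvd_mult_iff[OF l])
qed

lemma presents_iso:
  assumes P: "presents K I N \<Phi>" and "comm_group K" "comm_group K'" and f: "f \<in> iso K K'"
  shows "presents K' I N (\<lambda>c. f (\<Phi> c))"
proof -
  interpret K: comm_group K by fact
  interpret K': comm_group K' by fact
  have h: "f \<in> hom K K'" and b: "bij_betw f (carrier K) (carrier K')" using f by (auto simp: iso_def)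
  show ?thesis
    unfolding presents_def
  proof (intro conjI allI ballI)
    fix c d
    show "f (\<Phi> c) \<in> carrier K'" using presentsD(1)[OF P] h hom_in_carrier by metis
    show "f (\<Phi> (\<lambda>i. c i + d i)) = f (\<Phi> c) \<otimes>\<^bsub>K'\<^esub> f (\<Phi> d)"
      using presentsD(1,2)[OF P] h by (simp add: hom_mult)
    have "f \<one>\<^bsub>K\<^esub> = \<one>\<^bsub>K'\<^esub>" using hom_one[OF h] K.is_group K'.is_group by blast
    then have "f (\<Phi> c) = \<one>\<^bsub>K'\<^esub> \<longleftrightarrow> \<Phi> c = \<one>\<^bsub>K\<^esub>"
      using b presentsD(1)[OF P] K.one_closed unfolding bij_betw_def inj_on_def by metis
    then show "f (\<Phi> c) = \<one>\<^bsub>K'\<^esub> \<longleftrightarrow> (\<forall>i\<in>I. int (N i) dvd c i)"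
      using presentsD(4)[OF P] by simp
  next
    fix x assume "x \<in> carrier K'"
    then obtain y where "y \<in> carrier K" "x = f y" using b unfolding bij_betw_def by blast
    then show "\<exists>c. x = f (\<Phi> c)" using presentsD(3)[OF P] by blast
  qed
qed

subsection \<open>Bases of finite abelian groups of prime power order\<close>

context comm_group
begin

text \<open>
  A family as below that does not generate can be extended: by purity, an element of maximal order
  modulo the span can be corrected by an element of the span to split off a cyclic direct factor.
\<close>

definition pure_family :: "nat \<Rightarrow> nat \<Rightarrow> (nat \<Rightarrow> nat) \<Rightarrow> (nat \<Rightarrow> 'a) \<Rightarrow> bool" where
  "pure_family l k a e \<longleftrightarrow>
    e \<in> {..<k} \<rightarrow> carrier G \<and> (\<forall>i<k. 1 \<le> a i) \<and> (\<forall>j<k. \<forall>i\<le>j. a j \<le> a i) \<and>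
    (\<forall>i<k. \<forall>z\<in>carrier G. \<exists>c. z [^] (l ^ a i) = lin G {..<k} e c) \<and>
    (\<forall>c. lin G {..<k} e c = \<one> \<longleftrightarrow> (\<forall>i<k. int (l ^ a i) dvd c i)) \<and>
    (\<forall>z\<in>carrier G. \<forall>r c. z [^] (l ^ r) = lin G {..<k} e c \<longrightarrow>
       (\<exists>d. z [^] (l ^ r) = lin G {..<k} e d [^] (l ^ r)))"

text \<open>The members are distinct: \<open>e i = e j\<close> would be a relation with coefficient
  1 at \<open>i\<close>, which \<open>l ^ a i\<close> does not divide. Hence a family of maximal
  length exists.\<close>

lemma pure_family_bound:
  assumes "prime l" "finite (carrier G)" "pure_family l k a e"
  shows "k \<le> card (carrier G)"
proof -
  have e: "e \<in> {..<k} \<rightarrow> carrier G" using assms(3) by (simp add: pure_family_def)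
  have rel: "int (l ^ a i) dvd c i" if "lin G {..<k} e c = \<one>" "i < k" for c i
    using assms(3) that by (simp add: pure_family_def)
  have "inj_on e {..<k}"
  proof (rule inj_onI, rule ccontr)
    fix i j assume ij: "i \<in> {..<k}" "j \<in> {..<k}" "e i = e j" "i \<noteq> j"
    let ?c = "\<lambda>z. (if z = i then 1 else 0) + (if z = j then - 1 else 0 :: int)"
    have "lin G {..<k} e ?c = e i \<otimes> inv (e j)"
      using ij e by (subst lin_add) (auto simp: lin_delta int_pow_neg Pi_iff)
    also have "\<dots> = \<one>" using ij e by (auto simp: Pi_iff)
    finally have "int (l ^ a i) dvd ?c i"
      using rel[of ?c i] ij(1) by simp
    then have "int (l ^ a i) dvd int 1" using ij(4) by simp
    then have "l ^ a i dvd 1" by (simp only: int_dvd_int_iff)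
    then have "l ^ a i = 1" by simp
    moreover have "1 \<le> a i" using assms(3) ij by (simp add: pure_family_def)
    ultimately show False using prime_gt_1_nat[OF assms(1)] by simp
  qed
  then show ?thesis using card_inj_on_le[of e "{..<k}" "carrier G"] e assms(2) by auto
qed

text \<open>The order of the new element is the exponent l^b of the group modulo the span. This
  choice gives b <= \<open>a i\<close>, the annihilation clause for the new index and, through
  purity, an element whose powers meet the span trivially.\<close>

lemma pure_family_extend:
  assumes l: "prime l" and ord: "order G = l ^ m" and fin: "finite (carrier G)"
    and good: "pure_family l k a e" and x: "x \<in> carrier G" "\<And>c. x \<noteq> lin G {..<k} e c"
  shows "\<exists>a' e'. pure_family l (Suc k) a' e'"
proof -
  let ?L = "lin G {..<k} e"
  have e: "e \<in> {..<k} \<rightarrow> carrier G" and rel: "\<And>c. ?L c = \<one> \<longleftrightarrow> (\<forall>i<k. int (l ^ a i) dvd c i)"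
    and dec: "\<And>i j. j < k \<Longrightarrow> i \<le> j \<Longrightarrow> a j \<le> a i" and a1: "\<And>i. i < k \<Longrightarrow> 1 \<le> a i"
    and bd: "\<And>i z. i < k \<Longrightarrow> z \<in> carrier G \<Longrightarrow> \<exists>c. z [^] (l ^ a i) = ?L c"
    and pure: "\<And>z r c. z \<in> carrier G \<Longrightarrow> z [^] (l ^ r) = ?L c \<Longrightarrow>
       \<exists>d. z [^] (l ^ r) = ?L d [^] (l ^ r)"
    using good unfolding pure_family_def by blast+
  note Lc = lin_closed[OF e] and Ladd = lin_add[OF e] and Lneg = lin_neg[OF e]
    and Lpow = lin_nat_pow[OF e] and Lipow = lin_int_pow[OF e]
  have l0: "l > 0" using l prime_gt_0_nat by blast
  define b where "b = (LEAST b. \<forall>z\<in>carrier G. \<exists>c. z [^] (l ^ b) = ?L c)"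
  have "\<forall>z\<in>carrier G. \<exists>c. z [^] (l ^ m) = ?L c"
    using power_order_eq_one[OF fin] ord lin_zero unfolding order_def by metis
  then have b: "\<exists>c. z [^] (l ^ b) = ?L c" if "z \<in> carrier G" for z
    using LeastI[of "\<lambda>b. \<forall>z\<in>carrier G. \<exists>c. z [^] (l ^ b) = ?L c"] that unfolding b_def by blast
  have b0: "b \<noteq> 0"
  proof
    assume "b = 0"
    then show False using b[OF x(1)] x by simp
  qed
  then have "\<not> (\<forall>z\<in>carrier G. \<exists>c. z [^] (l ^ (b - 1)) = ?L c)"
    using not_less_Least[of "b - 1" "\<lambda>b. \<forall>z\<in>carrier G. \<exists>c. z [^] (l ^ b) = ?L c"]
    unfolding b_def[symmetric] by simp
  then obtain y where y: "y \<in> carrier G" "\<And>c. y [^] (l ^ (b - 1)) \<noteq> ?L c" by blast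
  obtain d where d: "y [^] (l ^ b) = ?L d [^] (l ^ b)" using b[OF y(1)] pure[OF y(1)] by blast
  \<comment> \<open>\<open>y\<close> has order exactly l^b modulo the span, and by purity its l^b-th
    power is that of a span element. Dividing this element out gives order l^b in the group itself
    without changing the class modulo the span.\<close>
  define w where "w = y \<otimes> inv (?L d)"
  have w: "w \<in> carrier G" unfolding w_def using y Lc by simp
  have yw: "y = w \<otimes> ?L d" unfolding w_def using y Lc by (simp add: m_assoc)
  have wb: "w [^] (l ^ b) = \<one>"
    unfolding w_def using y Lc d by (simp add: nat_pow_distrib nat_pow_inv)
  have wb': "w [^] (l ^ (b - 1)) \<noteq> ?L c" for c
  proof
    assume "w [^] (l ^ (b - 1)) = ?L c"
    then have "y [^] (l ^ (b - 1)) = ?L (\<lambda>i. c i + int (l ^ (b - 1)) * d i)"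
      unfolding yw using w Lc by (simp add: nat_pow_distrib Ladd Lpow del: of_nat_power)
    then show False using y(2) by blast
  qed
  have wi: "w [^] z = \<one>" if dvd: "int (l ^ b) dvd z" for z :: int
  proof -
    obtain q where q: "z = int (l ^ b) * q" using dvd by blast
    then show ?thesis using w wb by (simp add: int_pow_pow[symmetric] int_pow_int del: of_nat_power)
  qed
  \<comment> \<open>Otherwise gcd(z, l^b) = l^t with t < b, and by Bezout the l^t-th power of
    \<open>w\<close>, hence also the l^(b-1)-th, would lie in the span.\<close>
  have key: "int (l ^ b) dvd z" if "w [^] z = ?L c" for z :: int and c
  proof (rule ccontr)
    assume nd: "\<not> int (l ^ b) dvd z"
    define g where "g = gcd z (int (l ^ b))"
    obtain u v where uv: "u * z + v * int (l ^ b) = g" using bezout_int g_def by metis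
    have "nat g dvd l ^ b" unfolding g_def by (simp add: nat_dvd_iff)
    then obtain t where t: "t \<le> b" "nat g = l ^ t" using divides_primepow_nat[OF l] by blast
    have g0: "g \<ge> 0" by (simp add: g_def)
    have "t \<noteq> b" using t g0 nd unfolding g_def by (metis gcd_dvd1 int_nat_eq)
    then have tb: "t \<le> b - 1" using t by simp
    have "t + (b - 1 - t) = b - 1" using tb by linarith
    then have tt: "l ^ t * l ^ (b - 1 - t) = l ^ (b - 1)" by (metis power_add)
    have "w [^] (u * z) = ?L (\<lambda>i. u * c i)"
      unfolding Lipow that[symmetric] int_pow_pow[OF w] by (simp add: mult.commute)
    moreover have "w [^] (v * int (l ^ b)) = \<one>" by (rule wi) simp
    ultimately have "w [^] g = ?L (\<lambda>i. u * c i)"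
      unfolding uv[symmetric] int_pow_mult[OF w] using Lc by simp
    then have "w [^] (l ^ t) = ?L (\<lambda>i. u * c i)"
      using t g0 by (metis int_pow_int int_nat_eq)
    then have "(w [^] (l ^ t)) [^] (l ^ (b - 1 - t)) = ?L (\<lambda>i. int (l ^ (b - 1 - t)) * (u * c i))"
      using Lpow[of "l ^ (b - 1 - t)" "\<lambda>i. u * c i"] by simp
    then have "w [^] (l ^ (b - 1)) = ?L (\<lambda>i. int (l ^ (b - 1 - t)) * (u * c i))"
      unfolding nat_pow_pow[OF w] tt .
    then show False using wb' by blast
  qed
  define e' where "e' = e(k := w)"
  define a' where "a' = a(k := b)"
  let ?L' = "lin G {..<Suc k} e'"
  have e': "e' \<in> {..<Suc k} \<rightarrow> carrier G" using e w by (auto simp: e'_def Pi_iff less_Suc_eq)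
  have L': "?L' c = w [^] c k \<otimes> ?L c" for c
  proof -
    have "?L' c = e' k [^] c k \<otimes> lin G {..<k} e' c"
      unfolding lessThan_Suc using e' by (intro lin_insert) (auto simp: lessThan_Suc)
    moreover have "lin G {..<k} e' c = ?L c" using e by (subst lin_cong[of e]) (auto simp: e'_def)
    ultimately show ?thesis by (simp add: e'_def)
  qed
  have emb: "?L c = ?L' (c(k := 0))" for c
  proof -
    have "?L (c(k := 0)) = ?L c" using e by (intro lin_cong) auto
    then show ?thesis unfolding L' using Lc by simp
  qed
  have "pure_family l (Suc k) a' e'"
    unfolding pure_family_def
  proof (intro conjI allI impI ballI)
    show "e' \<in> {..<Suc k} \<rightarrow> carrier G" by fact
  next
    fix i assume "i < Suc k"
    then show "1 \<le> a' i" using a1 b0 by (auto simp: a'_def less_Suc_eq)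
  next
    fix i j assume j: "j < Suc k" and i: "i \<le> j"
    \<comment> \<open>\<open>b\<close> is least, and raising to \<open>l ^ a i\<close> also maps the
      whole group into the span.\<close>
    have "b \<le> a i" if "i < k" for i
      unfolding b_def by (rule Least_le) (use bd that in blast)
    then show "a' j \<le> a' i" using i j dec by (auto simp: a'_def less_Suc_eq)
  next
    fix i z assume "i < Suc k" "z \<in> carrier G"
    then show "\<exists>c. z [^] l ^ a' i = ?L' c"
      using b bd emb by (metis a'_def fun_upd_apply less_SucE)
  next
    fix c
    show "?L' c = \<one> \<longleftrightarrow> (\<forall>i<Suc k. int (l ^ a' i) dvd c i)"
    proof
      assume "?L' c = \<one>"
      then have "w [^] c k = inv (?L c)" unfolding L' using w Lc by (simp add: inv_equality)
      then have dk: "int (l ^ b) dvd c k" using key Lneg by metis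
      then have "?L c = \<one>" using \<open>?L' c = \<one>\<close> Lc unfolding L' by (simp add: wi)
      then show "\<forall>i<Suc k. int (l ^ a' i) dvd c i" using dk rel by (auto simp: a'_def less_Suc_eq)
    next
      assume R: "\<forall>i<Suc k. int (l ^ a' i) dvd c i"
      then have "int (l ^ b) dvd c k" by (auto simp: a'_def)
      moreover have "?L c = \<one>" unfolding rel
      proof (intro allI impI)
        fix i assume "i < k"
        then show "int (l ^ a i) dvd c i" using R[rule_format, of i] by (simp add: a'_def)
      qed
      ultimately show "?L' c = \<one>" unfolding L' by (simp add: wi)
    qed
  next
    fix z r c assume z: "z \<in> carrier G" and zr: "z [^] l ^ r = ?L' c"
    obtain cb where cb: "z [^] l ^ b = ?L cb" using b[OF z] by blast
    show "\<exists>d. z [^] l ^ r = ?L' d [^] l ^ r"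
    \<comment> \<open>For b <= r the power lies in the old span already. Otherwise raising to
      l^(b-r) leads into it, \<open>key\<close> makes l^r divide the coefficient of
      \<open>w\<close>, and once the corresponding power of \<open>w\<close> is removed from
      \<open>z\<close> the old purity applies.\<close>
    proof (cases "b \<le> r")
      case True
      have "z [^] l ^ r = (z [^] l ^ b) [^] (l ^ (r - b))"
        using z True by (simp add: nat_pow_pow flip: power_add)
      also have "\<dots> = ?L (\<lambda>i. int (l ^ (r - b)) * cb i)" unfolding cb Lpow ..
      finally show ?thesis using pure[OF z] emb by metis
    next
      case False
      then have rb: "l ^ r * l ^ (b - r) = l ^ b" by (simp flip: power_add)
      have "z [^] l ^ b = (z [^] l ^ r) [^] l ^ (b - r)" using z rb by (simp add: nat_pow_pow)
      also have "\<dots> = ?L' (\<lambda>i. int (l ^ (b - r)) * c i)" unfolding zr lin_nat_pow[OF e'] ..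
      finally have "?L cb = w [^] (int (l ^ (b - r)) * c k) \<otimes> ?L (\<lambda>i. int (l ^ (b - r)) * c i)"
        unfolding cb L' .
      then have "w [^] (int (l ^ (b - r)) * c k) = ?L cb \<otimes> inv (?L (\<lambda>i. int (l ^ (b - r)) * c i))"
        using w Lc by (simp add: m_assoc)
      also have "\<dots> = ?L (\<lambda>i. cb i + - (int (l ^ (b - r)) * c i))" unfolding Ladd Lneg ..
      finally have "int (l ^ b) dvd int (l ^ (b - r)) * c k" by (rule key)
      moreover have "b - (b - r) = r" using False by simp
      ultimately have "int (l ^ r) dvd c k" using prime_power_dvd_mult_iff[OF l0] by metis
      then obtain c' where c': "c k = int (l ^ r) * c'" by blast
      have pw: "(w [^] c') [^] (l ^ r) = w [^] c k"
        using w unfolding c' by (simp add: int_pow_pow int_pow_int[symmetric] mult.commute del: of_nat_power)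
      define s where "s = z \<otimes> inv (w [^] c')"
      have s: "s \<in> carrier G" using z w by (simp add: s_def)
      have "s [^] l ^ r = (w [^] c k \<otimes> ?L c) \<otimes> inv (w [^] c k)"
        unfolding s_def using z w Lc zr pw by (simp add: nat_pow_distrib nat_pow_inv L')
      also have "w [^] c k \<otimes> ?L c = ?L c \<otimes> w [^] c k"
        using w Lc by (simp add: m_comm)
      finally have "s [^] l ^ r = ?L c" using w Lc by (simp add: m_assoc)
      then obtain d where d: "s [^] l ^ r = ?L d [^] l ^ r" using pure[OF s] by blast
      have "?L (d(k := c')) = ?L d" using e by (intro lin_cong) auto
      then have D: "?L' (d(k := c')) = w [^] c' \<otimes> ?L d" unfolding L' by simp
      have "z = w [^] c' \<otimes> s" unfolding s_def using z w by (simp add: m_ac)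
      then have "z [^] l ^ r = (w [^] c') [^] l ^ r \<otimes> s [^] l ^ r"
        using w s by (simp add: nat_pow_distrib)
      also have "\<dots> = ?L' (d(k := c')) [^] l ^ r"
        unfolding D d using w Lc by (simp add: nat_pow_distrib)
      finally show ?thesis by blast
    qed
  qed
  then show ?thesis by blast
qed

end

text \<open>A pure family of maximal length spans, since an element outside the span would extend
  it; the empty family is the starting point.\<close>

lemma primary_group_basis:
  assumes l: "prime l" and G: "finite_abelian_primary l G"
  obtains k :: nat and a e where "e \<in> {..<k} \<rightarrow> carrier G" "\<And>i. i < k \<Longrightarrow> 1 \<le> a i"
    "\<And>i j. j < k \<Longrightarrow> i \<le> j \<Longrightarrow> a j \<le> a i"
    "presents G {..<k} (\<lambda>i. l ^ a i) (lin G {..<k} e)"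
proof -
  interpret comm_group G using G by (simp add: finite_abelian_primary_def)
  obtain m where m: "order G = l ^ m" and fin: "finite (carrier G)"
    using G by (auto simp: finite_abelian_primary_def)
  define P where "P k \<longleftrightarrow> (\<exists>a e. pure_family l k a e)" for k
  have "pure_family l 0 (\<lambda>_. 1) (\<lambda>_. \<one>\<^bsub>G\<^esub>)" by (auto simp: pure_family_def)
  then have P0: "P 0" unfolding P_def by blast
  have "\<forall>k. P k \<longrightarrow> k \<le> card (carrier G)" using pure_family_bound[OF l fin] P_def by blast
  then obtain k where k: "P k" "\<And>j. P j \<Longrightarrow> j \<le> k"
    using P0 GreatestI_nat Greatest_le_nat by metis
  then obtain a e where ae: "pure_family l k a e" using P_def by blast
  have surj: "\<exists>c. x = lin G {..<k} e c" if "x \<in> carrier G" for x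
  proof (rule ccontr)
    assume "\<not> ?thesis"
    then have "P (Suc k)" using pure_family_extend[OF l m fin ae that] P_def by blast
    then show False using k(2)[of "Suc k"] by simp
  qed
  have e: "e \<in> {..<k} \<rightarrow> carrier G" using ae by (simp add: pure_family_def)
  have "presents G {..<k} (\<lambda>i. l ^ a i) (lin G {..<k} e)"
    unfolding presents_def using surj lin_closed[OF e] lin_add[OF e] ae
    by (auto simp: pure_family_def)
  moreover have "\<And>i. i < k \<Longrightarrow> 1 \<le> a i" "\<And>i j. j < k \<Longrightarrow> i \<le> j \<Longrightarrow> a j \<le> a i"
    using ae by (auto simp: pure_family_def)
  ultimately show thesis using that[OF e] by blast
qed

subsection \<open>The group of rationals modulo integers\<close>

lemma comm_group_rat_group: "comm_group rat_group"
  by (rule comm_groupI) (auto simp: rat_group_def intro: exI[of _ "- x" for x])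

lemma subgroup_Ints: "subgroup \<int> rat_group"
proof -
  interpret comm_group rat_group by (rule comm_group_rat_group)
  have "inv\<^bsub>rat_group\<^esub> x = - x" for x
    by (rule inv_equality) (auto simp: rat_group_def)
  then show ?thesis
    by (intro subgroupI) (auto simp: rat_group_def intro: Ints_0)
qed

lemma comm_group_Q_mod_Z: "comm_group Q_mod_Z"
  unfolding Q_mod_Z_def
  by (rule comm_group.abelian_FactGroup[OF comm_group_rat_group subgroup_Ints])

interpretation QZ: comm_group Q_mod_Z by (rule comm_group_Q_mod_Z)

lemma mem_rat_class: "p \<in> rat_class q \<longleftrightarrow> p - q \<in> \<int>"
proof -
  have "p \<in> rat_class q \<longleftrightarrow> (\<exists>z\<in>\<int>. p = z + q)"
    by (auto simp: rat_class_def r_coset_def rat_group_def)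
  also have "\<dots> \<longleftrightarrow> p - q \<in> \<int>"
    by (metis add_diff_cancel diff_add_cancel)
  finally show ?thesis .
qed

lemma rat_class_eq: "rat_class p = rat_class q \<longleftrightarrow> p - q \<in> \<int>"
proof
  assume "rat_class p = rat_class q"
  then show "p - q \<in> \<int>" using mem_rat_class[of p p] mem_rat_class[of p q] by simp
next
  assume pq: "p - q \<in> \<int>"
  have "r \<in> rat_class p \<longleftrightarrow> r \<in> rat_class q" for r
  proof -
    have "r - p = (r - q) - (p - q)" "r - q = (r - p) + (p - q)" by simp_all
    then show ?thesis unfolding mem_rat_class using pq by (metis Ints_add Ints_diff)
  qed
  then show "rat_class p = rat_class q" by blast
qed

lemma carrier_Q_mod_Z: "carrier Q_mod_Z = range rat_class"
  by (auto simp: Q_mod_Z_def carrier_FactGroup rat_class_def rat_group_def)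

lemma rat_class_in_carrier [simp]: "rat_class q \<in> carrier Q_mod_Z"
  by (simp add: carrier_Q_mod_Z)

lemma rat_class_add: "rat_class p \<otimes>\<^bsub>Q_mod_Z\<^esub> rat_class q = rat_class (p + q)"
proof -
  interpret comm_group rat_group by (rule comm_group_rat_group)
  have "\<int> \<lhd> rat_group" using subgroup_Ints by (rule subgroup_imp_normal)
  moreover have "p \<in> carrier rat_group" "q \<in> carrier rat_group" "p \<otimes>\<^bsub>rat_group\<^esub> q = p + q"
    by (simp_all add: rat_group_def)
  ultimately show ?thesis
    unfolding Q_mod_Z_def rat_class_def by (metis mult_FactGroup normal.rcos_sum)
qed

lemma one_Q_mod_Z: "\<one>\<^bsub>Q_mod_Z\<^esub> = rat_class 0"
  using QZ.r_cancel_one[of "rat_class 0" "rat_class 0"] by (simp add: rat_class_add)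

lemma rat_class_eq_one: "rat_class q = \<one>\<^bsub>Q_mod_Z\<^esub> \<longleftrightarrow> q \<in> \<int>"
  by (simp add: one_Q_mod_Z rat_class_eq)

lemma rat_class_nat_pow: "rat_class q [^]\<^bsub>Q_mod_Z\<^esub> (n::nat) = rat_class (of_nat n * q)"
  by (induction n) (simp_all add: one_Q_mod_Z rat_class_add algebra_simps)

lemma rat_class_inv: "inv\<^bsub>Q_mod_Z\<^esub> rat_class q = rat_class (- q)"
  by (rule QZ.inv_equality) (simp_all add: rat_class_add one_Q_mod_Z)

lemma rat_class_int_pow: "rat_class q [^]\<^bsub>Q_mod_Z\<^esub> (z::int) = rat_class (of_int z * q)"
proof (cases z rule: int_cases2)
  case (nonneg n)
  then show ?thesis by (simp add: int_pow_int rat_class_nat_pow)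
next
  case (nonpos n)
  then show ?thesis by (simp add: QZ.int_pow_neg_int rat_class_nat_pow rat_class_inv)
qed

lemma lin_Q_mod_Z:
  "finite I \<Longrightarrow> lin Q_mod_Z I (\<lambda>i. rat_class (r i)) c = rat_class (\<Sum>i\<in>I. of_int (c i) * r i)"
proof (induction I rule: finite_induct)
  case empty
  then show ?case by (simp add: one_Q_mod_Z)
next
  case (insert i I)
  then show ?case by (subst QZ.lin_insert) (auto simp: rat_class_int_pow rat_class_add)
qed

lemma rat_lift: "c \<in> carrier Q_mod_Z \<Longrightarrow> rat_class (rat_lift c) = c"
proof -
  assume "c \<in> carrier Q_mod_Z"
  then obtain q where q: "c = rat_class q" by (auto simp: carrier_Q_mod_Z)
  have "rat_lift c \<in> c"
    unfolding rat_lift_def by (rule someI[of _ q]) (simp add: q mem_rat_class)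
  then show ?thesis unfolding q mem_rat_class rat_class_eq .
qed

lemma of_int_div_in_Ints_iff:
  "N > 0 \<Longrightarrow> (of_int z / of_nat N :: rat) \<in> \<int> \<longleftrightarrow> int N dvd z"
proof
  assume N: "N > 0" and "(of_int z / of_nat N :: rat) \<in> \<int>"
  then obtain q where "(of_int z / of_nat N :: rat) = of_int q" by (auto simp: Ints_def)
  then have "(of_int z :: rat) = of_int (q * int N)" using N by (simp add: field_simps)
  then have "z = q * int N" by (simp only: of_int_eq_iff)
  then show "int N dvd z" by simp
next
  assume N: "N > 0" and "int N dvd z"
  then show "(of_int z / of_nat N :: rat) \<in> \<int>" by (auto elim!: dvdE)
qed

text \<open>Both factors lie in (1 / N) Z, so changing either by an integer changes N times the
  product by an integer. This is why \<open>tensor_form\<close> does not depend on the lifts of the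
  character values.\<close>

lemma rat_class_lift_mult:
  assumes "of_nat N * p \<in> \<int>" "of_nat N * q \<in> \<int>" "rat_class p = rat_class p'" "rat_class q = rat_class q'"
  shows "rat_class (of_nat N * (p * q)) = rat_class (of_nat N * (p' * q'))"
proof -
  have d: "p - p' \<in> \<int>" "q - q' \<in> \<int>" using assms(3,4) by (simp_all add: rat_class_eq)
  have "of_nat N * (p * q) - of_nat N * (p' * q')
      = (p - p') * (of_nat N * q) + (of_nat N * p) * (q - q') - of_nat N * ((p - p') * (q - q'))"
    by (simp add: algebra_simps)
  also have "\<dots> \<in> \<int>"
    by (rule Ints_diff[OF Ints_add[OF Ints_mult[OF d(1) assms(2)] Ints_mult[OF assms(1) d(2)]]
          Ints_mult[OF Ints_of_nat Ints_mult[OF d]]])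
  finally show ?thesis by (simp add: rat_class_eq)
qed

subsection \<open>The dual group\<close>

lemma carrier_dual: "carrier (dual G) = hom G Q_mod_Z \<inter> extensional (carrier G)"
  by (simp add: dual_def)

lemma dual_mult: "\<alpha> \<otimes>\<^bsub>dual G\<^esub> \<beta> = (\<lambda>x\<in>carrier G. \<alpha> x \<otimes>\<^bsub>Q_mod_Z\<^esub> \<beta> x)"
  by (simp add: dual_def)

lemma dual_one: "\<one>\<^bsub>dual G\<^esub> = (\<lambda>x\<in>carrier G. \<one>\<^bsub>Q_mod_Z\<^esub>)"
  by (simp add: dual_def)

lemma dual_eqI:
  assumes "\<alpha> \<in> carrier (dual G)" "\<beta> \<in> carrier (dual G)" "\<And>x. x \<in> carrier G \<Longrightarrow> \<alpha> x = \<beta> x"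
  shows "\<alpha> = \<beta>"
  using assms by (intro extensionalityI[of _ "carrier G"]) (auto simp: carrier_dual)

lemma dual_closed: "\<alpha> \<in> carrier (dual G) \<Longrightarrow> x \<in> carrier G \<Longrightarrow> \<alpha> x \<in> carrier Q_mod_Z"
  by (auto simp: carrier_dual hom_in_carrier)

lemma dual_hom_mult:
  "\<alpha> \<in> carrier (dual G) \<Longrightarrow> x \<in> carrier G \<Longrightarrow> y \<in> carrier G \<Longrightarrow>
    \<alpha> (x \<otimes>\<^bsub>G\<^esub> y) = \<alpha> x \<otimes>\<^bsub>Q_mod_Z\<^esub> \<alpha> y"
  by (auto simp: carrier_dual hom_mult)

lemma comm_group_dual:
  assumes "comm_group G"
  shows "comm_group (dual G)"
proof -
  interpret comm_group G by fact
  have in_dual: "restrict f (carrier G) \<in> carrier (dual G)" if "f \<in> hom G Q_mod_Z" for f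
    using that by (auto simp: carrier_dual hom_def Pi_iff)
  show ?thesis
  proof (rule comm_groupI)
    fix \<alpha> \<beta> assume ab: "\<alpha> \<in> carrier (dual G)" "\<beta> \<in> carrier (dual G)"
    show "\<alpha> \<otimes>\<^bsub>dual G\<^esub> \<beta> \<in> carrier (dual G)"
      unfolding dual_mult using ab dual_closed[OF ab(1)] dual_closed[OF ab(2)]
      by (intro in_dual homI) (auto simp: dual_hom_mult QZ.m_ac)
    show "\<alpha> \<otimes>\<^bsub>dual G\<^esub> \<beta> = \<beta> \<otimes>\<^bsub>dual G\<^esub> \<alpha>"
      unfolding dual_mult using dual_closed[OF ab(1)] dual_closed[OF ab(2)]
      by (intro restrict_ext) (simp add: QZ.m_comm)
  next
    show "\<one>\<^bsub>dual G\<^esub> \<in> carrier (dual G)"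
      unfolding dual_one by (intro in_dual homI) auto
  next
    fix \<alpha> \<beta> \<gamma> assume "\<alpha> \<in> carrier (dual G)" "\<beta> \<in> carrier (dual G)" "\<gamma> \<in> carrier (dual G)"
    then show "\<alpha> \<otimes>\<^bsub>dual G\<^esub> \<beta> \<otimes>\<^bsub>dual G\<^esub> \<gamma> = \<alpha> \<otimes>\<^bsub>dual G\<^esub> (\<beta> \<otimes>\<^bsub>dual G\<^esub> \<gamma>)"
      unfolding dual_mult by (intro restrict_ext) (simp add: QZ.m_assoc dual_closed)
  next
    fix \<alpha> assume a: "\<alpha> \<in> carrier (dual G)"
    then show "\<one>\<^bsub>dual G\<^esub> \<otimes>\<^bsub>dual G\<^esub> \<alpha> = \<alpha>"
      unfolding dual_mult dual_one
      by (intro extensionalityI[of _ "carrier G"]) (auto simp: dual_closed carrier_dual hom_in_carrier)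
    have "(\<lambda>x\<in>carrier G. inv\<^bsub>Q_mod_Z\<^esub> \<alpha> x) \<in> carrier (dual G)"
      using a by (intro in_dual homI) (auto simp: dual_hom_mult dual_closed QZ.inv_mult)
    moreover have "(\<lambda>x\<in>carrier G. inv\<^bsub>Q_mod_Z\<^esub> \<alpha> x) \<otimes>\<^bsub>dual G\<^esub> \<alpha> = \<one>\<^bsub>dual G\<^esub>"
      unfolding dual_mult dual_one using a by (intro restrict_ext) (simp add: dual_closed)
    ultimately show "\<exists>\<beta>\<in>carrier (dual G). \<beta> \<otimes>\<^bsub>dual G\<^esub> \<alpha> = \<one>\<^bsub>dual G\<^esub>" by blast
  qed
qed

lemma dual_nat_pow:
  assumes "x \<in> carrier G"
  shows "(\<alpha> [^]\<^bsub>dual G\<^esub> (n::nat)) x = \<alpha> x [^]\<^bsub>Q_mod_Z\<^esub> n"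
  using assms by (induction n) (simp_all add: dual_one dual_mult)

lemma torsion_dual_lift:
  assumes "\<alpha> \<in> carrier (torsion (dual G) t)" "x \<in> carrier G"
  shows "of_nat t * rat_lift (\<alpha> x) \<in> \<int>" "rat_class (rat_lift (\<alpha> x)) = \<alpha> x"
proof -
  have a: "\<alpha> \<in> carrier (dual G)" "\<alpha> [^]\<^bsub>dual G\<^esub> t = \<one>\<^bsub>dual G\<^esub>"
    using assms by (auto simp: carrier_torsion)
  show L: "rat_class (rat_lift (\<alpha> x)) = \<alpha> x"
    using rat_lift dual_closed[OF a(1) assms(2)] by blast
  have "\<alpha> x [^]\<^bsub>Q_mod_Z\<^esub> t = \<one>\<^bsub>Q_mod_Z\<^esub>"
    using fun_cong[OF a(2), of x] assms(2) by (simp add: dual_nat_pow dual_one)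
  then have "rat_class (rat_lift (\<alpha> x)) [^]\<^bsub>Q_mod_Z\<^esub> t = \<one>\<^bsub>Q_mod_Z\<^esub>" unfolding L .
  then show "of_nat t * rat_lift (\<alpha> x) \<in> \<int>"
    by (simp add: rat_class_nat_pow rat_class_eq_one)
qed

lemma dual_map_in_dual:
  assumes "group G" "f \<in> hom G H" "\<beta> \<in> carrier (dual H)"
  shows "dual_map G f \<beta> \<in> carrier (dual G)"
proof -
  interpret group G by fact
  note f = hom_in_carrier[OF assms(2)] and b = assms(3)
  have "dual_map G f \<beta> \<in> hom G Q_mod_Z"
    by (rule homI) (simp_all add: dual_map_def compose_def f dual_closed[OF b]
        hom_mult[OF assms(2)] dual_hom_mult[OF b])
  then show ?thesis by (simp add: carrier_dual dual_map_def)
qed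

lemma dual_map_apply: "x \<in> carrier G \<Longrightarrow> dual_map G f \<beta> x = \<beta> (f x)"
  by (simp add: dual_map_def compose_def)

lemma dual_map_mult:
  assumes "f \<in> hom G H"
  shows "dual_map G f (\<alpha> \<otimes>\<^bsub>dual H\<^esub> \<beta>) = dual_map G f \<alpha> \<otimes>\<^bsub>dual G\<^esub> dual_map G f \<beta>"
  using hom_in_carrier[OF assms] by (intro ext) (simp add: dual_map_def compose_def dual_mult)

lemma dual_map_one:
  assumes "f \<in> hom G H"
  shows "dual_map G f \<one>\<^bsub>dual H\<^esub> = \<one>\<^bsub>dual G\<^esub>"
  using hom_in_carrier[OF assms] by (intro ext) (simp add: dual_map_def compose_def dual_one)

lemma dual_map_nat_pow:
  assumes "f \<in> hom G H"
  shows "dual_map G f (\<alpha> [^]\<^bsub>dual H\<^esub> (n::nat)) = dual_map G f \<alpha> [^]\<^bsub>dual G\<^esub> n"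
  by (induction n) (simp_all add: dual_map_one[OF assms] dual_map_mult[OF assms])

lemma dual_map_torsion:
  assumes "group G" "f \<in> hom G H" "\<beta> \<in> carrier (torsion (dual H) t)"
  shows "dual_map G f \<beta> \<in> carrier (torsion (dual G) t)"
  using assms(3) dual_map_in_dual[OF assms(1,2)] dual_map_nat_pow[OF assms(2), of \<beta> t]
    dual_map_one[OF assms(2)]
  by (simp add: carrier_torsion)

lemma dual_map_comp:
  assumes "f \<in> hom G H" "g \<in> hom H K"
  shows "dual_map G f (dual_map H g \<gamma>) = dual_map G (compose (carrier G) g f) \<gamma>"
  using hom_in_carrier[OF assms(1)] by (intro ext) (simp add: dual_map_def compose_def)

lemma dual_map_id:
  assumes "\<beta> \<in> carrier (dual G)"
  shows "dual_map G (\<lambda>x\<in>carrier G. x) \<beta> = \<beta>"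
  using assms by (intro ext) (simp add: dual_map_def compose_def carrier_dual extensional_def)

subsection \<open>The tensor square\<close>

definition pairs_group :: "('a, 'b) monoid_scheme \<Rightarrow> (('a \<times> 'a) \<Rightarrow>\<^sub>0 int) monoid" where
  "pairs_group G = free_Abelian_group (carrier G \<times> carrier G)"

lemma comm_group_pairs_group: "comm_group (pairs_group G)"
  unfolding pairs_group_def by (rule abelian_free_Abelian_group)

lemma frag_of_in_pairs_group:
  "x \<in> carrier G \<Longrightarrow> y \<in> carrier G \<Longrightarrow> frag_of (x, y) \<in> carrier (pairs_group G)"
  by (simp add: pairs_group_def)

lemma pairs_group_diff:
  "u \<in> carrier (pairs_group G) \<Longrightarrow> v \<in> carrier (pairs_group G) \<Longrightarrow>
    u - v = u \<otimes>\<^bsub>pairs_group G\<^esub> inv\<^bsub>pairs_group G\<^esub> v"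
  unfolding pairs_group_def by simp

lemma pairs_group_diff_closed:
  "u \<in> carrier (pairs_group G) \<Longrightarrow> v \<in> carrier (pairs_group G) \<Longrightarrow> u - v \<in> carrier (pairs_group G)"
proof -
  interpret comm_group "pairs_group G" by (rule comm_group_pairs_group)
  show "u \<in> carrier (pairs_group G) \<Longrightarrow> v \<in> carrier (pairs_group G) \<Longrightarrow> u - v \<in> carrier (pairs_group G)"
    by (simp add: pairs_group_diff)
qed

lemma bilinear_relations_subset:
  assumes "group G"
  shows "bilinear_relations G \<subseteq> carrier (pairs_group G)"
proof -
  interpret group G by fact
  show ?thesis
    unfolding bilinear_relations_def
    by (auto intro!: pairs_group_diff_closed frag_of_in_pairs_group)
qed

lemma subgroup_bilinear_kernel:
  assumes "group G"
  shows "subgroup (bilinear_kernel G) (pairs_group G)"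
  unfolding bilinear_kernel_def pairs_group_def[symmetric]
  by (rule group.generate_is_subgroup[OF comm_group.axioms(2)[OF comm_group_pairs_group]
        bilinear_relations_subset[OF assms]])

lemma normal_bilinear_kernel:
  assumes "group G"
  shows "bilinear_kernel G \<lhd> pairs_group G"
  by (rule comm_group.subgroup_imp_normal[OF comm_group_pairs_group subgroup_bilinear_kernel[OF assms]])

lemma tensor_square_alt: "tensor_square G = pairs_group G Mod bilinear_kernel G"
  by (simp add: tensor_square_def pairs_group_def)

lemma tensor_alt: "tensor G x y = bilinear_kernel G #>\<^bsub>pairs_group G\<^esub> frag_of (x, y)"
  by (simp add: tensor_def pairs_group_def)

lemma comm_group_tensor_square:
  assumes "group G"
  shows "comm_group (tensor_square G)"
  unfolding tensor_square_alt
  by (rule comm_group.abelian_FactGroup[OF comm_group_pairs_group subgroup_bilinear_kernel[OF assms]])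

lemma tensor_closed:
  "x \<in> carrier G \<Longrightarrow> y \<in> carrier G \<Longrightarrow> tensor G x y \<in> carrier (tensor_square G)"
  unfolding tensor_square_alt tensor_alt carrier_FactGroup
  by (intro imageI frag_of_in_pairs_group)

lemma tensor_coset_mult:
  assumes "group G" "u \<in> carrier (pairs_group G)" "v \<in> carrier (pairs_group G)"
  shows "(bilinear_kernel G #>\<^bsub>pairs_group G\<^esub> u) \<otimes>\<^bsub>tensor_square G\<^esub>
      (bilinear_kernel G #>\<^bsub>pairs_group G\<^esub> v) = bilinear_kernel G #>\<^bsub>pairs_group G\<^esub> (u + v)"
  unfolding tensor_square_alt mult_FactGroup
  using normal.rcos_sum[OF normal_bilinear_kernel[OF assms(1)] assms(2,3)]
  by (simp add: pairs_group_def)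

lemma tensor_coset_relation:
  assumes "group G" "r \<in> bilinear_relations G" "v \<in> carrier (pairs_group G)"
  shows "bilinear_kernel G #>\<^bsub>pairs_group G\<^esub> (r + v) = bilinear_kernel G #>\<^bsub>pairs_group G\<^esub> v"
proof -
  interpret F: comm_group "pairs_group G" by (rule comm_group_pairs_group)
  interpret S: subgroup "bilinear_kernel G" "pairs_group G"
    by (rule subgroup_bilinear_kernel[OF assms(1)])
  have "r \<in> bilinear_kernel G"
    using assms(2) unfolding bilinear_kernel_def by (rule generate.incl)
  then have "r \<otimes>\<^bsub>pairs_group G\<^esub> v \<in> bilinear_kernel G #>\<^bsub>pairs_group G\<^esub> v"
    by (auto simp: r_coset_def)
  then have "bilinear_kernel G #>\<^bsub>pairs_group G\<^esub> v
      = bilinear_kernel G #>\<^bsub>pairs_group G\<^esub> (r \<otimes>\<^bsub>pairs_group G\<^esub> v)"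
    using assms(3) S.subgroup_axioms by (rule F.repr_independence)
  then show ?thesis by (simp add: pairs_group_def)
qed

lemma tensor_mult_left:
  assumes "group G" "x \<in> carrier G" "x' \<in> carrier G" "y \<in> carrier G"
  shows "tensor G (x \<otimes>\<^bsub>G\<^esub> x') y = tensor G x y \<otimes>\<^bsub>tensor_square G\<^esub> tensor G x' y"
proof -
  have "frag_of (x \<otimes>\<^bsub>G\<^esub> x', y) - frag_of (x, y) - frag_of (x', y) \<in> bilinear_relations G"
    unfolding bilinear_relations_def using assms by blast
  moreover have c: "frag_of (x, y) \<in> carrier (pairs_group G)" "frag_of (x', y) \<in> carrier (pairs_group G)"
    using assms by (auto intro: frag_of_in_pairs_group)
  moreover have "frag_of (x, y) + frag_of (x', y) \<in> carrier (pairs_group G)"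
    using monoid.m_closed[OF comm_monoid.axioms(1)[OF comm_group.axioms(1)[OF comm_group_pairs_group[of G]]] c]
    by (simp add: pairs_group_def)
  ultimately show ?thesis
    unfolding tensor_alt tensor_coset_mult[OF assms(1) c]
    by (subst tensor_coset_relation[OF assms(1), symmetric]) auto
qed

lemma tensor_mult_right:
  assumes "group G" "x \<in> carrier G" "y \<in> carrier G" "y' \<in> carrier G"
  shows "tensor G x (y \<otimes>\<^bsub>G\<^esub> y') = tensor G x y \<otimes>\<^bsub>tensor_square G\<^esub> tensor G x y'"
proof -
  have "frag_of (x, y \<otimes>\<^bsub>G\<^esub> y') - frag_of (x, y) - frag_of (x, y') \<in> bilinear_relations G"
    unfolding bilinear_relations_def using assms by blast
  moreover have c: "frag_of (x, y) \<in> carrier (pairs_group G)" "frag_of (x, y') \<in> carrier (pairs_group G)"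
    using assms by (auto intro: frag_of_in_pairs_group)
  moreover have "frag_of (x, y) + frag_of (x, y') \<in> carrier (pairs_group G)"
    using monoid.m_closed[OF comm_monoid.axioms(1)[OF comm_group.axioms(1)[OF comm_group_pairs_group[of G]]] c]
    by (simp add: pairs_group_def)
  ultimately show ?thesis
    unfolding tensor_alt tensor_coset_mult[OF assms(1) c]
    by (subst tensor_coset_relation[OF assms(1), symmetric]) auto
qed

lemma tensor_hom_left:
  assumes "group G" "y \<in> carrier G"
  shows "(\<lambda>x. tensor G x y) \<in> hom G (tensor_square G)"
  using assms by (intro homI) (simp_all add: tensor_closed tensor_mult_left)

lemma tensor_hom_right:
  assumes "group G" "x \<in> carrier G"
  shows "tensor G x \<in> hom G (tensor_square G)"
  using assms by (intro homI) (simp_all add: tensor_closed tensor_mult_right)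

text \<open>Universal property of the tensor square: \<beta> extends to the free abelian group on
  pairs, and bilinearity says that the extension kills the defining relations. Independence of the
  chosen tensor expansions rests on this.\<close>

lemma tensor_universal:
  assumes G: "group G" and K: "comm_group K"
    and \<beta>: "\<And>x y. x \<in> carrier G \<Longrightarrow> y \<in> carrier G \<Longrightarrow> \<beta> x y \<in> carrier K"
    and left: "\<And>x x' y. x \<in> carrier G \<Longrightarrow> x' \<in> carrier G \<Longrightarrow> y \<in> carrier G \<Longrightarrow>
      \<beta> (x \<otimes>\<^bsub>G\<^esub> x') y = \<beta> x y \<otimes>\<^bsub>K\<^esub> \<beta> x' y"
    and right: "\<And>x y y'. x \<in> carrier G \<Longrightarrow> y \<in> carrier G \<Longrightarrow> y' \<in> carrier G \<Longrightarrow>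
      \<beta> x (y \<otimes>\<^bsub>G\<^esub> y') = \<beta> x y \<otimes>\<^bsub>K\<^esub> \<beta> x y'"
  obtains h where "h \<in> hom (tensor_square G) K"
    "\<And>x y. x \<in> carrier G \<Longrightarrow> y \<in> carrier G \<Longrightarrow> h (tensor G x y) = \<beta> x y"
proof -
  interpret G: group G by fact
  interpret K: comm_group K by fact
  interpret F: comm_group "pairs_group G" by (rule comm_group_pairs_group)
  have "(\<lambda>(x, y). \<beta> x y) ` (carrier G \<times> carrier G) \<subseteq> carrier K" using \<beta> by auto
  then obtain h0 where "h0 \<in> hom (free_Abelian_group (carrier G \<times> carrier G)) K"
    and h0p: "\<And>z. z \<in> carrier G \<times> carrier G \<Longrightarrow> h0 (frag_of z) = (\<lambda>(x, y). \<beta> x y) z"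
    using K.free_Abelian_group_universal by blast
  then have h0: "h0 \<in> hom (pairs_group G) K" by (simp add: pairs_group_def)
  interpret h0: group_hom "pairs_group G" K h0
    by (intro group_hom.intro group_hom_axioms.intro h0 F.is_group K.is_group)
  have h0f: "h0 (frag_of (x, y)) = \<beta> x y" if "x \<in> carrier G" "y \<in> carrier G" for x y
    using h0p[of "(x, y)"] that by simp
  have h0d: "h0 (u - v) = h0 u \<otimes>\<^bsub>K\<^esub> inv\<^bsub>K\<^esub> h0 v"
    if "u \<in> carrier (pairs_group G)" "v \<in> carrier (pairs_group G)" for u v
    using that by (simp add: pairs_group_diff)
  have h0r: "h0 (u - v - w) = \<one>\<^bsub>K\<^esub>"
    if "u \<in> carrier (pairs_group G)" "v \<in> carrier (pairs_group G)" "w \<in> carrier (pairs_group G)"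
      "h0 u = h0 v \<otimes>\<^bsub>K\<^esub> h0 w" for u v w
  proof -
    have "h0 (u - v - w) = h0 w \<otimes>\<^bsub>K\<^esub> h0 v \<otimes>\<^bsub>K\<^esub> inv\<^bsub>K\<^esub> h0 v \<otimes>\<^bsub>K\<^esub> inv\<^bsub>K\<^esub> h0 w"
      using that by (simp add: h0d pairs_group_diff_closed K.m_comm)
    also have "\<dots> = \<one>\<^bsub>K\<^esub>" using that by (simp add: K.m_assoc)
    finally show ?thesis .
  qed
  have "bilinear_relations G \<subseteq> kernel (pairs_group G) K h0"
  proof
    fix r assume r: "r \<in> bilinear_relations G"
    then have "h0 r = \<one>\<^bsub>K\<^esub>"
      unfolding bilinear_relations_def
      by (elim UnE; clarsimp) (rule h0r; simp add: frag_of_in_pairs_group h0f left right)+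
    then show "r \<in> kernel (pairs_group G) K h0"
      using r bilinear_relations_subset[OF G] by (auto simp: kernel_def)
  qed
  then have "bilinear_kernel G \<subseteq> kernel (pairs_group G) K h0"
    unfolding bilinear_kernel_def pairs_group_def[symmetric]
    by (rule F.generate_subgroup_incl[OF _ h0.subgroup_kernel])
  then obtain h where "h \<in> hom (pairs_group G Mod bilinear_kernel G) K"
    and h: "\<And>u. u \<in> carrier (pairs_group G) \<Longrightarrow> h (bilinear_kernel G #>\<^bsub>pairs_group G\<^esub> u) = h0 u"
    using h0.FactGroup_universal_kernel[OF normal_bilinear_kernel[OF G]] by blast
  then show thesis
    using that[of h] h0f by (simp add: tensor_square_alt tensor_alt frag_of_in_pairs_group)
qed

text \<open>Serves as an induction principle: with \<open>S\<close> the set of tensors having some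
  property closed under the group operations, only pure tensors need to be checked.\<close>

lemma tensor_subgroup_eq_carrier:
  assumes G: "group G" and S: "subgroup S (tensor_square G)"
    and gen: "\<And>x y. x \<in> carrier G \<Longrightarrow> y \<in> carrier G \<Longrightarrow> tensor G x y \<in> S"
  shows "S = carrier (tensor_square G)"
proof
  interpret T: comm_group "tensor_square G" by (rule comm_group_tensor_square[OF G])
  interpret F: comm_group "pairs_group G" by (rule comm_group_pairs_group)
  let ?c = "\<lambda>u. bilinear_kernel G #>\<^bsub>pairs_group G\<^esub> u"
  show "S \<subseteq> carrier (tensor_square G)" using S by (rule subgroup.subset)
  have c: "?c u \<in> S" if "u \<in> carrier (pairs_group G)" for u
  proof -
    have "Poly_Mapping.keys u \<subseteq> carrier G \<times> carrier G"
      using that by (simp add: pairs_group_def)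
    then show ?thesis
    proof (rule free_Abelian_group_induct[where P = "\<lambda>u. ?c u \<in> S"])
      have "?c 0 = \<one>\<^bsub>tensor_square G\<^esub>"
        using F.coset_join2[OF F.one_closed subgroup_bilinear_kernel[OF G]] subgroup.one_closed[OF subgroup_bilinear_kernel[OF G]]
        by (simp add: tensor_square_alt) (simp add: pairs_group_def)
      then show "?c 0 \<in> S" using subgroup.one_closed[OF S] by simp
    next
      fix u v
      assume 2: "Poly_Mapping.keys u \<subseteq> carrier G \<times> carrier G" "?c u \<in> S"
        "Poly_Mapping.keys v \<subseteq> carrier G \<times> carrier G" "?c v \<in> S"
      have uv: "u \<in> carrier (pairs_group G)" "v \<in> carrier (pairs_group G)"
        using 2 by (simp_all add: pairs_group_def)
      have "?c (u - v) \<otimes>\<^bsub>tensor_square G\<^esub> ?c v = ?c u"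
        using tensor_coset_mult[OF G pairs_group_diff_closed[OF uv] uv(2)] by simp
      moreover have "?c (u - v) \<in> carrier (tensor_square G)" "?c u \<in> carrier (tensor_square G)"
        "?c v \<in> carrier (tensor_square G)"
        unfolding tensor_square_alt carrier_FactGroup using uv pairs_group_diff_closed[OF uv] by auto
      ultimately have "?c (u - v) = ?c u \<otimes>\<^bsub>tensor_square G\<^esub> inv\<^bsub>tensor_square G\<^esub> ?c v"
        by (metis T.inv_solve_right)
      then show "?c (u - v) \<in> S"
        using 2 subgroup.m_closed[OF S] subgroup.m_inv_closed[OF S] by simp
    next
      fix a assume "a \<in> carrier G \<times> carrier G"
      then show "?c (frag_of a) \<in> S" using gen unfolding tensor_alt by auto
    qed
  qed
  show "carrier (tensor_square G) \<subseteq> S"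
    unfolding tensor_square_alt carrier_FactGroup using c by auto
qed

lemma tensor_hom_eq:
  assumes G: "group G" and K: "group K"
    and h: "h \<in> hom (tensor_square G) K" "h' \<in> hom (tensor_square G) K"
    and eq: "\<And>x y. x \<in> carrier G \<Longrightarrow> y \<in> carrier G \<Longrightarrow> h (tensor G x y) = h' (tensor G x y)"
    and \<omega>: "\<omega> \<in> carrier (tensor_square G)"
  shows "h \<omega> = h' \<omega>"
proof -
  interpret T: comm_group "tensor_square G" by (rule comm_group_tensor_square[OF G])
  interpret K: group K by fact
  interpret h: group_hom "tensor_square G" K h
    by (intro group_hom.intro group_hom_axioms.intro h T.is_group K.is_group)
  interpret h': group_hom "tensor_square G" K h'
    by (intro group_hom.intro group_hom_axioms.intro h T.is_group K.is_group)
  have "subgroup {\<omega> \<in> carrier (tensor_square G). h \<omega> = h' \<omega>} (tensor_square G)"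
    by (rule T.subgroupI) (auto intro!: exI[of _ "\<one>\<^bsub>tensor_square G\<^esub>"])
  then have "{\<omega> \<in> carrier (tensor_square G). h \<omega> = h' \<omega>} = carrier (tensor_square G)"
    by (rule tensor_subgroup_eq_carrier[OF G]) (auto simp: eq tensor_closed)
  then show ?thesis using \<omega> by blast
qed

lemma tensor_sum_Nil: "tensor_sum G [] = \<one>\<^bsub>tensor_square G\<^esub>"
  by (simp add: tensor_sum_def)

lemma tensor_sum_Cons:
  "tensor_sum G ((x, y) # zs) = tensor G x y \<otimes>\<^bsub>tensor_square G\<^esub> tensor_sum G zs"
  by (simp add: tensor_sum_def)

lemma tensor_sum_closed:
  assumes G: "group G"
  shows "set zs \<subseteq> carrier G \<times> carrier G \<Longrightarrow> tensor_sum G zs \<in> carrier (tensor_square G)"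
proof -
  interpret T: comm_group "tensor_square G" by (rule comm_group_tensor_square[OF G])
  show "set zs \<subseteq> carrier G \<times> carrier G \<Longrightarrow> tensor_sum G zs \<in> carrier (tensor_square G)"
    by (induction zs) (auto simp: tensor_sum_Nil tensor_sum_Cons tensor_closed)
qed

lemma tensor_sum_append:
  assumes G: "group G" and "set zs \<subseteq> carrier G \<times> carrier G" "set ws \<subseteq> carrier G \<times> carrier G"
  shows "tensor_sum G (zs @ ws) = tensor_sum G zs \<otimes>\<^bsub>tensor_square G\<^esub> tensor_sum G ws"
proof -
  interpret T: comm_group "tensor_square G" by (rule comm_group_tensor_square[OF G])
  show ?thesis
    using assms(2) tensor_sum_closed[OF G assms(3)]
    by (induction zs) (auto simp: tensor_sum_Nil tensor_sum_Cons tensor_closed T.m_assoc tensor_sum_closed[OF G])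
qed

text \<open>The inverse of a pure tensor is the pure tensor with one argument inverted, so sums
  without coefficients already form a subgroup.\<close>

lemma tensor_expansion_exists:
  assumes G: "group G" and "\<omega> \<in> carrier (tensor_square G)"
  shows "\<exists>zs. set zs \<subseteq> carrier G \<times> carrier G \<and> \<omega> = tensor_sum G zs"
proof -
  interpret G: group G by fact
  interpret T: comm_group "tensor_square G" by (rule comm_group_tensor_square[OF G])
  let ?S = "{tensor_sum G zs | zs. set zs \<subseteq> carrier G \<times> carrier G}"
  have inv: "inv\<^bsub>tensor_square G\<^esub> tensor_sum G zs = tensor_sum G (map (\<lambda>(x, y). (inv\<^bsub>G\<^esub> x, y)) zs)"
    if "set zs \<subseteq> carrier G \<times> carrier G" for zs
    using that
  proof (induction zs)
    case Nil
    then show ?case by (simp add: tensor_sum_Nil)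
  next
    case (Cons z zs)
    obtain x y where z: "z = (x, y)" "x \<in> carrier G" "y \<in> carrier G" using Cons.prems by (cases z) auto
    have "tensor G (inv\<^bsub>G\<^esub> x) y = inv\<^bsub>tensor_square G\<^esub> tensor G x y"
    proof -
      interpret h: group_hom G "tensor_square G" "\<lambda>x. tensor G x y"
        by (intro group_hom.intro group_hom_axioms.intro tensor_hom_left G T.is_group z)
      show ?thesis using z by simp
    qed
    then show ?case
      using Cons z tensor_sum_closed[OF G, of zs] by (simp add: tensor_sum_Cons T.inv_mult tensor_closed)
  qed
  have "subgroup ?S (tensor_square G)"
  proof (rule T.subgroupI)
    show "?S \<subseteq> carrier (tensor_square G)" using tensor_sum_closed[OF G] by blast
    show "?S \<noteq> {}" by (auto intro: exI[of _ "[]"])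
    show "inv\<^bsub>tensor_square G\<^esub> a \<in> ?S" if a: "a \<in> ?S" for a
    proof -
      obtain zs where zs: "a = tensor_sum G zs" "set zs \<subseteq> carrier G \<times> carrier G" using a by blast
      have "set (map (\<lambda>(x, y). (inv\<^bsub>G\<^esub> x, y)) zs) \<subseteq> carrier G \<times> carrier G" using zs(2) by auto
      then show ?thesis using inv[OF zs(2)] zs(1) by blast
    qed
    show "a \<otimes>\<^bsub>tensor_square G\<^esub> b \<in> ?S" if ab: "a \<in> ?S" "b \<in> ?S" for a b
    proof -
      obtain zs where "a = tensor_sum G zs" "set zs \<subseteq> carrier G \<times> carrier G"
        using ab(1) by blast
      moreover obtain ws where "b = tensor_sum G ws" "set ws \<subseteq> carrier G \<times> carrier G"
        using ab(2) by blast
      ultimately show ?thesis using tensor_sum_append[OF G] by (intro CollectI exI[of _ "zs @ ws"]) simp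
    qed
  qed
  then have "?S = carrier (tensor_square G)"
  proof (rule tensor_subgroup_eq_carrier[OF G])
    fix x y assume "x \<in> carrier G" "y \<in> carrier G"
    then show "tensor G x y \<in> ?S"
      by (intro CollectI exI[of _ "[(x, y)]"]) (simp add: tensor_sum_Nil tensor_sum_Cons tensor_closed)
  qed
  then show ?thesis using assms(2) by blast
qed

lemma tensor_expansion:
  assumes "group G" "\<omega> \<in> carrier (tensor_square G)"
  shows "set (tensor_expansion G \<omega>) \<subseteq> carrier G \<times> carrier G"
    "tensor_sum G (tensor_expansion G \<omega>) = \<omega>"
  using someI_ex[OF tensor_expansion_exists[OF assms]] unfolding tensor_expansion_def by auto

text \<open>The homomorphism given by the universal property has the same value on every expansion
  of a tensor, in particular on the one picked by \<open>tensor_expansion\<close>.\<close>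

lemma tensor_map_eq_hom:
  assumes G: "group G" and H: "group H" and f: "f \<in> hom G H"
  obtains h where "h \<in> hom (tensor_square G) (tensor_square H)"
    "\<And>x y. x \<in> carrier G \<Longrightarrow> y \<in> carrier G \<Longrightarrow> h (tensor G x y) = tensor H (f x) (f y)"
    "\<And>\<omega>. \<omega> \<in> carrier (tensor_square G) \<Longrightarrow> tensor_map G H f \<omega> = h \<omega>"
proof -
  interpret T: comm_group "tensor_square G" by (rule comm_group_tensor_square[OF G])
  interpret U: comm_group "tensor_square H" by (rule comm_group_tensor_square[OF H])
  note fc = hom_in_carrier[OF f]
  obtain h where h: "h \<in> hom (tensor_square G) (tensor_square H)"
    and ht: "\<And>x y. x \<in> carrier G \<Longrightarrow> y \<in> carrier G \<Longrightarrow> h (tensor G x y) = tensor H (f x) (f y)"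
    by (rule tensor_universal[OF G U.comm_group_axioms, of "\<lambda>x y. tensor H (f x) (f y)"])
      (simp_all add: tensor_closed tensor_mult_left[OF H] tensor_mult_right[OF H] fc hom_mult[OF f])
  have hs: "h (tensor_sum G zs) = tensor_sum H (map (map_prod f f) zs)"
    if "set zs \<subseteq> carrier G \<times> carrier G" for zs
    using that
  proof (induction zs)
    case Nil
    then show ?case using hom_one[OF h T.is_group U.is_group] by (simp add: tensor_sum_Nil)
  next
    case (Cons z zs)
    then show ?case
      by (cases z) (auto simp: tensor_sum_Cons hom_mult[OF h] ht tensor_closed tensor_sum_closed[OF G])
  qed
  show thesis
  proof (rule that[OF h ht])
    fix \<omega> assume "\<omega> \<in> carrier (tensor_square G)"
    then show "tensor_map G H f \<omega> = h \<omega>"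
      unfolding tensor_map_def using hs tensor_expansion[OF G] by metis
  qed
qed

lemma tensor_map_hom:
  assumes "group G" "group H" "f \<in> hom G H"
  shows "tensor_map G H f \<in> hom (tensor_square G) (tensor_square H)"
proof -
  interpret T: comm_group "tensor_square G" by (rule comm_group_tensor_square[OF assms(1)])
  obtain h where h: "h \<in> hom (tensor_square G) (tensor_square H)"
    "\<And>\<omega>. \<omega> \<in> carrier (tensor_square G) \<Longrightarrow> tensor_map G H f \<omega> = h \<omega>"
    using tensor_map_eq_hom[OF assms] by metis
  show ?thesis using h(1) by (auto simp: hom_def h(2) Pi_iff)
qed

lemma tensor_map_tensor:
  assumes "group G" "group H" "f \<in> hom G H" "x \<in> carrier G" "y \<in> carrier G"
  shows "tensor_map G H f (tensor G x y) = tensor H (f x) (f y)"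
  using tensor_map_eq_hom[OF assms(1-3)] tensor_closed[OF assms(4,5)] assms(4,5) by metis

lemma tensor_map_comp:
  assumes G: "group G" and H: "group H" and K: "group K" and f: "f \<in> hom G H" and g: "g \<in> hom H K"
    and \<omega>: "\<omega> \<in> carrier (tensor_square G)"
  shows "tensor_map H K g (tensor_map G H f \<omega>) = tensor_map G K (compose (carrier G) g f) \<omega>"
proof -
  have gf: "compose (carrier G) g f \<in> hom G K"
    using f g by (auto simp: hom_def compose_def Pi_iff group.is_monoid[OF G] monoid.m_closed)
  have "tensor_map H K g \<circ> tensor_map G H f \<in> hom (tensor_square G) (tensor_square K)"
    by (rule Group.hom_compose[OF tensor_map_hom[OF G H f] tensor_map_hom[OF H K g]])
  then have "(tensor_map H K g \<circ> tensor_map G H f) \<omega> = tensor_map G K (compose (carrier G) g f) \<omega>"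
    by (rule tensor_hom_eq[OF G comm_group.axioms(2)[OF comm_group_tensor_square[OF K]] _
        tensor_map_hom[OF G K gf] _ \<omega>])
      (simp add: tensor_map_tensor G H K f g gf hom_in_carrier[OF f] compose_eq)
  then show ?thesis by simp
qed

lemma tensor_map_id:
  assumes G: "group G" and \<omega>: "\<omega> \<in> carrier (tensor_square G)"
  shows "tensor_map G G (\<lambda>x\<in>carrier G. x) \<omega> = \<omega>"
proof -
  interpret G: group G by fact
  have i: "(\<lambda>x\<in>carrier G. x) \<in> hom G G" by (auto simp: hom_def)
  have idh: "id \<in> hom (tensor_square G) (tensor_square G)" by (auto simp: hom_def)
  have "tensor_map G G (\<lambda>x\<in>carrier G. x) \<omega> = id \<omega>"
    by (intro tensor_hom_eq[OF G comm_group.axioms(2)[OF comm_group_tensor_square[OF G]]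
        tensor_map_hom[OF G G i] idh _ \<omega>]) (simp add: tensor_map_tensor[OF G G i])
  then show ?thesis by simp
qed

text \<open>On l^m-torsion characters the scaled product of lifts is bilinear modulo integers, so it
  factors through the tensor square, and neither the expansion nor the lifts matter.\<close>

lemma tensor_form_hom:
  assumes G: "group G" and ab: "\<alpha> \<in> carrier (torsion (dual G) (l ^ m))"
      "\<beta> \<in> carrier (torsion (dual G) (l ^ m))"
  shows "(\<lambda>\<omega>. tensor_form l G \<omega> m \<alpha> \<beta>) \<in> hom (tensor_square G) Q_mod_Z" (is ?th1)
    and "\<And>x y. x \<in> carrier G \<Longrightarrow> y \<in> carrier G \<Longrightarrow> tensor_form l G (tensor G x y) m \<alpha> \<beta> =
      rat_class (of_nat (l ^ m) * (rat_lift (\<alpha> x) * rat_lift (\<beta> y)))" (is "PROP ?th2")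
proof -
  interpret G: group G by fact
  interpret T: comm_group "tensor_square G" by (rule comm_group_tensor_square[OF G])
  let ?b = "\<lambda>x y. rat_class (of_nat (l ^ m) * (rat_lift (\<alpha> x) * rat_lift (\<beta> y)))"
  have d: "\<alpha> \<in> carrier (dual G)" "\<beta> \<in> carrier (dual G)" using ab by (auto simp: carrier_torsion)
  have I: "of_nat (l ^ m) * rat_lift (\<alpha> x) \<in> \<int>" "rat_class (rat_lift (\<alpha> x)) = \<alpha> x"
      "of_nat (l ^ m) * rat_lift (\<beta> x) \<in> \<int>" "rat_class (rat_lift (\<beta> x)) = \<beta> x"
    if "x \<in> carrier G" for x
    using torsion_dual_lift[OF ab(1) that] torsion_dual_lift[OF ab(2) that] by auto
  have left: "?b (x \<otimes>\<^bsub>G\<^esub> x') y = ?b x y \<otimes>\<^bsub>Q_mod_Z\<^esub> ?b x' y"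
    if "x \<in> carrier G" "x' \<in> carrier G" "y \<in> carrier G" for x x' y
  proof -
    have "rat_class (rat_lift (\<alpha> (x \<otimes>\<^bsub>G\<^esub> x'))) = rat_class (rat_lift (\<alpha> x) + rat_lift (\<alpha> x'))"
      using that d by (simp add: I dual_hom_mult dual_closed rat_lift rat_class_add[symmetric])
    then have "?b (x \<otimes>\<^bsub>G\<^esub> x') y =
        rat_class (of_nat (l ^ m) * ((rat_lift (\<alpha> x) + rat_lift (\<alpha> x')) * rat_lift (\<beta> y)))"
      by (rule rat_class_lift_mult[OF I(1)[OF G.m_closed[OF that(1,2)]] I(3)[OF that(3)] _ refl])
    then show ?thesis by (simp add: rat_class_add algebra_simps)
  qed
  have right: "?b x (y \<otimes>\<^bsub>G\<^esub> y') = ?b x y \<otimes>\<^bsub>Q_mod_Z\<^esub> ?b x y'"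
    if "x \<in> carrier G" "y \<in> carrier G" "y' \<in> carrier G" for x y y'
  proof -
    have "rat_class (rat_lift (\<beta> (y \<otimes>\<^bsub>G\<^esub> y'))) = rat_class (rat_lift (\<beta> y) + rat_lift (\<beta> y'))"
      using that d by (simp add: I dual_hom_mult dual_closed rat_lift rat_class_add[symmetric])
    then have "?b x (y \<otimes>\<^bsub>G\<^esub> y') =
        rat_class (of_nat (l ^ m) * (rat_lift (\<alpha> x) * (rat_lift (\<beta> y) + rat_lift (\<beta> y'))))"
      by (rule rat_class_lift_mult[OF I(1)[OF that(1)] I(3)[OF G.m_closed[OF that(2,3)]] refl])
    then show ?thesis by (simp add: rat_class_add algebra_simps)
  qed
  obtain h where h: "h \<in> hom (tensor_square G) Q_mod_Z"
    and ht: "\<And>x y. x \<in> carrier G \<Longrightarrow> y \<in> carrier G \<Longrightarrow> h (tensor G x y) = ?b x y"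
    by (rule tensor_universal[OF G comm_group_Q_mod_Z, of ?b]) (simp_all only: left right rat_class_in_carrier)
  have hs: "h (tensor_sum G zs) =
      rat_class (of_nat (l ^ m) * (\<Sum>(x, y) \<leftarrow> zs. rat_lift (\<alpha> x) * rat_lift (\<beta> y)))"
    if "set zs \<subseteq> carrier G \<times> carrier G" for zs
    using that
  proof (induction zs)
    case Nil
    then show ?case
      using hom_one[OF h T.is_group QZ.is_group] by (simp add: tensor_sum_Nil one_Q_mod_Z)
  next
    case (Cons z zs)
    then show ?case
      by (cases z) (auto simp: tensor_sum_Cons hom_mult[OF h] ht tensor_closed
          tensor_sum_closed[OF G] rat_class_add algebra_simps)
  qed
  have eq: "tensor_form l G \<omega> m \<alpha> \<beta> = h \<omega>" if "\<omega> \<in> carrier (tensor_square G)" for \<omega>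
    unfolding tensor_form_def using hs[OF tensor_expansion(1)[OF G that]] tensor_expansion(2)[OF G that]
    by simp
  show ?th1 using h by (auto simp: hom_def eq Pi_iff)
  show "PROP ?th2" by (simp add: eq tensor_closed ht)
qed

text \<open>Both sides are homomorphisms in \<omega>, so comparing them on pure tensors
  suffices.\<close>

lemma tensor_form_map:
  assumes G: "group G" and H: "group H" and f: "f \<in> hom G H"
    and ab: "\<alpha> \<in> carrier (torsion (dual H) (l ^ m))" "\<beta> \<in> carrier (torsion (dual H) (l ^ m))"
    and \<omega>: "\<omega> \<in> carrier (tensor_square G)"
  shows "tensor_form l H (tensor_map G H f \<omega>) m \<alpha> \<beta>
    = tensor_form l G \<omega> m (dual_map G f \<alpha>) (dual_map G f \<beta>)"
proof -
  note ab' = ab[THEN dual_map_torsion[OF G f]]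
  have "((\<lambda>\<omega>. tensor_form l H \<omega> m \<alpha> \<beta>) \<circ> tensor_map G H f) \<omega>
    = (\<lambda>\<omega>. tensor_form l G \<omega> m (dual_map G f \<alpha>) (dual_map G f \<beta>)) \<omega>"
    by (rule tensor_hom_eq[OF G QZ.is_group
          Group.hom_compose[OF tensor_map_hom[OF G H f] tensor_form_hom(1)[OF H ab]]
          tensor_form_hom(1)[OF G ab'] _ \<omega>])
      (simp add: tensor_map_tensor[OF G H f] tensor_form_hom(2)[OF H ab] tensor_form_hom(2)[OF G ab']
        hom_in_carrier[OF f] dual_map_apply)
  then show ?thesis by simp
qed

subsection \<open>Transport of BEGs and counting of isomorphisms\<close>

lemma nat_pow_wedge_square [simp]:
  "x [^]\<^bsub>wedge_square G\<^esub> (n::nat) = x [^]\<^bsub>tensor_square G\<^esub> n"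
  by (induction n) (simp_all add: wedge_square_def nat_pow_def)

lemma wedge_square_simps [simp]:
  "mult (wedge_square G) = mult (tensor_square G)" "one (wedge_square G) = one (tensor_square G)"
  by (simp_all add: wedge_square_def)

lemma subgroup_wedge_square:
  assumes "group G"
  shows "subgroup (carrier (wedge_square G)) (tensor_square G)"
proof -
  interpret T: comm_group "tensor_square G" by (rule comm_group_tensor_square[OF assms])
  show ?thesis unfolding wedge_square_def carrier_subgroup_generated
    by (rule T.generate_is_subgroup) blast
qed

lemma comm_group_wedge_square:
  assumes "group G"
  shows "comm_group (wedge_square G)"
proof -
  interpret T: comm_group "tensor_square G" by (rule comm_group_tensor_square[OF assms])
  show ?thesis
    unfolding wedge_square_def
    by (rule T.abelian_subgroup_generated) (rule T.comm_group_axioms)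
qed

lemma wedge_square_subset:
  assumes "group G" "\<omega> \<in> carrier (wedge_square G)"
  shows "\<omega> \<in> carrier (tensor_square G)"
  using subgroup.subset[OF subgroup_wedge_square[OF assms(1)]] assms(2) by blast

lemma wedge_closed:
  assumes "group G" "x \<in> carrier G" "y \<in> carrier G"
  shows "wedge G x y \<in> carrier (tensor_square G)"
proof -
  interpret T: comm_group "tensor_square G" by (rule comm_group_tensor_square[OF assms(1)])
  show ?thesis using assms by (simp add: wedge_def tensor_closed)
qed

lemma wedge_in_wedge_square:
  assumes "group G" "x \<in> carrier G" "y \<in> carrier G"
  shows "wedge G x y \<in> carrier (wedge_square G)"
  unfolding wedge_square_def carrier_subgroup_generated
  by (rule generate.incl) (use wedge_closed[OF assms] assms in blast)

lemma wedge_square_minimal: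
  assumes "group G" "subgroup S (tensor_square G)"
    and "\<And>x y. x \<in> carrier G \<Longrightarrow> y \<in> carrier G \<Longrightarrow> wedge G x y \<in> S"
  shows "carrier (wedge_square G) \<subseteq> S"
proof -
  interpret T: comm_group "tensor_square G" by (rule comm_group_tensor_square[OF assms(1)])
  show ?thesis unfolding wedge_square_def
    by (rule T.subgroup_generated_minimal[OF assms(2)]) (use assms(3) in blast)
qed

lemma tensor_map_wedge_square:
  assumes G: "group G" and H: "group H" and f: "f \<in> hom G H"
    and \<omega>: "\<omega> \<in> carrier (wedge_square G)"
  shows "tensor_map G H f \<omega> \<in> carrier (wedge_square H)"
proof -
  interpret T: comm_group "tensor_square G" by (rule comm_group_tensor_square[OF G])
  interpret U: comm_group "tensor_square H" by (rule comm_group_tensor_square[OF H])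
  interpret h: group_hom "tensor_square G" "tensor_square H" "tensor_map G H f"
    by (intro group_hom.intro group_hom_axioms.intro tensor_map_hom G H f T.is_group U.is_group)
  interpret W: subgroup "carrier (wedge_square H)" "tensor_square H"
    by (rule subgroup_wedge_square[OF H])
  let ?S = "{\<omega> \<in> carrier (tensor_square G). tensor_map G H f \<omega> \<in> carrier (wedge_square H)}"
  have "subgroup ?S (tensor_square G)"
    by (rule T.subgroupI)
      (auto simp: W.m_closed W.m_inv_closed W.one_closed intro!: exI[of _ "\<one>\<^bsub>tensor_square G\<^esub>"])
  then have "carrier (wedge_square G) \<subseteq> ?S"
  proof (rule wedge_square_minimal[OF G])
    fix x y assume xy: "x \<in> carrier G" "y \<in> carrier G"
    have "tensor_map G H f (wedge G x y) = wedge H (f x) (f y)"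
      using xy by (simp add: wedge_def tensor_closed tensor_map_tensor[OF G H f])
    then show "wedge G x y \<in> ?S"
      using xy wedge_closed[OF G xy] wedge_in_wedge_square[OF H] hom_in_carrier[OF f] by simp
  qed
  then show ?thesis using \<omega> by blast
qed

lemma is_begD:
  assumes "is_beg l n (G, \<omega>, \<psi>)"
  shows "finite_abelian_primary l G" "comm_group G" "group G" "finite (carrier G)"
    "\<omega> \<in> carrier (torsion (wedge_square G) (l ^ n))" "\<omega> \<in> carrier (wedge_square G)"
    "\<omega> \<in> carrier (tensor_square G)"
    "\<psi> \<in> hom (torsion (dual G) (l ^ n)) (torsion G (l ^ n))"
    "\<psi> \<in> extensional (carrier (torsion (dual G) (l ^ n)))"
  using assms wedge_square_subset[of G \<omega>]
  by (auto simp: is_beg_def finite_abelian_primary_def carrier_torsion comm_group.axioms(2))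

lemma is_beg_identity:
  assumes "is_beg l n (G, \<omega>, \<psi>)"
    "\<alpha> \<in> carrier (torsion (dual G) (l ^ (n + r)))" "\<beta> \<in> carrier (torsion (dual G) (l ^ (n + r)))"
  shows "\<beta> (\<psi> (\<alpha> [^]\<^bsub>dual G\<^esub> (l ^ r))) =
        \<alpha> (\<psi> (\<beta> [^]\<^bsub>dual G\<^esub> (l ^ r))) \<otimes>\<^bsub>Q_mod_Z\<^esub>
          (tensor_form l G \<omega> (n + r) \<alpha> \<beta> [^]\<^bsub>Q_mod_Z\<^esub> (2::nat))"
  using assms by (simp add: is_beg_def)

text \<open>Transport of structure along f: \<omega> goes to its image and \<psi> to f \<psi>
  f^dual. Morphisms become the homomorphisms that push one structure forward to the other, and
  automorphisms of the group act on its structures.\<close>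

definition beg_push ::
    "nat \<Rightarrow> nat \<Rightarrow> ('a \<Rightarrow> 'c) \<Rightarrow> ('a, 'b) monoid_scheme \<Rightarrow> ('c, 'd) monoid_scheme \<Rightarrow>
     (('a \<times> 'a) \<Rightarrow>\<^sub>0 int) set \<times> (('a \<Rightarrow> rat set) \<Rightarrow> 'a) \<Rightarrow>
     (('c \<times> 'c) \<Rightarrow>\<^sub>0 int) set \<times> (('c \<Rightarrow> rat set) \<Rightarrow> 'c)" where
  "beg_push l n f K G = (\<lambda>(\<omega>, \<psi>). (tensor_map K G f \<omega>,
     \<lambda>\<beta>\<in>carrier (torsion (dual G) (l ^ n)). f (\<psi> (dual_map K f \<beta>))))"

lemma beg_hom_iff_push:
  assumes "is_beg l n (G, x)"
  shows "f \<in> beg_hom l n (K, y) (G, x) \<longleftrightarrow>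
    f \<in> hom K G \<and> f \<in> extensional (carrier K) \<and> beg_push l n f K G y = x"
proof -
  obtain \<omega> \<psi> where y: "y = (\<omega>, \<psi>)" by (cases y)
  obtain \<omega>' \<psi>' where x: "x = (\<omega>', \<psi>')" by (cases x)
  have ext: "\<psi>' \<in> extensional (carrier (torsion (dual G) (l ^ n)))"
    using is_begD(9) assms x by blast
  have "(\<forall>\<beta> \<in> carrier (torsion (dual G) (l ^ n)). f (\<psi> (dual_map K f \<beta>)) = \<psi>' \<beta>) \<longleftrightarrow>
    (\<lambda>\<beta>\<in>carrier (torsion (dual G) (l ^ n)). f (\<psi> (dual_map K f \<beta>))) = \<psi>'"
    using ext by (auto simp: fun_eq_iff extensional_def)
  then show ?thesis unfolding beg_hom_def beg_push_def x y by auto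
qed

lemma torsion_hom_closed:
  assumes "group K" "group G" "f \<in> hom K G" "x \<in> carrier (torsion K t)"
  shows "f x \<in> carrier (torsion G t)"
proof -
  interpret group_hom K G f by (intro group_hom.intro group_hom_axioms.intro assms)
  show ?thesis using assms(4) by (simp add: carrier_torsion flip: hom_nat_pow)
qed

text \<open>The identity for \<alpha>, \<beta> on \<open>G\<close> is the identity on
  \<open>K\<close> for their pullbacks along f, by naturality of \<open>tensor_form\<close>.\<close>

lemma is_beg_push:
  assumes B: "is_beg l n (K, x)" and G: "comm_group G" and f: "f \<in> iso K G"
  shows "is_beg l n (G, beg_push l n f K G x)"
proof -
  obtain \<omega> \<psi> where x: "x = (\<omega>, \<psi>)" by (cases x)
  note B' = B[unfolded x] note D = is_begD[OF B']
  interpret K: comm_group K by fact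
  interpret G: comm_group G by fact
  have fh: "f \<in> hom K G" and fb: "bij_betw f (carrier K) (carrier G)" using f by (auto simp: iso_def)
  let ?D = "carrier (torsion (dual G) (l ^ n))"
  let ?\<psi> = "\<lambda>\<beta>\<in>?D. f (\<psi> (dual_map K f \<beta>))"
  note dt = dual_map_torsion[OF K.is_group fh]
  interpret dG: comm_group "dual G" by (rule comm_group_dual[OF G])
  interpret T: comm_group "torsion (dual G) (l ^ n)" by (rule comm_group_torsion[OF dG.comm_group_axioms])
  interpret h: group_hom "tensor_square K" "tensor_square G" "tensor_map K G f"
    by (intro group_hom.intro group_hom_axioms.intro tensor_map_hom fh K.is_group G.is_group
        comm_group.axioms(2)[OF comm_group_tensor_square])
  have prim: "finite_abelian_primary l G"
    using D(1) G bij_betw_finite[OF fb] bij_betw_same_card[OF fb]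
    by (auto simp: finite_abelian_primary_def order_def)
  have psi: "\<psi> (dual_map K f \<beta>) \<in> carrier (torsion K (l ^ n))" if "\<beta> \<in> ?D" for \<beta>
    using hom_in_carrier[OF D(8) dt[OF that]] .
  then have psiK: "\<psi> (dual_map K f \<beta>) \<in> carrier K" if "\<beta> \<in> ?D" for \<beta>
    using that by (simp add: carrier_torsion)
  have "tensor_map K G f \<omega> \<in> carrier (torsion (wedge_square G) (l ^ n))"
    using D(5,7) tensor_map_wedge_square[OF K.is_group G.is_group fh D(6)]
    by (simp add: carrier_torsion h.hom_nat_pow[symmetric])
  moreover have "?\<psi> \<in> hom (torsion (dual G) (l ^ n)) (torsion G (l ^ n))"
  proof (rule homI)
    fix \<alpha> assume a: "\<alpha> \<in> ?D"
    then show "?\<psi> \<alpha> \<in> carrier (torsion G (l ^ n))"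
      using torsion_hom_closed[OF K.is_group G.is_group fh psi[OF a]] by simp
    fix \<beta> assume b: "\<beta> \<in> ?D"
    have "\<psi> (dual_map K f (\<alpha> \<otimes>\<^bsub>dual G\<^esub> \<beta>)) = \<psi> (dual_map K f \<alpha>) \<otimes>\<^bsub>K\<^esub> \<psi> (dual_map K f \<beta>)"
      using hom_mult[OF D(8) dt[OF a] dt[OF b]] by (simp add: dual_map_mult[OF fh])
    then show "?\<psi> (\<alpha> \<otimes>\<^bsub>torsion (dual G) (l ^ n)\<^esub> \<beta>)
        = ?\<psi> \<alpha> \<otimes>\<^bsub>torsion G (l ^ n)\<^esub> ?\<psi> \<beta>"
      using a b T.m_closed[OF a b] hom_mult[OF fh psiK[OF a] psiK[OF b]] by simp
  qed
  moreover have "\<beta> (?\<psi> (\<alpha> [^]\<^bsub>dual G\<^esub> (l ^ r))) =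
      \<alpha> (?\<psi> (\<beta> [^]\<^bsub>dual G\<^esub> (l ^ r))) \<otimes>\<^bsub>Q_mod_Z\<^esub>
        (tensor_form l G (tensor_map K G f \<omega>) (n + r) \<alpha> \<beta> [^]\<^bsub>Q_mod_Z\<^esub> (2::nat))"
    if ab: "\<alpha> \<in> carrier (torsion (dual G) (l ^ (n + r)))"
      "\<beta> \<in> carrier (torsion (dual G) (l ^ (n + r)))" for r \<alpha> \<beta>
  proof -
    have m: "\<alpha> [^]\<^bsub>dual G\<^esub> (l ^ r) \<in> ?D" if "\<alpha> \<in> carrier (torsion (dual G) (l ^ (n + r)))" for \<alpha>
      using that by (simp add: carrier_torsion dG.nat_pow_pow power_add mult.commute)
    have e: "?\<psi> (\<alpha> [^]\<^bsub>dual G\<^esub> (l ^ r)) = f (\<psi> (dual_map K f \<alpha> [^]\<^bsub>dual K\<^esub> (l ^ r)))"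
        "\<psi> (dual_map K f \<alpha> [^]\<^bsub>dual K\<^esub> (l ^ r)) \<in> carrier K"
      if "\<alpha> \<in> carrier (torsion (dual G) (l ^ (n + r)))" for \<alpha>
      using m[OF that] psiK[OF m[OF that]] by (simp_all add: dual_map_nat_pow[OF fh])
    show ?thesis
      using is_beg_identity[OF B' dt[OF ab(1)] dt[OF ab(2)]]
      unfolding e(1)[OF ab(1)] e(1)[OF ab(2)]
        tensor_form_map[OF K.is_group G.is_group fh ab D(7)]
      by (simp add: dual_map_apply e(2)[OF ab(1)] e(2)[OF ab(2)])
  qed
  ultimately show ?thesis
    using prim unfolding x beg_push_def is_beg_def by simp
qed

lemma hom_compose_extensional:
  assumes "group K" "f \<in> hom K G" "g \<in> hom G H"
  shows "compose (carrier K) g f \<in> hom K H"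
proof -
  interpret group K by fact
  show ?thesis
    by (rule homI) (simp_all add: compose_eq hom_in_carrier[OF assms(2)] hom_in_carrier[OF assms(3)]
        hom_mult[OF assms(2)] hom_mult[OF assms(3)])
qed

lemma beg_push_compose:
  assumes B: "is_beg l n (K, x)" and G: "group G" and H: "group H"
    and f: "f \<in> hom K G" and g: "g \<in> hom G H"
  shows "beg_push l n g G H (beg_push l n f K G x) = beg_push l n (compose (carrier K) g f) K H x"
proof -
  obtain \<omega> \<psi> where x: "x = (\<omega>, \<psi>)" by (cases x)
  note D = is_begD[OF B[unfolded x]]
  have "f (\<psi> (dual_map K f (dual_map G g \<beta>))) \<in> carrier G \<and>
      \<psi> (dual_map K f (dual_map G g \<beta>)) \<in> carrier K"
    if "\<beta> \<in> carrier (torsion (dual H) (l ^ n))" for \<beta>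
    using hom_in_carrier[OF D(8) dual_map_torsion[OF D(3) f dual_map_torsion[OF G g that]]]
      hom_in_carrier[OF f] by (simp add: carrier_torsion)
  then show ?thesis
    unfolding x beg_push_def
    using dual_map_torsion[OF G g]
    by (simp add: tensor_map_comp[OF D(3) G H f g D(7)] dual_map_comp[OF f g] compose_eq cong: restrict_cong)
qed

lemma beg_push_id:
  assumes B: "is_beg l n (K, x)"
  shows "beg_push l n (\<lambda>x\<in>carrier K. x) K K x = x"
proof -
  obtain \<omega> \<psi> where x: "x = (\<omega>, \<psi>)" by (cases x)
  note D = is_begD[OF B[unfolded x]]
  have "(\<lambda>\<beta>\<in>carrier (torsion (dual K) (l ^ n)). (\<lambda>x\<in>carrier K. x) (\<psi> (dual_map K (\<lambda>x\<in>carrier K. x) \<beta>))) = \<psi>"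
  proof (rule extensionalityI[OF restrict_extensional D(9)])
    fix \<beta> assume b: "\<beta> \<in> carrier (torsion (dual K) (l ^ n))"
    then show "(\<lambda>\<beta>\<in>carrier (torsion (dual K) (l ^ n)).
        (\<lambda>x\<in>carrier K. x) (\<psi> (dual_map K (\<lambda>x\<in>carrier K. x) \<beta>))) \<beta> = \<psi> \<beta>"
      using hom_in_carrier[OF D(8) b] by (simp add: carrier_torsion dual_map_id)
  qed
  then show ?thesis unfolding x beg_push_def by (simp add: tensor_map_id[OF D(3) D(7)])
qed

definition ext_iso :: "('a, 'b) monoid_scheme \<Rightarrow> ('c, 'd) monoid_scheme \<Rightarrow> ('a \<Rightarrow> 'c) set" where
  "ext_iso K G = iso K G \<inter> extensional (carrier K)"

lemma ext_iso_inverse: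
  assumes "group K" "group G" "f \<in> ext_iso K G"
  obtains g where "g \<in> ext_iso G K" "compose (carrier K) g f = (\<lambda>x\<in>carrier K. x)"
    "compose (carrier G) f g = (\<lambda>y\<in>carrier G. y)"
proof -
  have f: "f \<in> iso K G" "bij_betw f (carrier K) (carrier G)" using assms by (auto simp: ext_iso_def iso_def)
  let ?g = "\<lambda>y\<in>carrier G. inv_into (carrier K) f y"
  have "?g \<in> iso G K"
    by (rule group.iso_eq[OF assms(2) group.iso_set_sym[OF assms(1) f(1)]]) simp
  then have "?g \<in> ext_iso G K" by (simp add: ext_iso_def)
  moreover have "compose (carrier K) ?g f = (\<lambda>x\<in>carrier K. x)" by (rule compose_inv_into_id[OF f(2)])
  moreover have "compose (carrier G) f ?g = (\<lambda>y\<in>carrier G. y)"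
    by (rule compose_id_inv_into) (use f(2) in \<open>simp add: bij_betw_def\<close>)
  ultimately show thesis by (rule that)
qed

lemma ext_iso_compose:
  assumes "group K" "f \<in> ext_iso K G" "g \<in> ext_iso G H"
  shows "compose (carrier K) g f \<in> ext_iso K H"
  using assms hom_compose_extensional[OF assms(1), of f G g H] bij_betw_compose[of f "carrier K" "carrier G" g "carrier H"]
  by (simp add: ext_iso_def iso_def)

text \<open>By functoriality of the pushforward, the inverse of a group isomorphism that transports
  the structure transports it back; the condition on the inverse morphism is therefore
  automatic.\<close>

lemma beg_iso_iff:
  assumes A: "is_beg l n (K, y)" and B: "is_beg l n (G, x)"
  shows "f \<in> beg_iso l n (K, y) (G, x) \<longleftrightarrow> f \<in> ext_iso K G \<and> beg_push l n f K G y = x"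
proof
  interpret K: group K using is_begD(3) A by (metis prod.collapse)
  interpret G: group G using is_begD(3) B by (metis prod.collapse)
  assume "f \<in> beg_iso l n (K, y) (G, x)"
  then obtain g where f: "f \<in> beg_hom l n (K, y) (G, x)" and g: "g \<in> beg_hom l n (G, x) (K, y)"
    and gf: "compose (carrier K) g f = (\<lambda>x\<in>carrier K. x)"
    and fg: "compose (carrier G) f g = (\<lambda>y\<in>carrier G. y)"
    unfolding beg_iso_def by auto
  have fh: "f \<in> hom K G" "f \<in> extensional (carrier K)" "beg_push l n f K G y = x"
    using f unfolding beg_hom_iff_push[OF B] by auto
  have gh: "g \<in> hom G K" using g unfolding beg_hom_iff_push[OF A] by auto
  have "g (f z) = z" if "z \<in> carrier K" for z using fun_cong[OF gf, of z] that by (simp add: compose_eq)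
  moreover have "f (g z) = z" if "z \<in> carrier G" for z using fun_cong[OF fg, of z] that by (simp add: compose_eq)
  ultimately have "bij_betw f (carrier K) (carrier G)"
    using hom_in_carrier[OF fh(1)] hom_in_carrier[OF gh] by (intro bij_betw_byWitness[where f' = g]) auto
  then show "f \<in> ext_iso K G \<and> beg_push l n f K G y = x"
    using fh by (simp add: ext_iso_def iso_def)
next
  interpret K: group K using is_begD(3) A by (metis prod.collapse)
  interpret G: group G using is_begD(3) B by (metis prod.collapse)
  assume f: "f \<in> ext_iso K G \<and> beg_push l n f K G y = x"
  then obtain g where g: "g \<in> ext_iso G K" "compose (carrier K) g f = (\<lambda>x\<in>carrier K. x)"
    "compose (carrier G) f g = (\<lambda>y\<in>carrier G. y)"
    using ext_iso_inverse[OF K.is_group G.is_group] by blast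
  have fh: "f \<in> hom K G" "f \<in> extensional (carrier K)" and gh: "g \<in> hom G K" "g \<in> extensional (carrier G)"
    using f g by (auto simp: ext_iso_def iso_def)
  have "beg_push l n g G K x = y"
    using beg_push_compose[OF A G.is_group K.is_group fh(1) gh(1)] beg_push_id[OF A] f g(2) by simp
  then have "g \<in> beg_hom l n (G, x) (K, y)" unfolding beg_hom_iff_push[OF A] using gh by simp
  moreover have "f \<in> beg_hom l n (K, y) (G, x)" unfolding beg_hom_iff_push[OF B] using fh f by simp
  ultimately show "f \<in> beg_iso l n (K, y) (G, x)" unfolding beg_iso_def using g by auto
qed

lemma beg_iso_sym: "beg_iso l n A B \<noteq> {} \<Longrightarrow> beg_iso l n B A \<noteq> {}"
  unfolding beg_iso_def by blast

lemma beg_iso_compose: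
  assumes A: "is_beg l n (K, y)" and B: "is_beg l n (G, x)" and C: "is_beg l n (H, z)"
    and f: "f \<in> beg_iso l n (K, y) (G, x)" and g: "g \<in> beg_iso l n (G, x) (H, z)"
  shows "compose (carrier K) g f \<in> beg_iso l n (K, y) (H, z)"
proof -
  have K: "group K" "group G" "group H" using is_begD(3) A B C by (metis prod.collapse)+
  have f': "f \<in> ext_iso K G" "beg_push l n f K G y = x" and g': "g \<in> ext_iso G H" "beg_push l n g G H x = z"
    using f g beg_iso_iff[OF A B] beg_iso_iff[OF B C] by auto
  have "f \<in> hom K G" "g \<in> hom G H" using f' g' by (auto simp: ext_iso_def iso_def)
  then show ?thesis
    unfolding beg_iso_iff[OF A C]
    using beg_push_compose[OF A K(2,3)] f' g' ext_iso_compose[OF K(1)] by metis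
qed

lemma beg_iso_refl:
  assumes A: "is_beg l n (K, y)"
  shows "(\<lambda>x\<in>carrier K. x) \<in> beg_iso l n (K, y) (K, y)"
proof -
  have "group K" using is_begD(3) A by (metis prod.collapse)
  then have "(\<lambda>x\<in>carrier K. x) \<in> iso K K"
    by (rule group.iso_eq[OF _ iso_set_refl]) simp
  then show ?thesis
    unfolding beg_iso_iff[OF A A] using beg_push_id[OF A] by (simp add: ext_iso_def)
qed

lemma beg_iso_push:
  assumes A: "is_beg l n (K, y)" and G: "comm_group G" and f: "f \<in> ext_iso K G"
  shows "f \<in> beg_iso l n (K, y) (G, beg_push l n f K G y)"
  using f is_beg_push[OF A G] beg_iso_iff[OF A is_beg_push[OF A G]] by (simp add: ext_iso_def)

section \<open>Counting isomorphisms and orbits\<close>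

lemma compose_cancel:
  assumes "compose A g f = (\<lambda>x\<in>A. x)" "h \<in> C \<rightarrow> A" "h \<in> extensional C"
  shows "compose C g (compose C f h) = h"
proof (rule extensionalityI[OF compose_extensional assms(3)])
  fix x assume x: "x \<in> C"
  then have "h x \<in> A" using assms(2) by blast
  then have "g (f (h x)) = h x" using fun_cong[OF assms(1), of "h x"] by (simp add: compose_eq)
  then show "compose C g (compose C f h) x = h x" using x by (simp add: compose_eq)
qed

lemma compose_cancel':
  assumes "compose B f g = (\<lambda>x\<in>B. x)" "h \<in> extensional B" "g \<in> B \<rightarrow> A"
  shows "compose B (compose A h f) g = h"
proof (rule extensionalityI[OF compose_extensional assms(2)])
  fix x assume x: "x \<in> B"
  then have "f (g x) = x" using fun_cong[OF assms(1), of x] by (simp add: compose_eq)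
  then show "compose B (compose A h f) g x = h x"
    using x assms(3) by (simp add: compose_eq Pi_iff)
qed

text \<open>Composition with one fixed isomorphism is a bijection from the automorphisms, the
  isomorphisms being a torsor under them.\<close>

lemma card_beg_iso:
  assumes A: "is_beg l n (K, y)" and B: "is_beg l n (G, x)" and ne: "beg_iso l n (K, y) (G, x) \<noteq> {}"
  shows "card (beg_iso l n (K, y) (G, x)) = card (beg_aut l n (K, y))"
proof -
  obtain f where f: "f \<in> beg_iso l n (K, y) (G, x)" using ne by blast
  then obtain g where g: "g \<in> beg_iso l n (G, x) (K, y)"
    and gf: "compose (carrier K) g f = (\<lambda>x\<in>carrier K. x)"
    and fg: "compose (carrier G) f g = (\<lambda>y\<in>carrier G. y)"
    unfolding beg_iso_def by auto
  have fn: "h \<in> carrier M \<rightarrow> carrier N" "h \<in> extensional (carrier M)"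
    if "h \<in> beg_iso l n (M, u) (N, v)" for h and M :: "'x monoid" and N :: "'y monoid" and u v
  proof -
    have "h \<in> hom M N \<and> h \<in> extensional (carrier M)"
      using that by (cases u; cases v) (simp add: beg_iso_def beg_hom_def)
    then show "h \<in> carrier M \<rightarrow> carrier N" "h \<in> extensional (carrier M)"
      by (simp_all add: hom_def)
  qed
  have "bij_betw (\<lambda>h. compose (carrier K) f h) (beg_aut l n (K, y)) (beg_iso l n (K, y) (G, x))"
  proof (rule bij_betw_byWitness[where f' = "\<lambda>h. compose (carrier K) g h"])
    show "\<forall>h\<in>beg_aut l n (K, y). compose (carrier K) g (compose (carrier K) f h) = h"
      unfolding beg_aut_def by (intro ballI compose_cancel[OF gf]; rule fn; assumption)
    show "\<forall>h\<in>beg_iso l n (K, y) (G, x). compose (carrier K) f (compose (carrier K) g h) = h"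
      by (intro ballI compose_cancel[OF fg]; rule fn; assumption)
    show "(\<lambda>h. compose (carrier K) f h) ` beg_aut l n (K, y) \<subseteq> beg_iso l n (K, y) (G, x)"
      unfolding beg_aut_def by (intro image_subsetI beg_iso_compose[OF A A B _ f])
    show "(\<lambda>h. compose (carrier K) g h) ` beg_iso l n (K, y) (G, x) \<subseteq> beg_aut l n (K, y)"
      unfolding beg_aut_def by (intro image_subsetI beg_iso_compose[OF A B A _ g])
  qed
  then show ?thesis by (rule bij_betw_same_card[symmetric])
qed

lemma ext_iso_self: "ext_iso G G = auto G"
  by (auto simp: ext_iso_def iso_def auto_def Bij_def)

lemma card_ext_iso:
  assumes K: "group K" and G: "group G" and iso: "K \<cong> G"
  shows "card (ext_iso K G) = card (auto G)"
proof -
  obtain f0 where "f0 \<in> iso K G" using iso by (auto simp: is_iso_def)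
  then have "restrict f0 (carrier K) \<in> ext_iso K G"
    using group.iso_eq[OF K, of f0 G "restrict f0 (carrier K)"] by (simp add: ext_iso_def)
  then obtain f g where f: "f \<in> ext_iso K G" and g: "g \<in> ext_iso G K"
    and gf: "compose (carrier K) g f = (\<lambda>x\<in>carrier K. x)"
    and fg: "compose (carrier G) f g = (\<lambda>y\<in>carrier G. y)"
    using ext_iso_inverse[OF K G] by metis
  have fn: "f \<in> carrier K \<rightarrow> carrier G" "g \<in> carrier G \<rightarrow> carrier K"
    using f g by (auto simp: ext_iso_def iso_def hom_in_carrier)
  have "bij_betw (\<lambda>h. compose (carrier G) h g) (ext_iso K G) (ext_iso G G)"
  proof (rule bij_betw_byWitness[where f' = "\<lambda>h. compose (carrier K) h f"])
    show "\<forall>h\<in>ext_iso K G. compose (carrier K) (compose (carrier G) h g) f = h"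
      by (intro ballI compose_cancel'[OF gf _ fn(1)]) (simp add: ext_iso_def)
    show "\<forall>h\<in>ext_iso G G. compose (carrier G) (compose (carrier K) h f) g = h"
      by (intro ballI compose_cancel'[OF fg _ fn(2)]) (simp add: ext_iso_def)
    show "(\<lambda>h. compose (carrier G) h g) ` ext_iso K G \<subseteq> ext_iso G G"
      by (intro image_subsetI ext_iso_compose[OF G g])
    show "(\<lambda>h. compose (carrier K) h f) ` ext_iso G G \<subseteq> ext_iso K G"
      by (intro image_subsetI ext_iso_compose[OF K f])
  qed
  then show ?thesis unfolding ext_iso_self by (rule bij_betw_same_card)
qed

lemma finite_auto:
  assumes "finite (carrier G)"
  shows "finite (auto G)"
proof (rule finite_subset)
  show "auto G \<subseteq> PiE (carrier G) (\<lambda>_. carrier G)"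
    by (auto simp: auto_def hom_def Bij_def PiE_def)
  show "finite (PiE (carrier G) (\<lambda>_. carrier G))" using assms by (simp add: finite_PiE)
qed

lemma card_auto_pos:
  assumes "group G" "finite (carrier G)"
  shows "card (auto G) > 0"
  using group.id_in_auto[OF assms(1)] finite_auto[OF assms(2)] by (auto simp: card_gt_0_iff)

text \<open>\<open>B\<close> may live on another carrier type than \<open>G\<close>. Representatives
  of classes, which live on natural numbers, can thus be compared directly with the structures on
  the given group.\<close>

definition beg_orbit ::
    "nat \<Rightarrow> nat \<Rightarrow> 'b beg \<Rightarrow> 'a monoid \<Rightarrow> ((('a \<times> 'a) \<Rightarrow>\<^sub>0 int) set \<times> (('a \<Rightarrow> rat set) \<Rightarrow> 'a)) set" where
  "beg_orbit l n B G = {x. is_beg l n (G, x) \<and> beg_iso l n B (G, x) \<noteq> {}}"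

text \<open>Orbit-stabilizer: sorting the group isomorphisms from \<open>K\<close> to
  \<open>G\<close> by the structure that they push \<open>y\<close> to gives one fibre for each
  member of the orbit, and each fibre has as many elements as the automorphism group.\<close>

lemma card_beg_orbit:
  fixes G :: "'a monoid"
  assumes A: "is_beg l n (K, y)" and G: "comm_group G" and iso: "K \<cong> G"
  shows "finite (beg_orbit l n (K, y) G)"
    and "card (beg_orbit l n (K, y) G) * card (beg_aut l n (K, y)) = card (auto G)"
proof -
  let ?N = "beg_orbit l n (K, y) G"
  have K: "group K" "finite (carrier K)" using is_begD[of l n K "fst y" "snd y"] A by auto
  have G': "group G" using G by (rule comm_group.axioms(2))
  obtain f0 where f0: "bij_betw f0 (carrier K) (carrier G)" using iso by (auto simp: is_iso_def iso_def)
  then have finG: "finite (carrier G)" using bij_betw_finite K(2) by blast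
  have U: "ext_iso K G = (\<Union>x\<in>?N. beg_iso l n (K, y) (G, x))"
  proof (intro equalityI subsetI)
    fix f assume f: "f \<in> ext_iso K G"
    have i: "f \<in> beg_iso l n (K, y) (G, beg_push l n f K G y)" by (rule beg_iso_push[OF A G f])
    moreover have "is_beg l n (G, beg_push l n f K G y)"
      using is_beg_push[OF A G] f by (simp add: ext_iso_def)
    ultimately have "beg_push l n f K G y \<in> ?N" unfolding beg_orbit_def by auto
    then show "f \<in> (\<Union>x\<in>?N. beg_iso l n (K, y) (G, x))" using i by (rule UN_I)
  next
    fix f assume "f \<in> (\<Union>x\<in>?N. beg_iso l n (K, y) (G, x))"
    then obtain x where x: "x \<in> ?N" "f \<in> beg_iso l n (K, y) (G, x)" by (elim UN_E)
    then have "is_beg l n (G, x)" by (simp add: beg_orbit_def)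
    then show "f \<in> ext_iso K G" using x(2) beg_iso_iff[OF A] by blast
  qed
  have finE: "finite (ext_iso K G)"
  proof (rule finite_subset)
    show "ext_iso K G \<subseteq> PiE (carrier K) (\<lambda>_. carrier G)"
      by (auto simp: ext_iso_def iso_def hom_def PiE_def)
    show "finite (PiE (carrier K) (\<lambda>_. carrier G))" using K(2) finG by (simp add: finite_PiE)
  qed
  have "?N \<subseteq> (\<lambda>f. beg_push l n f K G y) ` ext_iso K G"
  proof
    fix x assume x: "x \<in> ?N"
    then obtain f where "f \<in> beg_iso l n (K, y) (G, x)" "is_beg l n (G, x)" by (auto simp: beg_orbit_def)
    then show "x \<in> (\<lambda>f. beg_push l n f K G y) ` ext_iso K G" using beg_iso_iff[OF A] by (metis imageI)
  qed
  then show fin: "finite ?N" using finE by (rule finite_surj[rotated])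
  have "card (ext_iso K G) = (\<Sum>x\<in>?N. card (beg_iso l n (K, y) (G, x)))"
    unfolding U
  proof (rule card_UN_disjoint[OF fin])
    show "\<forall>x\<in>?N. finite (beg_iso l n (K, y) (G, x))"
    proof
      fix x assume "x \<in> ?N"
      then have "beg_iso l n (K, y) (G, x) \<subseteq> ext_iso K G" unfolding U by (rule UN_upper)
      then show "finite (beg_iso l n (K, y) (G, x))" using finE by (rule finite_subset)
    qed
    show "\<forall>x\<in>?N. \<forall>x'\<in>?N. x \<noteq> x' \<longrightarrow> beg_iso l n (K, y) (G, x) \<inter> beg_iso l n (K, y) (G, x') = {}"
    proof (intro ballI impI)
      fix x x' assume "x \<in> ?N" "x' \<in> ?N" and ne: "x \<noteq> x'"
      then have b: "is_beg l n (G, x)" "is_beg l n (G, x')" by (simp_all add: beg_orbit_def)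
      have False if "f \<in> beg_iso l n (K, y) (G, x)" "f \<in> beg_iso l n (K, y) (G, x')" for f
        using that ne unfolding beg_iso_iff[OF A b(1)] beg_iso_iff[OF A b(2)] by simp
      then show "beg_iso l n (K, y) (G, x) \<inter> beg_iso l n (K, y) (G, x') = {}"
        by (meson disjoint_iff)
    qed
  qed
  also have "\<dots> = (\<Sum>x\<in>?N. card (beg_aut l n (K, y)))"
    by (rule sum.cong[OF refl]) (simp add: beg_orbit_def card_beg_iso[OF A])
  finally show "card ?N * card (beg_aut l n (K, y)) = card (auto G)"
    using card_ext_iso[OF K(1) G' iso] by simp
qed

definition psi_iso :: "nat \<Rightarrow> nat \<Rightarrow> 'a beg \<Rightarrow> bool" where
  "psi_iso l n = (\<lambda>(G, \<omega>, \<psi>). \<psi> \<in> iso (torsion (dual G) (l ^ n)) (torsion G (l ^ n)))"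

text \<open>The target \<psi> is f \<psi> f^dual, a composite of three bijections between torsion
  subgroups.\<close>

lemma psi_iso_beg_iso:
  assumes A: "is_beg l n (K, y)" and B: "is_beg l n (G, x)" and f: "f \<in> beg_iso l n (K, y) (G, x)"
    and y: "psi_iso l n (K, y)"
  shows "psi_iso l n (G, x)"
proof -
  obtain \<omega> \<psi> where yy: "y = (\<omega>, \<psi>)" by (cases y)
  obtain \<omega>' \<psi>' where xx: "x = (\<omega>', \<psi>')" by (cases x)
  note DA = is_begD[OF A[unfolded yy]] and DB = is_begD[OF B[unfolded xx]]
  let ?D = "carrier (torsion (dual G) (l ^ n))" and ?E = "carrier (torsion (dual K) (l ^ n))"
  have fe: "f \<in> ext_iso K G" and fp: "beg_push l n f K G y = x"
    using f unfolding beg_iso_iff[OF A B] by auto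
  obtain g where ge: "g \<in> ext_iso G K"
    and gf: "compose (carrier K) g f = (\<lambda>x\<in>carrier K. x)"
    and fg: "compose (carrier G) f g = (\<lambda>y\<in>carrier G. y)"
    using ext_iso_inverse[OF DA(3) DB(3) fe] by blast
  have fh: "f \<in> hom K G" and gh: "g \<in> hom G K" using fe ge by (auto simp: ext_iso_def iso_def)
  have b1: "bij_betw (dual_map K f) ?D ?E"
  proof (rule bij_betw_byWitness[where f' = "dual_map G g"])
    show "\<forall>\<beta>\<in>?D. dual_map G g (dual_map K f \<beta>) = \<beta>"
      by (simp add: dual_map_comp[OF gh fh] dual_map_id fg carrier_torsion)
    show "\<forall>\<beta>\<in>?E. dual_map K f (dual_map G g \<beta>) = \<beta>"
      by (simp add: dual_map_comp[OF fh gh] dual_map_id gf carrier_torsion)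
    show "dual_map K f ` ?D \<subseteq> ?E"
      by (intro image_subsetI dual_map_torsion[OF DA(3) fh])
    show "dual_map G g ` ?E \<subseteq> ?D"
      by (intro image_subsetI dual_map_torsion[OF DB(3) gh])
  qed
  have b2: "bij_betw \<psi> ?E (carrier (torsion K (l ^ n)))"
    using y by (simp add: psi_iso_def yy iso_def)
  have b3: "bij_betw f (carrier (torsion K (l ^ n))) (carrier (torsion G (l ^ n)))"
  proof (rule bij_betw_byWitness[where f' = g])
    have "g (f z) = z" if "z \<in> carrier K" for z
      using fun_cong[OF gf, of z] that by (simp add: compose_eq)
    then show "\<forall>a\<in>carrier (torsion K (l ^ n)). g (f a) = a" by (simp add: carrier_torsion)
    have "f (g z) = z" if "z \<in> carrier G" for z
      using fun_cong[OF fg, of z] that by (simp add: compose_eq)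
    then show "\<forall>a\<in>carrier (torsion G (l ^ n)). f (g a) = a" by (simp add: carrier_torsion)
    show "f ` carrier (torsion K (l ^ n)) \<subseteq> carrier (torsion G (l ^ n))"
      by (intro image_subsetI torsion_hom_closed[OF DA(3) DB(3) fh])
    show "g ` carrier (torsion G (l ^ n)) \<subseteq> carrier (torsion K (l ^ n))"
      by (intro image_subsetI torsion_hom_closed[OF DB(3) DA(3) gh])
  qed
  have "bij_betw (f \<circ> (\<psi> \<circ> dual_map K f)) ?D (carrier (torsion G (l ^ n)))"
    by (rule bij_betw_trans[OF bij_betw_trans[OF b1 b2] b3])
  moreover have pe: "(\<lambda>\<beta>\<in>?D. f (\<psi> (dual_map K f \<beta>))) = \<psi>'"
    using fp by (simp add: xx yy beg_push_def)
  have "\<psi>' \<beta> = (f \<circ> (\<psi> \<circ> dual_map K f)) \<beta>" if "\<beta> \<in> ?D" for \<beta>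
    using fun_cong[OF pe, of \<beta>] that by simp
  ultimately have "bij_betw \<psi>' ?D (carrier (torsion G (l ^ n)))"
    using bij_betw_cong[of ?D \<psi>' "f \<circ> (\<psi> \<circ> dual_map K f)"] by blast
  then show ?thesis using DB(8) by (simp add: psi_iso_def xx iso_def)
qed

lemma beg_weight_eq:
  "beg_weight l n (G, x) = (if psi_iso l n (G, x)
     then prodinf (\<lambda>i. 1 - inverse (real l) ^ (2 * i + 1)) /
          (real (card (beg_aut l n (G, x))) * real (card (carrier (torsion (sym_square G) (l ^ n)))))
     else 0)"
  by (cases x) (simp add: beg_weight_def psi_iso_def)

text \<open>Classes consist of BEGs on sets of natural numbers, so a structure on an arbitrary
  finite group has to be moved to such a copy before it has a class.\<close>

lemma nat_group_copy:
  fixes G :: "'a monoid"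
  assumes "comm_group G" "finite (carrier G)"
  obtains H :: "nat monoid" and f where "comm_group H" "f \<in> ext_iso G H"
proof -
  interpret comm_group G by fact
  obtain \<phi> :: "'a \<Rightarrow> nat" where \<phi>: "inj_on \<phi> (carrier G)"
    using finite_imp_inj_to_nat_seg[OF assms(2)] by blast
  let ?H = "image_group \<phi> G"
  have iso: "\<phi> \<in> iso G ?H" by (rule inj_imp_image_group_iso[OF \<phi>])
  have grp: "group ?H" by (rule inj_imp_image_group_is_group[OF \<phi>])
  have "comm_group ?H"
    by (rule iso_imp_comm_group) (use iso grp in \<open>auto simp: is_iso_def group.is_monoid\<close>)
  moreover have "restrict \<phi> (carrier G) \<in> ext_iso G ?H"
    using iso_eq[OF iso, of "restrict \<phi> (carrier G)"] by (simp add: ext_iso_def)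
  ultimately show thesis by (rule that)
qed

lemma equiv_begs:
  "equiv (begs l n) {(A, B). A \<in> begs l n \<and> B \<in> begs l n \<and> beg_iso l n A B \<noteq> {}}"
proof (rule equivI)
  show "refl_on (begs l n) {(A, B). A \<in> begs l n \<and> B \<in> begs l n \<and> beg_iso l n A B \<noteq> {}}"
  proof (rule refl_onI)
    fix A assume A: "A \<in> begs l n"
    then have "beg_iso l n A A \<noteq> {}"
      using beg_iso_refl[of l n "fst A" "snd A"] by (auto simp: begs_def)
    then show "(A, A) \<in> {(A, B). A \<in> begs l n \<and> B \<in> begs l n \<and> beg_iso l n A B \<noteq> {}}"
      using A by simp
  qed
  show "sym {(A, B). A \<in> begs l n \<and> B \<in> begs l n \<and> beg_iso l n A B \<noteq> {}}"
    by (rule symI) (simp add: beg_iso_sym)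
  show "trans {(A, B). A \<in> begs l n \<and> B \<in> begs l n \<and> beg_iso l n A B \<noteq> {}}"
  proof (rule transI, clarsimp)
    fix K y G x H z
    assume A: "(K, y) \<in> begs l n" "(G, x) \<in> begs l n" "(H, z) \<in> begs l n"
      and "beg_iso l n (K, y) (G, x) \<noteq> {}" "beg_iso l n (G, x) (H, z) \<noteq> {}" "beg_iso l n (K, y) (H, z) = {}"
    then show False using beg_iso_compose[of l n K y G x H z] by (auto simp: begs_def)
  qed
qed blast

lemma beg_iso_imp_is_iso:
  assumes "is_beg l n (K, y)" "is_beg l n (G, x)" "beg_iso l n (K, y) (G, x) \<noteq> {}"
  shows "K \<cong> G"
  using assms beg_iso_iff[OF assms(1,2)] by (auto simp: is_iso_def ext_iso_def)

text \<open>
  A class with underlying group \<open>G\<close> corresponds to an orbit of \<open>Aut(G)\<close> on the BEG structures on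
  \<open>G\<close> itself, and the mass of the class is proportional to the size of the orbit.
\<close>

lemma measure_beg_measure:
  fixes G :: "'a monoid"
  assumes l: "l > 1" and G: "comm_group G" "finite (carrier G)"
    and sym: "\<And>H :: nat monoid. finite_abelian_primary l H \<Longrightarrow> H \<cong> G \<Longrightarrow>
      card (carrier (torsion (sym_square H) (l ^ n))) = s"
    and fin: "finite {x. is_beg l n (G, x)}"
  shows "measure (beg_measure l n) {C \<in> beg_classes l n. \<exists>(H, \<omega>, \<psi>) \<in> C. H \<cong> G} =
    prodinf (\<lambda>i. 1 - inverse (real l) ^ (2 * i + 1))
      * real (card {x. is_beg l n (G, x) \<and> psi_iso l n (G, x)}) / (real (card (auto G)) * real s)"
proof -
  interpret G: comm_group G by fact
  define R where "R = {(A, B). A \<in> begs l n \<and> B \<in> begs l n \<and> beg_iso l n A B \<noteq> {}}"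
  have eqv: "equiv (begs l n) R" unfolding R_def by (rule equiv_begs)
  have classes: "beg_classes l n = begs l n // R" by (simp add: beg_classes_def R_def)
  define P where "P = prodinf (\<lambda>i. 1 - inverse (real l) ^ (2 * i + 1))"
  define X where "X = {x. is_beg l n (G, x)}"
  define Y where "Y = {x. is_beg l n (G, x) \<and> psi_iso l n (G, x)}"
  define CC where "CC = {C \<in> beg_classes l n. \<exists>(H, \<omega>, \<psi>) \<in> C. H \<cong> G}"
  define b where "b C = (SOME B. B \<in> C)" for C :: "nat beg set"
  define N where "N C = beg_orbit l n (b C) G" for C
  \<comment> \<open>\<open>ennreal\<close> truncates negative reals, so nonnegative weights are
    needed for the measure to be their real sum.\<close>
  have P0: "P \<ge> 0"
  proof -
    have "convergent_prod (\<lambda>i. 1 - inverse (real l) ^ (2 * i + 1))"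
    proof (intro abs_convergent_prod_imp_convergent_prod)
      have su: "summable (\<lambda>i. (inverse (real l) ^ 2) ^ i * inverse (real l))"
        using l by (intro summable_mult2 summable_geometric) (simp add: power_less_one_iff field_simps)
      have eq: "norm (1 - inverse (real l) ^ (2 * i + 1) - 1)
          = (inverse (real l) ^ 2) ^ i * inverse (real l)" for i
        by (simp add: power_mult)
      show "abs_convergent_prod (\<lambda>i. 1 - inverse (real l) ^ (2 * i + 1))"
        unfolding abs_convergent_prod_conv_summable eq by (rule su)
    qed
    then have "(\<lambda>k. \<Prod>i\<le>k. 1 - inverse (real l) ^ (2 * i + 1)) \<longlonglongrightarrow> P"
      unfolding P_def by (rule convergent_prod_LIMSEQ)
    moreover have "inverse (real l) ^ (2 * i + 1) \<le> 1" for i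
      using l by (intro power_le_one) (simp_all add: field_simps)
    then have "0 \<le> (\<Prod>i\<le>k. 1 - inverse (real l) ^ (2 * i + 1))" for k
      by (intro prod_nonneg) (simp add: field_simps)
    ultimately show ?thesis by (intro LIMSEQ_le_const) auto
  qed
  have bC: "b C \<in> C" "is_beg l n (b C)" "fst (b C) \<cong> G" if C: "C \<in> CC" for C
  proof -
    have CR: "C \<in> begs l n // R" using C by (simp add: CC_def classes)
    obtain H \<omega> \<psi> where H: "(H, \<omega>, \<psi>) \<in> C" "H \<cong> G" using C by (auto simp: CC_def)
    show "b C \<in> C" unfolding b_def using H(1) by (rule someI)
    then have r: "(b C, (H, \<omega>, \<psi>)) \<in> R" using quotient_eq_iff[OF eqv CR CR _ H(1)] by simp
    then show bb: "is_beg l n (b C)" by (simp add: R_def begs_def)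
    have "is_beg l n (H, \<omega>, \<psi>)" "beg_iso l n (b C) (H, \<omega>, \<psi>) \<noteq> {}" using r by (simp_all add: R_def begs_def)
    then have "fst (b C) \<cong> H" using beg_iso_imp_is_iso[of l n "fst (b C)" "snd (b C)"] bb by simp
    then show "fst (b C) \<cong> G" using H(2) by (rule iso_trans)
  qed
  have NX: "N C \<subseteq> X" for C by (auto simp: N_def X_def beg_orbit_def)
  have aut0: "card (auto G) > 0" by (rule card_auto_pos[OF G.is_group G(2)])
  have orbit: "card (N C) * card (beg_aut l n (b C)) = card (auto G)" if "C \<in> CC" for C
    using card_beg_orbit(2)[of l n "fst (b C)" "snd (b C)" G] bC[OF that] G(1) by (simp add: N_def)
  \<comment> \<open>By orbit-stabilizer 1 / |Aut(B)| equals |orbit| / |Aut(G)|. Bijectivity of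
    \<psi> is constant on an orbit, so intersecting with \<open>Y\<close> gives the whole orbit or
    nothing, matching the case distinction in the weight.\<close>
  have weight: "beg_weight l n (b C) = P / (real (card (auto G)) * real s) * real (card (N C \<inter> Y))"
    if C: "C \<in> CC" for C
  proof -
    obtain K y where Ky: "b C = (K, y)" by (cases "b C")
    have K: "is_beg l n (K, y)" "K \<cong> G" using bC[OF C] Ky by auto
    have s: "card (carrier (torsion (sym_square K) (l ^ n))) = s"
      using sym K is_begD(1) by (metis prod.collapse)
    have pos: "card (N C) \<noteq> 0" "card (beg_aut l n (K, y)) \<noteq> 0"
      using orbit[OF C] aut0 Ky by (metis mult_0 less_irrefl, metis mult_0_right less_irrefl)
    have same: "psi_iso l n (G, x) \<longleftrightarrow> psi_iso l n (K, y)" if x: "x \<in> N C" for x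
    proof -
      have x': "is_beg l n (G, x)" "beg_iso l n (K, y) (G, x) \<noteq> {}"
        using x by (auto simp: N_def beg_orbit_def Ky)
      obtain f where f: "f \<in> beg_iso l n (K, y) (G, x)" using x'(2) by blast
      obtain g where g: "g \<in> beg_iso l n (G, x) (K, y)" using beg_iso_sym[OF x'(2)] by blast
      show ?thesis
        using psi_iso_beg_iso[OF K(1) x'(1) f] psi_iso_beg_iso[OF x'(1) K(1) g] by blast
    qed
    show ?thesis
    proof (cases "psi_iso l n (K, y)")
      case True
      then have "N C \<inter> Y = N C" using same by (auto simp: Y_def N_def beg_orbit_def)
      moreover have "real (card (auto G)) = real (card (N C)) * real (card (beg_aut l n (K, y)))"
        using orbit[OF C] Ky by (metis of_nat_mult)
      moreover have "beg_weight l n (b C) = P / (real (card (beg_aut l n (K, y))) * real s)"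
        using True by (simp add: Ky beg_weight_eq s P_def)
      ultimately show ?thesis using pos by (simp add: field_simps)
    next
      case False
      then have "N C \<inter> Y = {}" using same by (auto simp: Y_def)
      then show ?thesis using False by (simp add: Ky beg_weight_eq)
    qed
  qed
  have disj: "C = C'" if C: "C \<in> CC" "C' \<in> CC" and x: "x \<in> N C" "x \<in> N C'" for C C' x
  proof -
    have xx: "is_beg l n (G, x)" "beg_iso l n (b C) (G, x) \<noteq> {}" "beg_iso l n (b C') (G, x) \<noteq> {}"
      using x by (auto simp: N_def beg_orbit_def)
    then obtain f g where "f \<in> beg_iso l n (b C) (G, x)" "g \<in> beg_iso l n (G, x) (b C')"
      using beg_iso_sym[OF xx(3)] by blast
    then have "beg_iso l n (b C) (b C') \<noteq> {}"
      using beg_iso_compose[of l n "fst (b C)" "snd (b C)" G x "fst (b C')" "snd (b C')" f g]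
        bC(2)[OF C(1)] bC(2)[OF C(2)] xx(1) by auto
    then have "(b C, b C') \<in> R" using bC(2)[OF C(1)] bC(2)[OF C(2)] by (simp add: R_def begs_def)
    then show ?thesis
      using quotient_eqI[OF eqv _ _ bC(1)[OF C(1)] bC(1)[OF C(2)]] C by (simp add: CC_def classes)
  qed
  \<comment> \<open>The class is that of a copy on natural numbers; its chosen representative need
    not be this copy, so two isomorphisms are composed.\<close>
  have cover: "\<exists>C\<in>CC. x \<in> N C" if x: "x \<in> X" for x
  proof -
    have xb: "is_beg l n (G, x)" using x by (simp add: X_def)
    obtain H :: "nat monoid" and f where H: "comm_group H" "f \<in> ext_iso G H"
      using nat_group_copy[OF G] by blast
    define A where "A = (H, beg_push l n f G H x)"
    have A: "is_beg l n A" unfolding A_def using is_beg_push[OF xb H(1)] H(2) by (simp add: ext_iso_def)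
    have fA: "beg_iso l n A (G, x) \<noteq> {}"
      using beg_iso_push[OF xb H] beg_iso_sym unfolding A_def by blast
    define C where "C = R `` {A}"
    have AC: "A \<in> C" unfolding C_def using A equiv_class_self[OF eqv] by (simp add: begs_def)
    have "G \<cong> H" using H(2) by (auto simp: ext_iso_def is_iso_def)
    then have HG: "H \<cong> G" by (rule G.iso_sym)
    have CR: "C \<in> begs l n // R" unfolding C_def using A by (intro quotientI) (simp add: begs_def)
    have C: "C \<in> CC"
      unfolding CC_def classes using CR AC HG by (auto simp: A_def)
    have "(b C, A) \<in> R" using quotient_eq_iff[OF eqv CR CR bC(1)[OF C] AC] by simp
    then obtain h where "h \<in> beg_iso l n (b C) A" by (auto simp: R_def)
    moreover obtain k where "k \<in> beg_iso l n A (G, x)" using fA by blast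
    ultimately have "beg_iso l n (b C) (G, x) \<noteq> {}"
      using beg_iso_compose[of l n "fst (b C)" "snd (b C)" "fst A" "snd A" G x h k]
        bC(2)[OF C] A xb by auto
    then have "x \<in> N C" using xb by (simp add: N_def beg_orbit_def)
    then show ?thesis using C by blast
  qed
  have finX: "finite X" using fin by (simp add: X_def)
  have ne: "N C \<noteq> {}" if "C \<in> CC" for C
    using orbit[OF that] aut0 by auto
  \<comment> \<open>There are only finitely many classes on this group, as they have distinct orbits
    inside the finite set \<open>X\<close>; the measure is therefore a finite sum.\<close>
  have "inj_on N CC"
  proof (rule inj_onI)
    fix C C' assume C: "C \<in> CC" "C' \<in> CC" "N C = N C'"
    obtain x where "x \<in> N C" using ne[OF C(1)] by blast
    then show "C = C'" using disj[OF C(1,2)] C(3) by blast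
  qed
  moreover have "N ` CC \<subseteq> Pow X" using NX by blast
  ultimately have finCC: "finite CC" using finX by (meson finite_Pow_iff inj_on_finite)
  have cardY: "card Y = (\<Sum>C\<in>CC. card (N C \<inter> Y))"
  proof -
    have "Y = (\<Union>C\<in>CC. N C \<inter> Y)" using cover by (auto simp: X_def Y_def)
    then have "card Y = card (\<Union>C\<in>CC. N C \<inter> Y)" by simp
    also have "\<dots> = (\<Sum>C\<in>CC. card (N C \<inter> Y))"
    proof (rule card_UN_disjoint[OF finCC])
      show "\<forall>C\<in>CC. finite (N C \<inter> Y)"
        using finite_subset[OF NX finX] by simp
      show "\<forall>C\<in>CC. \<forall>C'\<in>CC. C \<noteq> C' \<longrightarrow> N C \<inter> Y \<inter> (N C' \<inter> Y) = {}"
      proof (intro ballI impI)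
        fix C C' assume "C \<in> CC" "C' \<in> CC" "C \<noteq> C'"
        then have "x \<notin> N C \<or> x \<notin> N C'" for x using disj[of C C' x] by metis
        then show "N C \<inter> Y \<inter> (N C' \<inter> Y) = {}" by blast
      qed
    qed
    finally show ?thesis .
  qed
  have w0: "beg_weight l n (b C) \<ge> 0" if "C \<in> CC" for C
    unfolding weight[OF that] using P0 by simp
  have "emeasure (beg_measure l n) CC = (\<Sum>C\<in>CC. ennreal (beg_weight l n (b C)))"
    unfolding beg_measure_def b_def
    by (rule emeasure_point_measure_finite2[OF _ finCC]) (auto simp: CC_def)
  also have "\<dots> = ennreal (\<Sum>C\<in>CC. beg_weight l n (b C))"
    using w0 by (intro sum_ennreal) auto
  finally have "measure (beg_measure l n) CC = (\<Sum>C\<in>CC. beg_weight l n (b C))"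
    using w0 by (simp add: Sigma_Algebra.measure_def sum_nonneg)
  also have "\<dots> = (\<Sum>C\<in>CC. P / (real (card (auto G)) * real s) * real (card (N C \<inter> Y)))"
    by (intro sum.cong weight) auto
  also have "\<dots> = P / (real (card (auto G)) * real s) * real (card Y)"
    unfolding cardY by (simp add: sum_distrib_left)
  finally show ?thesis by (simp add: CC_def P_def Y_def)
qed

subsection \<open>Coordinates on the dual and on the tensor square\<close>

definition delta :: "'i \<Rightarrow> 'i \<Rightarrow> int" where
  "delta i = (\<lambda>j. if j = i then 1 else 0)"

lemma sum_delta:
  fixes c :: "'i \<Rightarrow> 'r::comm_ring_1"
  shows "finite I \<Longrightarrow> i \<in> I \<Longrightarrow> (\<Sum>j\<in>I. c j * of_int (delta i j)) = c i"
  unfolding delta_def by (simp add: if_distrib sum.If_cases cong: if_cong)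

lemma rat_class_div_cong:
  assumes "g > 0" "[a = b] (mod int g)"
  shows "rat_class (of_int a / of_nat g) = rat_class (of_int b / of_nat g)"
proof -
  have "of_int a / of_nat g - of_int b / of_nat g = (of_int (a - b) / of_nat g :: rat)"
    by (simp add: diff_divide_distrib)
  then show ?thesis
    using of_int_div_in_Ints_iff[OF assms(1), of "a - b"] assms(2)
    by (simp add: rat_class_eq cong_iff_dvd_diff)
qed

locale presented_group = comm_group G for G :: "('a, 'b) monoid_scheme" (structure) +
  fixes I :: "nat set" and N :: "nat \<Rightarrow> nat" and \<Phi> :: "(nat \<Rightarrow> int) \<Rightarrow> 'a"
  assumes pres: "presents G I N \<Phi>" and finI: "finite I" and Npos: "i \<in> I \<Longrightarrow> N i > 0"
begin

definition co :: "'a \<Rightarrow> nat \<Rightarrow> int" where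
  "co x = (SOME c. x = \<Phi> c)"

lemma Phi_closed [simp]: "\<Phi> c \<in> carrier G"
  by (rule presentsD(1)[OF pres])

lemma Phi_co: "x \<in> carrier G \<Longrightarrow> \<Phi> (co x) = x"
  unfolding co_def using someI_ex[OF presentsD(3)[OF pres]] by metis

lemma Phi_eq: "\<Phi> c = \<Phi> d \<longleftrightarrow> (\<forall>i\<in>I. [c i = d i] (mod int (N i)))"
  by (rule presents_eq[OF pres comm_group_axioms])

lemma co_cong: "i \<in> I \<Longrightarrow> [co (\<Phi> c) i = c i] (mod int (N i))"
  using Phi_co[of "\<Phi> c"] unfolding Phi_eq by simp

lemma co_mult:
  assumes "x \<in> carrier G" "y \<in> carrier G" "i \<in> I"
  shows "[co (x \<otimes> y) i = co x i + co y i] (mod int (N i))"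
proof -
  have "x \<otimes> y = \<Phi> (\<lambda>i. co x i + co y i)"
    using presentsD(2)[OF pres, of "co x" "co y"] assms by (simp add: Phi_co)
  then show ?thesis using co_cong[OF assms(3), of "\<lambda>i. co x i + co y i"] by simp
qed

lemma Phi_lin: "\<Phi> c = lin G I (\<lambda>i. \<Phi> (delta i)) c"
proof -
  have "\<Phi> c = \<Phi> (\<lambda>i. \<Sum>j\<in>I. c j * delta j i)"
    unfolding Phi_eq
  proof
    fix i assume i: "i \<in> I"
    have "(\<Sum>j\<in>I. c j * delta j i) = (\<Sum>j\<in>I. c j * of_int (delta i j))"
      by (rule sum.cong) (auto simp: delta_def)
    then show "[c i = (\<Sum>j\<in>I. c j * delta j i)] (mod int (N i))"
      using sum_delta[OF finI i, of c] by simp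
  qed
  also have "\<dots> = lin G I (\<lambda>i. \<Phi> (delta i)) c"
    by (rule presents_sum[OF pres comm_group_axioms finI])
  finally show ?thesis .
qed

lemma Phi_delta_nat_pow:
  assumes "i \<in> I"
  shows "\<Phi> (delta i) [^] N i = \<one>"
proof -
  have "\<Phi> (\<lambda>j. int (N i) * delta i j) = \<one>"
    unfolding presentsD(4)[OF pres] by (auto simp: delta_def)
  then show ?thesis unfolding presents_nat_pow[OF pres comm_group_axioms] .
qed

definition chi :: "(nat \<Rightarrow> int) \<Rightarrow> 'a \<Rightarrow> rat set" where
  "chi A = (\<lambda>x\<in>carrier G. rat_class (\<Sum>i\<in>I. of_int (A i) * (of_int (co x i) / of_nat (N i))))"

lemma chi_cong:
  assumes "\<And>i. i \<in> I \<Longrightarrow> [c i = d i] (mod int (N i))"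
  shows "rat_class (\<Sum>i\<in>I. of_int (A i) * (of_int (c i) / of_nat (N i)))
    = rat_class (\<Sum>i\<in>I. of_int (A i) * (of_int (d i) / of_nat (N i)))"
proof -
  have "(of_int (c i) / of_nat (N i) - of_int (d i) / of_nat (N i) :: rat) \<in> \<int>" if "i \<in> I" for i
    using rat_class_div_cong[OF Npos[OF that] assms[OF that]] by (simp add: rat_class_eq)
  then have "(\<Sum>i\<in>I. of_int (A i) * (of_int (c i) / of_nat (N i) - of_int (d i) / of_nat (N i) :: rat)) \<in> \<int>"
    by (intro Ints_sum Ints_mult Ints_of_int) auto
  then show ?thesis by (simp add: rat_class_eq right_diff_distrib sum_subtractf)
qed

lemma chi_Phi: "chi A (\<Phi> c) = rat_class (\<Sum>i\<in>I. of_int (A i) * (of_int (c i) / of_nat (N i)))"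
  unfolding chi_def using chi_cong[of "co (\<Phi> c)" c A, OF co_cong] by simp

lemma chi_Phi_delta:
  assumes "i \<in> I"
  shows "chi A (\<Phi> (delta i)) = rat_class (of_int (A i) / of_nat (N i))"
proof -
  have "(\<Sum>j\<in>I. of_int (A j) * (of_int (delta i j) / of_nat (N j)))
      = (\<Sum>j\<in>I. of_int (A j) / of_nat (N j) * (of_int (delta i j) :: rat))"
    by (rule sum.cong) simp_all
  then show ?thesis unfolding chi_Phi using sum_delta[OF finI assms] by metis
qed

lemma chi_in_dual: "chi A \<in> carrier (dual G)"
proof -
  have "chi A (x \<otimes> y) = chi A x \<otimes>\<^bsub>Q_mod_Z\<^esub> chi A y" if "x \<in> carrier G" "y \<in> carrier G" for x y
  proof -
    have "chi A (\<Phi> (\<lambda>i. co x i + co y i)) = chi A (\<Phi> (co x)) \<otimes>\<^bsub>Q_mod_Z\<^esub> chi A (\<Phi> (co y))"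
      unfolding chi_Phi rat_class_add
      by (simp add: add_divide_distrib distrib_left sum.distrib)
    then show ?thesis using that by (simp add: presentsD(2)[OF pres] Phi_co)
  qed
  moreover have "chi A x \<in> carrier Q_mod_Z" if "x \<in> carrier G" for x
    using that by (simp add: chi_def)
  ultimately have "chi A \<in> hom G Q_mod_Z" by (intro homI) auto
  then show ?thesis by (simp add: carrier_dual chi_def)
qed

text \<open>The value of a character on the i-th basis element is killed by \<open>N i\<close>,
  hence of the form A i / N i modulo integers, and these values determine the character. So the dual
  has the same invariants as the group.\<close>

lemma presents_dual: "presents (dual G) I N chi"
  unfolding presents_def
proof (intro conjI allI ballI)
  fix A B
  show "chi A \<in> carrier (dual G)" by (rule chi_in_dual)
  show "chi (\<lambda>i. A i + B i) = chi A \<otimes>\<^bsub>dual G\<^esub> chi B"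
    unfolding chi_def dual_mult
    by (rule restrict_ext) (simp add: rat_class_add distrib_right add_divide_distrib sum.distrib)
  show "chi A = \<one>\<^bsub>dual G\<^esub> \<longleftrightarrow> (\<forall>i\<in>I. int (N i) dvd A i)"
  proof
    assume L: "chi A = \<one>\<^bsub>dual G\<^esub>"
    show "\<forall>i\<in>I. int (N i) dvd A i"
    proof
      fix i assume i: "i \<in> I"
      have "rat_class (of_int (A i) / of_nat (N i)) = \<one>\<^bsub>Q_mod_Z\<^esub>"
        using fun_cong[OF L, of "\<Phi> (delta i)"] by (simp add: chi_Phi_delta[OF i] dual_one)
      then show "int (N i) dvd A i"
        using of_int_div_in_Ints_iff[OF Npos[OF i]] by (simp add: rat_class_eq_one)
    qed
  next
    assume R: "\<forall>i\<in>I. int (N i) dvd A i"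
    show "chi A = \<one>\<^bsub>dual G\<^esub>"
      unfolding chi_def dual_one
    proof (rule restrict_ext)
      fix x
      have "(of_int (A i) * (of_int (co x i) / of_nat (N i)) :: rat) \<in> \<int>" if "i \<in> I" for i
      proof -
        have "(of_int (A i) / of_nat (N i) :: rat) \<in> \<int>"
          using R that of_int_div_in_Ints_iff[OF Npos[OF that]] by blast
        then have "(of_int (co x i) * (of_int (A i) / of_nat (N i)) :: rat) \<in> \<int>"
          by (intro Ints_mult Ints_of_int)
        then show ?thesis by (simp add: mult.commute)
      qed
      then show "rat_class (\<Sum>i\<in>I. of_int (A i) * (of_int (co x i) / of_nat (N i))) = \<one>\<^bsub>Q_mod_Z\<^esub>"
        unfolding rat_class_eq_one by (rule Ints_sum)
    qed
  qed
next
  fix \<alpha> assume a: "\<alpha> \<in> carrier (dual G)"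
  have ah: "\<alpha> \<in> hom G Q_mod_Z" using a by (simp add: carrier_dual)
  interpret a: group_hom G Q_mod_Z \<alpha>
    by (intro group_hom.intro group_hom_axioms.intro is_group QZ.is_group ah)
  have "\<exists>z. \<alpha> (\<Phi> (delta i)) = rat_class (of_int z / of_nat (N i))" if i: "i \<in> I" for i
  proof -
    obtain r where r: "\<alpha> (\<Phi> (delta i)) = rat_class r"
      using dual_closed[OF a Phi_closed] by (auto simp: carrier_Q_mod_Z)
    have "\<alpha> (\<Phi> (delta i)) [^]\<^bsub>Q_mod_Z\<^esub> N i = \<one>\<^bsub>Q_mod_Z\<^esub>"
      unfolding a.hom_nat_pow[OF Phi_closed, symmetric] Phi_delta_nat_pow[OF i] by (rule a.hom_one)
    then have "of_nat (N i) * r \<in> \<int>" unfolding r rat_class_nat_pow rat_class_eq_one .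
    then obtain z where "of_nat (N i) * r = of_int z" by (auto simp: Ints_def)
    then have "r = of_int z / of_nat (N i)" using Npos[OF i] by (simp add: field_simps)
    then show ?thesis using r by blast
  qed
  then obtain A where A: "\<And>i. i \<in> I \<Longrightarrow> \<alpha> (\<Phi> (delta i)) = rat_class (of_int (A i) / of_nat (N i))"
    by metis
  have "\<alpha> = chi A"
  proof (rule dual_eqI[OF a chi_in_dual])
    fix x assume "x \<in> carrier G"
    then obtain c where x: "x = \<Phi> c" using presentsD(3)[OF pres] by blast
    have "\<alpha> x = lin Q_mod_Z I (\<lambda>i. \<alpha> (\<Phi> (delta i))) c"
      unfolding x Phi_lin[of c] by (rule lin_hom[OF comm_group_Q_mod_Z ah finI]) simp
    also have "\<dots> = lin Q_mod_Z I (\<lambda>i. rat_class (of_int (A i) / of_nat (N i))) c"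
      using A by (intro QZ.lin_cong) (auto simp: a.hom_closed)
    also have "\<dots> = chi A x"
      unfolding lin_Q_mod_Z[OF finI] x chi_Phi
      by (intro arg_cong[of _ _ rat_class] sum.cong) (simp_all add: mult.commute)
    finally show "\<alpha> x = chi A x" .
  qed
  then show "\<exists>A. \<alpha> = chi A" by blast
qed

section \<open>Coordinates on the tensor, wedge and symmetric squares\<close>

abbreviation T where "T \<equiv> tensor_square G"

lemma comm_group_T: "comm_group T"
  by (rule comm_group_tensor_square[OF is_group])

text \<open>The tensor product of cyclic groups of orders \<open>N i\<close> and \<open>N j\<close>
  is cyclic of this order.\<close>

definition gm :: "nat \<times> nat \<Rightarrow> nat" where
  "gm = (\<lambda>(i, j). gcd (N i) (N j))"

definition ts :: "(nat \<times> nat \<Rightarrow> int) \<Rightarrow> (('a \<times> 'a) \<Rightarrow>\<^sub>0 int) set" where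
  "ts = lin T (I \<times> I) (\<lambda>(i, j). tensor G (\<Phi> (delta i)) (\<Phi> (delta j)))"

lemma gm_pos: "p \<in> I \<times> I \<Longrightarrow> gm p > 0"
  using Npos by (auto simp: gm_def)

lemma tensor_basis_closed:
  "(\<lambda>(i, j). tensor G (\<Phi> (delta i)) (\<Phi> (delta j))) \<in> I \<times> I \<rightarrow> carrier T"
  by (auto intro: tensor_closed)

lemma hom_ts:
  assumes h: "h \<in> hom T Q_mod_Z"
    and r: "\<And>i j. i \<in> I \<Longrightarrow> j \<in> I \<Longrightarrow> h (tensor G (\<Phi> (delta i)) (\<Phi> (delta j))) = rat_class (r (i, j))"
  shows "h (ts M) = rat_class (\<Sum>p\<in>I \<times> I. of_int (M p) * r p)"
proof -
  have fI: "finite (I \<times> I)" using finI by simp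
  have "h (ts M) = lin Q_mod_Z (I \<times> I) (\<lambda>p. h (case p of (i, j) \<Rightarrow> tensor G (\<Phi> (delta i)) (\<Phi> (delta j)))) M"
    unfolding ts_def
    by (rule comm_group.lin_hom[OF comm_group_T comm_group_Q_mod_Z h fI tensor_basis_closed])
  also have "\<dots> = lin Q_mod_Z (I \<times> I) (\<lambda>p. rat_class (r p)) M"
    using r hom_in_carrier[OF h] by (intro QZ.lin_cong) (auto intro: tensor_closed)
  finally show ?thesis unfolding lin_Q_mod_Z[OF fI] .
qed

text \<open>The functional reading off the \<open>(i, j)\<close> coordinate of a tensor. It bounds
  the orders of the basis tensors from below and shows that they are independent.\<close>

lemma coordinate_hom:
  assumes ij: "i \<in> I" "j \<in> I"
  obtains h where "h \<in> hom T Q_mod_Z"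
    "\<And>c d. h (tensor G (\<Phi> c) (\<Phi> d)) = rat_class (of_int (c i * d j) / of_nat (gm (i, j)))"
proof -
  let ?g = "gm (i, j)"
  let ?b = "\<lambda>x y. rat_class (of_int (co x i * co y j) / of_nat ?g)"
  have g: "?g > 0" "int ?g dvd int (N i)" "int ?g dvd int (N j)"
    using gm_pos[of "(i, j)"] ij by (auto simp: gm_def)
  have ci: "[u = v] (mod int ?g)" if "[u = v] (mod int (N i))" for u v
    using that g(2) by (rule cong_dvd_modulus)
  have cj: "[u = v] (mod int ?g)" if "[u = v] (mod int (N j))" for u v
    using that g(3) by (rule cong_dvd_modulus)
  obtain h where h: "h \<in> hom T Q_mod_Z"
    and hb: "\<And>x y. x \<in> carrier G \<Longrightarrow> y \<in> carrier G \<Longrightarrow> h (tensor G x y) = ?b x y"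
  proof (rule tensor_universal[OF is_group comm_group_Q_mod_Z, of ?b])
    fix x x' y assume "x \<in> carrier G" "x' \<in> carrier G" "y \<in> carrier G"
    then have "[co (x \<otimes> x') i * co y j = (co x i + co x' i) * co y j] (mod int ?g)"
      using ij by (intro cong_mult ci co_mult cong_refl)
    then have "?b (x \<otimes> x') y = rat_class (of_int ((co x i + co x' i) * co y j) / of_nat ?g)"
      by (rule rat_class_div_cong[OF g(1)])
    then show "?b (x \<otimes> x') y = ?b x y \<otimes>\<^bsub>Q_mod_Z\<^esub> ?b x' y"
      by (simp add: rat_class_add distrib_right add_divide_distrib)
  next
    fix x y y' assume "x \<in> carrier G" "y \<in> carrier G" "y' \<in> carrier G"
    then have "[co x i * co (y \<otimes> y') j = co x i * (co y j + co y' j)] (mod int ?g)"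
      using ij by (intro cong_mult cj co_mult cong_refl)
    then have "?b x (y \<otimes> y') = rat_class (of_int (co x i * (co y j + co y' j)) / of_nat ?g)"
      by (rule rat_class_div_cong[OF g(1)])
    then show "?b x (y \<otimes> y') = ?b x y \<otimes>\<^bsub>Q_mod_Z\<^esub> ?b x y'"
      by (simp add: rat_class_add distrib_left add_divide_distrib)
  qed (simp_all only: rat_class_in_carrier)
  have "h (tensor G (\<Phi> c) (\<Phi> d)) = rat_class (of_int (c i * d j) / of_nat ?g)" for c d
    unfolding hb[OF Phi_closed Phi_closed]
    using ij by (intro rat_class_div_cong[OF g(1)] cong_mult ci cj co_cong)
  then show thesis using that h by blast
qed

lemma coordinate_hom_ts:
  assumes ij: "i \<in> I" "j \<in> I"
  obtains h where "h \<in> hom T Q_mod_Z"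
    "\<And>c d. h (tensor G (\<Phi> c) (\<Phi> d)) = rat_class (of_int (c i * d j) / of_nat (gm (i, j)))"
    "\<And>M. h (ts M) = rat_class (of_int (M (i, j)) / of_nat (gm (i, j)))"
proof -
  obtain h where h: "h \<in> hom T Q_mod_Z"
    and hc: "\<And>c d. h (tensor G (\<Phi> c) (\<Phi> d)) = rat_class (of_int (c i * d j) / of_nat (gm (i, j)))"
    using coordinate_hom[OF ij] by metis
  have "h (ts M) = rat_class (of_int (M (i, j)) / of_nat (gm (i, j)))" for M
  proof -
    let ?r = "\<lambda>p. of_int (delta (i, j) p) / of_nat (gm (i, j)) :: rat"
    have "h (ts M) = rat_class (\<Sum>p\<in>I \<times> I. of_int (M p) * ?r p)"
      by (rule hom_ts[OF h]) (auto simp: hc delta_def)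
    also have "(\<Sum>p\<in>I \<times> I. of_int (M p) * ?r p)
        = (\<Sum>p\<in>I \<times> I. of_int (M p) * of_int (delta (i, j) p)) / of_nat (gm (i, j))"
      by (simp add: sum_divide_distrib)
    also have "(\<Sum>p\<in>I \<times> I. of_int (M p) * of_int (delta (i, j) p)) = (of_int (M (i, j)) :: rat)"
      using finI ij by (intro sum_delta) auto
    finally show ?thesis .
  qed
  then show thesis using that h hc by blast
qed

text \<open>The upper bound on the order of a basis tensor: \<open>N i\<close> and
  \<open>N j\<close> both kill it, hence by Bezout so does their gcd.\<close>

lemma tensor_basis_nat_pow:
  assumes ij: "i \<in> I" "j \<in> I" and z: "int (gm (i, j)) dvd z"
  shows "tensor G (\<Phi> (delta i)) (\<Phi> (delta j)) [^]\<^bsub>T\<^esub> z = \<one>\<^bsub>T\<^esub>"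
proof -
  interpret T: comm_group T by (rule comm_group_T)
  let ?t = "tensor G (\<Phi> (delta i)) (\<Phi> (delta j))"
  have t: "?t \<in> carrier T" by (simp add: tensor_closed)
  interpret l: group_hom G T "\<lambda>x. tensor G x (\<Phi> (delta j))"
    by (intro group_hom.intro group_hom_axioms.intro is_group T.is_group tensor_hom_left Phi_closed)
  interpret r: group_hom G T "tensor G (\<Phi> (delta i))"
    by (intro group_hom.intro group_hom_axioms.intro is_group T.is_group tensor_hom_right Phi_closed)
  have 1: "?t [^]\<^bsub>T\<^esub> int (N i) = \<one>\<^bsub>T\<^esub>"
    unfolding int_pow_int l.hom_nat_pow[OF Phi_closed, symmetric] Phi_delta_nat_pow[OF ij(1)]
    by (rule l.hom_one)
  have 2: "?t [^]\<^bsub>T\<^esub> int (N j) = \<one>\<^bsub>T\<^esub>"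
    unfolding int_pow_int r.hom_nat_pow[OF Phi_closed, symmetric] Phi_delta_nat_pow[OF ij(2)]
    by (rule r.hom_one)
  obtain u v where uv: "u * int (N i) + v * int (N j) = int (gm (i, j))"
    using bezout_int[of "int (N i)" "int (N j)"] by (auto simp: gm_def)
  obtain w where w: "z = int (gm (i, j)) * w" using z by blast
  have "z = int (N i) * (u * w) + int (N j) * (v * w)"
    unfolding w uv[symmetric] by (simp add: algebra_simps)
  then have "?t [^]\<^bsub>T\<^esub> z = (?t [^]\<^bsub>T\<^esub> int (N i)) [^]\<^bsub>T\<^esub> (u * w) \<otimes>\<^bsub>T\<^esub> (?t [^]\<^bsub>T\<^esub> int (N j)) [^]\<^bsub>T\<^esub> (v * w)"
    by (simp only: T.int_pow_mult[OF t] T.int_pow_pow[OF t])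
  then show ?thesis unfolding 1 2 by simp
qed

lemma presents_tensor: "presents T (I \<times> I) gm ts"
proof -
  interpret T: comm_group T by (rule comm_group_T)
  note tc = tensor_basis_closed
  have fI: "finite (I \<times> I)" using finI by simp
  have cl: "ts M \<in> carrier T" for M unfolding ts_def by (rule T.lin_closed[OF tc])
  have add: "ts (\<lambda>p. M p + M' p) = ts M \<otimes>\<^bsub>T\<^esub> ts M'" for M M'
    unfolding ts_def by (rule T.lin_add[OF tc])
  have sub: "subgroup (range ts) T"
  proof (rule T.subgroupI)
    show "range ts \<subseteq> carrier T" by (intro image_subsetI cl)
    show "inv\<^bsub>T\<^esub> a \<in> range ts" if "a \<in> range ts" for a
    proof -
      obtain M where M: "a = ts M" using \<open>a \<in> range ts\<close> by (elim rangeE)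
      show ?thesis
        unfolding M ts_def T.lin_neg[OF tc, symmetric] by (rule rangeI)
    qed
    show "a \<otimes>\<^bsub>T\<^esub> b \<in> range ts" if "a \<in> range ts" "b \<in> range ts" for a b
    proof -
      obtain M M' where M: "a = ts M" "b = ts M'"
        using \<open>a \<in> range ts\<close> \<open>b \<in> range ts\<close> by (elim rangeE)
      show ?thesis unfolding M add[symmetric] by (rule rangeI)
    qed
  qed simp
  have rg: "range ts = carrier T"
  proof (rule tensor_subgroup_eq_carrier[OF is_group sub])
    \<comment> \<open>From basis tensors to all pure tensors by expanding one argument at a
      time.\<close>
    have b: "tensor G (\<Phi> (delta i)) (\<Phi> (delta j)) \<in> range ts" if "i \<in> I" "j \<in> I" for i j
    proof -
      have "ts (\<lambda>p. if p = (i, j) then 1 else 0) = tensor G (\<Phi> (delta i)) (\<Phi> (delta j))"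
        unfolding ts_def using T.lin_delta[OF fI _ tc, of "(i, j)" 1] that
        by (simp add: tensor_closed)
      then show ?thesis using rangeI[of ts "\<lambda>p. if p = (i, j) then 1 else 0"] by (simp only:)
    qed
    have b2: "tensor G (\<Phi> c) (\<Phi> (delta j)) \<in> range ts" if "j \<in> I" for c j
    proof -
      have "tensor G (\<Phi> c) (\<Phi> (delta j)) = lin T I (\<lambda>i. tensor G (\<Phi> (delta i)) (\<Phi> (delta j))) c"
        unfolding Phi_lin[of c]
        by (rule lin_hom[OF comm_group_T tensor_hom_left[OF is_group Phi_closed] finI]) simp
      then show ?thesis using T.lin_subgroup[OF sub finI] b that by simp
    qed
    fix x y assume "x \<in> carrier G" "y \<in> carrier G"
    then obtain c d where xy: "x = \<Phi> c" "y = \<Phi> d" using presentsD(3)[OF pres] by metis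
    have "tensor G (\<Phi> c) (\<Phi> d) = lin T I (\<lambda>j. tensor G (\<Phi> c) (\<Phi> (delta j))) d"
      unfolding Phi_lin[of d]
      by (rule lin_hom[OF comm_group_T tensor_hom_right[OF is_group Phi_closed] finI]) simp
    then show "tensor G x y \<in> range ts" unfolding xy using T.lin_subgroup[OF sub finI] b2 by simp
  qed
  have surj: "\<exists>c. x = ts c" if "x \<in> carrier T" for x
    using that unfolding rg[symmetric] by (elim rangeE) (rule exI)
  have ker: "ts M = \<one>\<^bsub>T\<^esub> \<longleftrightarrow> (\<forall>p\<in>I \<times> I. int (gm p) dvd M p)" for M
  proof
    assume L: "ts M = \<one>\<^bsub>T\<^esub>"
    show "\<forall>p\<in>I \<times> I. int (gm p) dvd M p"
    proof (clarify)
      fix i j assume ij: "i \<in> I" "j \<in> I"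
      obtain h where h: "h \<in> hom T Q_mod_Z"
        "h (ts M) = rat_class (of_int (M (i, j)) / of_nat (gm (i, j)))"
        using coordinate_hom_ts[OF ij] by metis
      have "rat_class (of_int (M (i, j)) / of_nat (gm (i, j))) = \<one>\<^bsub>Q_mod_Z\<^esub>"
        using hom_one[OF h(1) T.is_group QZ.is_group] h(2) L by simp
      then show "int (gm (i, j)) dvd M (i, j)"
        using of_int_div_in_Ints_iff gm_pos ij by (simp add: rat_class_eq_one)
    qed
  next
    assume R: "\<forall>p\<in>I \<times> I. int (gm p) dvd M p"
    show "ts M = \<one>\<^bsub>T\<^esub>"
      unfolding ts_def lin_def
      by (rule T.finprod_one_eqI) (use R tensor_basis_nat_pow in auto)
  qed
  show ?thesis unfolding presents_def by (simp add: cl add ker surj)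
qed

lemma ts_eq: "ts M = ts M' \<longleftrightarrow> (\<forall>p\<in>I \<times> I. [M p = M' p] (mod int (gm p)))"
  by (rule presents_eq[OF presents_tensor comm_group_T])

lemma tensor_Phi: "tensor G (\<Phi> c) (\<Phi> d) = ts (\<lambda>(i, j). c i * d j)"
proof -
  interpret T: comm_group T by (rule comm_group_T)
  obtain M where M: "tensor G (\<Phi> c) (\<Phi> d) = ts M"
    using presentsD(3)[OF presents_tensor tensor_closed[OF Phi_closed Phi_closed]] by blast
  have "[M (i, j) = c i * d j] (mod int (gm (i, j)))" if ij: "i \<in> I" "j \<in> I" for i j
  proof -
    obtain h where "h (tensor G (\<Phi> c) (\<Phi> d)) = rat_class (of_int (c i * d j) / of_nat (gm (i, j)))"
      "h (ts M) = rat_class (of_int (M (i, j)) / of_nat (gm (i, j)))"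
      using coordinate_hom_ts[OF ij] by metis
    then have "(of_int (M (i, j)) / of_nat (gm (i, j)) - of_int (c i * d j) / of_nat (gm (i, j)) :: rat) \<in> \<int>"
      unfolding M rat_class_eq[symmetric] by simp
    then have "(of_int (M (i, j) - c i * d j) / of_nat (gm (i, j)) :: rat) \<in> \<int>"
      by (simp add: diff_divide_distrib)
    moreover have "gm (i, j) > 0" using gm_pos ij by simp
    ultimately have "int (gm (i, j)) dvd M (i, j) - c i * d j"
      using of_int_div_in_Ints_iff by blast
    then show ?thesis by (simp add: cong_iff_dvd_diff)
  qed
  then show ?thesis unfolding M ts_eq by auto
qed

lemma tensor_form_ts:
  assumes A: "chi A \<in> carrier (torsion (dual G) (l ^ m))" and B: "chi B \<in> carrier (torsion (dual G) (l ^ m))"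
  shows "tensor_form l G (ts M) m (chi A) (chi B) = rat_class (\<Sum>(i, j)\<in>I \<times> I.
    of_int (M (i, j)) * (of_nat (l ^ m) * (of_int (A i) / of_nat (N i) * (of_int (B j) / of_nat (N j)))))"
proof -
  let ?r = "\<lambda>(i, j). of_nat (l ^ m) * (of_int (A i) / of_nat (N i) * (of_int (B j) / of_nat (N j))) :: rat"
  have "tensor_form l G (ts M) m (chi A) (chi B) = rat_class (\<Sum>p\<in>I \<times> I. of_int (M p) * ?r p)"
  proof (rule hom_ts[OF tensor_form_hom(1)[OF is_group A B]])
    fix i j assume ij: "i \<in> I" "j \<in> I"
    \<comment> \<open>The lifts picked by \<open>rat_lift\<close> are replaced by the explicit A i /
      N i and B j / N j; torsion of both characters is what allows it.\<close>
    show "tensor_form l G (tensor G (\<Phi> (delta i)) (\<Phi> (delta j))) m (chi A) (chi B) = rat_class (?r (i, j))"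
      unfolding tensor_form_hom(2)[OF is_group A B Phi_closed Phi_closed] prod.case
      by (rule rat_class_lift_mult[OF torsion_dual_lift(1)[OF A Phi_closed] torsion_dual_lift(1)[OF B Phi_closed]])
        (simp_all add: torsion_dual_lift(2)[OF A Phi_closed] torsion_dual_lift(2)[OF B Phi_closed]
          chi_Phi_delta ij rat_lift)
  qed
  then show ?thesis by (simp add: case_prod_unfold)
qed

text \<open>The coefficient matrix of the sum of c(i, j) e_i wedge e_j over i < j, inside the tensor
  square.\<close>

definition antisym_ext :: "(nat \<times> nat \<Rightarrow> int) \<Rightarrow> nat \<times> nat \<Rightarrow> int" where
  "antisym_ext c = (\<lambda>(i, j). if i < j then c (i, j) else if j < i then - c (j, i) else 0)"

text \<open>The normal form for tensors modulo wedges.\<close>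

definition upper_ext :: "(nat \<times> nat \<Rightarrow> int) \<Rightarrow> nat \<times> nat \<Rightarrow> int" where
  "upper_ext c = (\<lambda>(i, j). if i \<le> j then c (i, j) else 0)"

definition strict_pairs :: "(nat \<times> nat) set" where
  "strict_pairs = {(i, j). i \<in> I \<and> j \<in> I \<and> i < j}"

definition weak_pairs :: "(nat \<times> nat) set" where
  "weak_pairs = {(i, j). i \<in> I \<and> j \<in> I \<and> i \<le> j}"

lemma gm_swap: "gm (i, j) = gm (j, i)"
  by (simp add: gm_def gcd.commute)

lemma wedge_Phi: "wedge G (\<Phi> c) (\<Phi> d) = ts (antisym_ext (\<lambda>(i, j). c i * d j - d i * c j))"
proof -
  interpret T: comm_group T by (rule comm_group_T)
  have "antisym_ext (\<lambda>(i, j). c i * d j - d i * c j) = (\<lambda>p. (\<lambda>(i, j). c i * d j) p + - (\<lambda>(i, j). d i * c j) p)"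
    by (auto simp: antisym_ext_def fun_eq_iff)
  moreover have "ts (\<lambda>p. (\<lambda>(i, j). c i * d j) p + - (\<lambda>(i, j). d i * c j) p)
      = ts (\<lambda>(i, j). c i * d j) \<otimes>\<^bsub>T\<^esub> inv\<^bsub>T\<^esub> ts (\<lambda>(i, j). d i * c j)"
    unfolding ts_def T.lin_add[OF tensor_basis_closed] T.lin_neg[OF tensor_basis_closed] ..
  ultimately show ?thesis unfolding wedge_def tensor_Phi by simp
qed

text \<open>The wedge square sits inside the tensor square as the span of the basis wedges; a
  strictly upper coefficient appears there up to sign at two positions of equal order
  \<open>gm\<close>, so no new relation arises.\<close>

lemma presents_wedge: "presents (wedge_square G) strict_pairs gm (\<lambda>c. ts (antisym_ext c))"
proof -
  interpret T: comm_group T by (rule comm_group_T)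
  have fP: "finite strict_pairs"
    by (rule finite_subset[of _ "I \<times> I"]) (use finI in \<open>auto simp: strict_pairs_def\<close>)
  have add: "ts (antisym_ext (\<lambda>p. c p + d p)) = ts (antisym_ext c) \<otimes>\<^bsub>T\<^esub> ts (antisym_ext d)" for c d
  proof -
    have "antisym_ext (\<lambda>p. c p + d p) = (\<lambda>p. antisym_ext c p + antisym_ext d p)"
      by (auto simp: antisym_ext_def fun_eq_iff)
    then show ?thesis using presentsD(2)[OF presents_tensor] by simp
  qed
  have neg: "ts (antisym_ext (\<lambda>p. - c p)) = inv\<^bsub>T\<^esub> ts (antisym_ext c)" for c
  proof -
    have "antisym_ext (\<lambda>p. - c p) = (\<lambda>p. - antisym_ext c p)"
      by (auto simp: antisym_ext_def fun_eq_iff)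
    then show ?thesis unfolding ts_def by (simp add: T.lin_neg[OF tensor_basis_closed])
  qed
  have cl: "ts (antisym_ext c) \<in> carrier (wedge_square G)" for c
  proof -
    have "ts (antisym_ext c) = ts (\<lambda>q. \<Sum>p\<in>strict_pairs. c p * antisym_ext (delta p) q)"
      unfolding ts_eq
    proof (clarify)
      fix i j assume ij: "i \<in> I" "j \<in> I"
      have "(\<Sum>p\<in>strict_pairs. c p * antisym_ext (delta p) (i, j)) = antisym_ext c (i, j)"
      proof (cases i j rule: linorder_cases)
        case less
        have "(\<Sum>p\<in>strict_pairs. c p * antisym_ext (delta p) (i, j)) = (\<Sum>p\<in>strict_pairs. c p * of_int (delta (i, j) p))"
          using less by (intro sum.cong) (auto simp: antisym_ext_def delta_def)
        also have "\<dots> = c (i, j)" using less ij fP by (intro sum_delta) (auto simp: strict_pairs_def)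
        finally show ?thesis using less by (simp add: antisym_ext_def)
      next
        case equal
        then show ?thesis by (simp add: antisym_ext_def)
      next
        case greater
        have "(\<Sum>p\<in>strict_pairs. c p * antisym_ext (delta p) (i, j))
            = (\<Sum>p\<in>strict_pairs. - (c p * of_int (delta (j, i) p)))"
          using greater by (intro sum.cong) (auto simp: antisym_ext_def delta_def)
        also have "\<dots> = - (\<Sum>p\<in>strict_pairs. c p * of_int (delta (j, i) p))" by (rule sum_negf)
        also have "(\<Sum>p\<in>strict_pairs. c p * of_int (delta (j, i) p)) = c (j, i)"
          using greater ij fP by (intro sum_delta) (auto simp: strict_pairs_def)
        finally show ?thesis using greater by (simp add: antisym_ext_def)
      qed
      then show "[antisym_ext c (i, j) = (\<Sum>p\<in>strict_pairs. c p * antisym_ext (delta p) (i, j))] (mod int (gm (i, j)))"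
        by simp
    qed
    also have "\<dots> = lin T strict_pairs (\<lambda>p. ts (antisym_ext (delta p))) c"
      by (rule presents_sum[OF presents_tensor comm_group_T fP])
    also have "\<dots> \<in> carrier (wedge_square G)"
    proof (rule T.lin_subgroup[OF subgroup_wedge_square[OF is_group] fP], clarify)
      fix i j assume "(i, j) \<in> strict_pairs"
      then have "antisym_ext (delta (i, j)) = antisym_ext (\<lambda>(i', j'). delta i i' * delta j j' - delta j i' * delta i j')"
        by (auto simp: antisym_ext_def delta_def fun_eq_iff strict_pairs_def)
      then have "ts (antisym_ext (delta (i, j))) = wedge G (\<Phi> (delta i)) (\<Phi> (delta j))"
        unfolding wedge_Phi by simp
      then show "ts (antisym_ext (delta (i, j))) \<in> carrier (wedge_square G)"
        using wedge_in_wedge_square[OF is_group] by simp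
    qed
    finally show ?thesis .
  qed
  have "subgroup (range (\<lambda>c. ts (antisym_ext c))) T"
  proof (rule T.subgroupI)
    show "range (\<lambda>c. ts (antisym_ext c)) \<subseteq> carrier T"
      by (intro image_subsetI presentsD(1)[OF presents_tensor])
    show "inv\<^bsub>T\<^esub> a \<in> range (\<lambda>c. ts (antisym_ext c))" if "a \<in> range (\<lambda>c. ts (antisym_ext c))" for a
    proof -
      obtain c where c: "a = ts (antisym_ext c)"
        using \<open>a \<in> range (\<lambda>c. ts (antisym_ext c))\<close> by (elim rangeE)
      show ?thesis unfolding c neg[symmetric] by (rule rangeI)
    qed
    show "a \<otimes>\<^bsub>T\<^esub> b \<in> range (\<lambda>c. ts (antisym_ext c))"
      if "a \<in> range (\<lambda>c. ts (antisym_ext c))" "b \<in> range (\<lambda>c. ts (antisym_ext c))" for a b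
    proof -
      obtain c d where c: "a = ts (antisym_ext c)" "b = ts (antisym_ext d)"
        using \<open>a \<in> range (\<lambda>c. ts (antisym_ext c))\<close> \<open>b \<in> range (\<lambda>c. ts (antisym_ext c))\<close>
        by (elim rangeE)
      show ?thesis unfolding c add[symmetric] by (rule rangeI)
    qed
  qed simp
  then have surj: "carrier (wedge_square G) \<subseteq> range (\<lambda>c. ts (antisym_ext c))"
  proof (rule wedge_square_minimal[OF is_group])
    fix x y assume "x \<in> carrier G" "y \<in> carrier G"
    then obtain c d where "x = \<Phi> c" "y = \<Phi> d" using presentsD(3)[OF pres] by metis
    then show "wedge G x y \<in> range (\<lambda>c. ts (antisym_ext c))" by (simp only: wedge_Phi) (rule rangeI)
  qed
  have ker: "ts (antisym_ext c) = \<one>\<^bsub>T\<^esub> \<longleftrightarrow> (\<forall>p\<in>strict_pairs. int (gm p) dvd c p)" for c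
    unfolding presentsD(4)[OF presents_tensor]
  proof
    assume L: "\<forall>p\<in>I \<times> I. int (gm p) dvd antisym_ext c p"
    show "\<forall>p\<in>strict_pairs. int (gm p) dvd c p"
    proof
      fix p assume "p \<in> strict_pairs"
      then show "int (gm p) dvd c p"
        using L[rule_format, of p] by (auto simp: strict_pairs_def antisym_ext_def)
    qed
  next
    assume R: "\<forall>p\<in>strict_pairs. int (gm p) dvd c p"
    show "\<forall>p\<in>I \<times> I. int (gm p) dvd antisym_ext c p"
    proof clarify
      fix i j assume "i \<in> I" "j \<in> I"
      then show "int (gm (i, j)) dvd antisym_ext c (i, j)"
        using R[rule_format, of "(i, j)"] R[rule_format, of "(j, i)"] gm_swap[of i j]
        by (auto simp: strict_pairs_def antisym_ext_def)
    qed
  qed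
  have "\<exists>c. x = ts (antisym_ext c)" if "x \<in> carrier (wedge_square G)" for x
    using subsetD[OF surj that] by (elim rangeE) (rule exI)
  then show ?thesis
    unfolding presents_def by (simp add: cl add ker)
qed

text \<open>If an upper triangular matrix is congruent to an antisymmetric one, its zero entries
  below the diagonal force the entries above to vanish, and the diagonal vanishes by antisymmetry.
  Hence no relations arise beyond those of the tensor square.\<close>

lemma presents_sym:
  "presents (sym_square G) weak_pairs gm (\<lambda>c. carrier (wedge_square G) #>\<^bsub>T\<^esub> ts (upper_ext c))"
proof -
  interpret T: comm_group T by (rule comm_group_T)
  let ?W = "carrier (wedge_square G)"
  have sW: "subgroup ?W T" by (rule subgroup_wedge_square[OF is_group])
  have nW: "?W \<lhd> T" using sW by (rule T.subgroup_imp_normal)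
  have tc: "ts M \<in> carrier T" for M by (rule presentsD(1)[OF presents_tensor])
  have add: "upper_ext (\<lambda>p. c p + d p) = (\<lambda>p. upper_ext c p + upper_ext d p)" for c d
    by (auto simp: upper_ext_def fun_eq_iff)
  show ?thesis
    unfolding presents_def sym_square_def
  proof (intro conjI allI ballI)
    fix c d
    show "?W #>\<^bsub>T\<^esub> ts (upper_ext c) \<in> carrier (T Mod ?W)"
      unfolding carrier_FactGroup using tc by (rule imageI)
    show "?W #>\<^bsub>T\<^esub> ts (upper_ext (\<lambda>p. c p + d p)) =
        (?W #>\<^bsub>T\<^esub> ts (upper_ext c)) \<otimes>\<^bsub>T Mod ?W\<^esub> (?W #>\<^bsub>T\<^esub> ts (upper_ext d))"
      unfolding mult_FactGroup normal.rcos_sum[OF nW tc tc] add presentsD(2)[OF presents_tensor] ..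
    have "?W #>\<^bsub>T\<^esub> ts (upper_ext c) = ?W \<longleftrightarrow> ts (upper_ext c) \<in> ?W"
      using T.coset_join1[OF _ tc sW] T.coset_join2[OF tc sW] by blast
    also have "\<dots> \<longleftrightarrow> (\<exists>a. ts (upper_ext c) = ts (antisym_ext a))"
      using presentsD(3)[OF presents_wedge] presentsD(1)[OF presents_wedge] by metis
    also have "\<dots> \<longleftrightarrow> (\<forall>p\<in>weak_pairs. int (gm p) dvd c p)"
    proof
      assume "\<exists>a. ts (upper_ext c) = ts (antisym_ext a)"
      then obtain a where a: "[upper_ext c p = antisym_ext a p] (mod int (gm p))" if "p \<in> I \<times> I" for p
        unfolding ts_eq by blast
      show "\<forall>p\<in>weak_pairs. int (gm p) dvd c p"
      proof
        fix p assume "p \<in> weak_pairs"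
        then obtain i j where p: "p = (i, j)" "i \<in> I" "j \<in> I" "i \<le> j" by (auto simp: weak_pairs_def)
        have 1: "[c (i, j) = antisym_ext a (i, j)] (mod int (gm p))"
          using a[of p] p by (simp add: upper_ext_def)
        show "int (gm p) dvd c p"
        proof (cases "i = j")
          case True
          then show ?thesis using 1 p by (simp add: antisym_ext_def cong_0_iff)
        next
          case False
          then have "[0 = - a (i, j)] (mod int (gm p))"
            using a[of "(j, i)"] p gm_swap[of i j] by (simp add: antisym_ext_def upper_ext_def)
          then have "int (gm p) dvd a (i, j)" by (simp add: cong_iff_dvd_diff)
          moreover have "[c (i, j) = a (i, j)] (mod int (gm p))"
            using 1 False p by (simp add: antisym_ext_def)
          ultimately show ?thesis using p cong_dvd_iff by blast
        qed
      qed
    next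
      assume R: "\<forall>p\<in>weak_pairs. int (gm p) dvd c p"
      have "ts (upper_ext c) = ts (antisym_ext (\<lambda>_. 0))"
        unfolding ts_eq using R by (auto simp: upper_ext_def antisym_ext_def weak_pairs_def cong_0_iff)
      then show "\<exists>a. ts (upper_ext c) = ts (antisym_ext a)" by blast
    qed
    finally show "?W #>\<^bsub>T\<^esub> ts (upper_ext c) = \<one>\<^bsub>T Mod ?W\<^esub> \<longleftrightarrow> (\<forall>p\<in>weak_pairs. int (gm p) dvd c p)"
      by simp
  next
    fix X assume "X \<in> carrier (T Mod ?W)"
    then obtain M where X: "X = ?W #>\<^bsub>T\<^esub> ts M"
      using presentsD(3)[OF presents_tensor] unfolding carrier_FactGroup by auto
    \<comment> \<open>Modulo wedges the entry at \<open>(j, i)\<close> below the diagonal moves to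
      \<open>(i, j)\<close>: \<open>a\<close> is the wedge subtracted and \<open>c\<close> the
      folded upper triangular matrix.\<close>
    define a where "a = (\<lambda>(i, j). - M (j, i))"
    define c where "c = (\<lambda>(i, j). if i < j then M (i, j) + M (j, i) else M (i, j))"
    have "M = (\<lambda>p. antisym_ext a p + upper_ext c p)"
      by (auto simp: a_def c_def antisym_ext_def upper_ext_def fun_eq_iff)
    then have "ts M = ts (antisym_ext a) \<otimes>\<^bsub>T\<^esub> ts (upper_ext c)"
      using presentsD(2)[OF presents_tensor, of "antisym_ext a" "upper_ext c"] by simp
    then have "ts M \<in> ?W #>\<^bsub>T\<^esub> ts (upper_ext c)"
      using presentsD(1)[OF presents_wedge] unfolding r_coset_def by auto
    then have "X = ?W #>\<^bsub>T\<^esub> ts (upper_ext c)"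
      unfolding X by (rule T.repr_independence[symmetric, OF _ tc sW])
    then show "\<exists>c. X = ?W #>\<^bsub>T\<^esub> ts (upper_ext c)" by blast
  qed
qed

end

subsection \<open>BEG structures in coordinates\<close>

locale primary_coords = presented_group G "{..<k}" "\<lambda>i. l ^ a i" \<Phi>
  for G :: "'a monoid" (structure) and k l :: nat and a and \<Phi> +
  fixes n :: nat
  assumes prime: "prime l" and odd: "odd l" and n1: "1 \<le> n"
    and a1: "i < k \<Longrightarrow> 1 \<le> a i" and dec: "j < k \<Longrightarrow> i \<le> j \<Longrightarrow> a j \<le> a i"
begin

lemma l0: "l > 0"
  using prime prime_gt_0_nat by blast

text \<open>
  The \<open>i\<close>-th cyclic factor of \<open>G[l^n]\<close> has order \<open>l^bb(i)\<close> and is generated by the \<open>l^dd(i)\<close>-th power of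
  the basis element; \<open>gd\<close> and \<open>tt\<close> are the resulting coordinates on the \<open>l^n\<close>-torsion of the dual and
  of \<open>G\<close>, and the \<open>(i, j)\<close> entry of \<open>\<psi>\<close> or \<open>\<omega>\<close> is a residue modulo \<open>l^mm(i, j)\<close>.
\<close>

definition bb :: "nat \<Rightarrow> nat" where "bb i = min (a i) n"
definition dd :: "nat \<Rightarrow> nat" where "dd i = a i - n"
definition mm :: "nat \<times> nat \<Rightarrow> nat" where "mm = (\<lambda>(i, j). min (bb i) (bb j))"

lemma a_eq: "a i = dd i + bb i"
  by (simp add: bb_def dd_def)

lemma bb_le: "bb i \<le> n"
  by (simp add: bb_def)

lemma bb_pos: "i < k \<Longrightarrow> 1 \<le> bb i"
  using a1 n1 by (simp add: bb_def)

lemma bb_dec: "j < k \<Longrightarrow> i \<le> j \<Longrightarrow> bb j \<le> bb i"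
  using dec by (auto simp: bb_def min_def dest: le_trans)

lemma dd_dec: "j < k \<Longrightarrow> i \<le> j \<Longrightarrow> dd j \<le> dd i"
  using dec by (simp add: dd_def diff_le_mono)

lemma mm_less: "j < k \<Longrightarrow> i \<le> j \<Longrightarrow> mm (i, j) = bb j \<and> mm (j, i) = bb j"
  using bb_dec by (simp add: mm_def)

definition gd :: "(nat \<Rightarrow> int) \<Rightarrow> 'a \<Rightarrow> rat set" where
  "gd c = chi (\<lambda>i. int (l ^ dd i) * c i)"

definition tt :: "(nat \<Rightarrow> int) \<Rightarrow> 'a" where
  "tt c = \<Phi> (\<lambda>i. int (l ^ dd i) * c i)"

abbreviation D where "D \<equiv> torsion (dual G) (l ^ n)"

lemma comm_group_dual_G: "comm_group (dual G)"
  by (rule comm_group_dual[OF comm_group_axioms])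

lemma comm_group_D: "comm_group D"
  by (rule comm_group_torsion[OF comm_group_dual_G])

lemma comm_group_TG: "comm_group (torsion G (l ^ n))"
  by (rule comm_group_torsion[OF comm_group_axioms])

lemma presents_D: "presents D {..<k} (\<lambda>i. l ^ bb i) gd"
  using presents_prime_power_torsion[OF presents_dual comm_group_dual_G l0, of n]
  unfolding bb_def[abs_def] dd_def[abs_def] gd_def[abs_def] .

lemma presents_TG: "presents (torsion G (l ^ n)) {..<k} (\<lambda>i. l ^ bb i) tt"
  using presents_prime_power_torsion[OF pres comm_group_axioms l0, of n]
  unfolding bb_def[abs_def] dd_def[abs_def] tt_def[abs_def] .

lemma presented_D: "presented_group D {..<k} (\<lambda>i. l ^ bb i) gd"
  by (intro presented_group.intro comm_group_D presented_group_axioms.intro presents_D) (simp_all add: l0)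

lemma tt_eq: "tt c = tt c' \<longleftrightarrow> (\<forall>i<k. [c i = c' i] (mod int (l ^ bb i)))"
  using presents_eq[OF presents_TG comm_group_TG, of c c'] by auto

text \<open>A homomorphism from a cyclic group of order \<open>l ^ bb i\<close> to one of order
  \<open>l ^ bb j\<close> multiplies by a multiple of \<open>l ^ (bb j - mm (i, j))\<close>; the
  cofactor \<open>u (i, j)\<close> is free modulo \<open>l ^ mm (i, j)\<close>.\<close>

definition pcoeff :: "(nat \<times> nat \<Rightarrow> int) \<Rightarrow> nat \<Rightarrow> nat \<Rightarrow> int" where
  "pcoeff u i j = int (l ^ (bb j - mm (i, j))) * u (i, j)"

definition psi_of :: "(nat \<times> nat \<Rightarrow> int) \<Rightarrow> ('a \<Rightarrow> rat set) \<Rightarrow> 'a" where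
  "psi_of u = (\<lambda>\<gamma>\<in>carrier D. tt (\<lambda>j. \<Sum>i<k. presented_group.co gd \<gamma> i * pcoeff u i j))"

text \<open>Makes \<open>psi_of\<close> independent of the coordinates picked by \<open>co\<close>,
  which are determined only modulo \<open>l ^ bb i\<close>.\<close>

lemma pcoeff_dvd: "int (l ^ bb j) dvd int (l ^ bb i) * pcoeff u i j"
proof -
  have "bb j \<le> bb i + (bb j - mm (i, j))" by (auto simp: mm_def)
  then have "int (l ^ bb j) dvd int (l ^ (bb i + (bb j - mm (i, j))))"
    by (simp add: le_imp_power_dvd)
  then show ?thesis by (simp add: pcoeff_def power_add mult.assoc[symmetric])
qed

lemma psi_of_gd: "psi_of u (gd c) = tt (\<lambda>j. \<Sum>i<k. c i * pcoeff u i j)"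
proof -
  have "tt (\<lambda>j. \<Sum>i<k. presented_group.co gd (gd c) i * pcoeff u i j) = tt (\<lambda>j. \<Sum>i<k. c i * pcoeff u i j)"
    unfolding tt_eq
  proof (intro allI impI cong_sum)
    fix j i assume i: "i \<in> {..<k}"
    have "int (l ^ bb i) dvd presented_group.co gd (gd c) i - c i"
      using presented_group.co_cong[OF presented_D i, of c] by (simp add: cong_iff_dvd_diff)
    then have "int (l ^ bb i) * pcoeff u i j dvd (presented_group.co gd (gd c) i - c i) * pcoeff u i j"
      by (rule mult_dvd_mono) simp
    then have "int (l ^ bb j) dvd (presented_group.co gd (gd c) i - c i) * pcoeff u i j"
      using pcoeff_dvd dvd_trans by blast
    then show "[presented_group.co gd (gd c) i * pcoeff u i j = c i * pcoeff u i j] (mod int (l ^ bb j))"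
      by (simp add: cong_iff_dvd_diff left_diff_distrib)
  qed
  then show ?thesis using presentsD(1)[OF presents_D, of c] by (simp add: psi_of_def)
qed

lemma psi_of_hom: "psi_of u \<in> hom D (torsion G (l ^ n))"
proof (rule homI)
  fix x assume "x \<in> carrier D"
  then show "psi_of u x \<in> carrier (torsion G (l ^ n))"
    unfolding psi_of_def using presentsD(1)[OF presents_TG] by simp
  fix y assume "y \<in> carrier D"
  then obtain c c' where xy: "x = gd c" "y = gd c'"
    using presentsD(3)[OF presents_D] \<open>x \<in> carrier D\<close> by metis
  have "x \<otimes>\<^bsub>D\<^esub> y = gd (\<lambda>i. c i + c' i)" unfolding xy presentsD(2)[OF presents_D] ..
  moreover have "(\<lambda>j. \<Sum>i<k. (c i + c' i) * pcoeff u i j)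
      = (\<lambda>j. (\<Sum>i<k. c i * pcoeff u i j) + (\<Sum>i<k. c' i * pcoeff u i j))"
    by (simp add: distrib_right sum.distrib)
  ultimately show "psi_of u (x \<otimes>\<^bsub>D\<^esub> y) = psi_of u x \<otimes>\<^bsub>torsion G (l ^ n)\<^esub> psi_of u y"
    using presentsD(2)[OF presents_TG] by (simp only: psi_of_gd xy)
qed

lemma psi_of_extensional: "psi_of u \<in> extensional (carrier D)"
  by (simp add: psi_of_def)

lemma psi_of_eq: "psi_of u = psi_of u' \<longleftrightarrow> (\<forall>i<k. \<forall>j<k. [u (i, j) = u' (i, j)] (mod int (l ^ mm (i, j))))"
proof -
  have e: "[pcoeff u i j = pcoeff u' i j] (mod int (l ^ bb j)) \<longleftrightarrow> [u (i, j) = u' (i, j)] (mod int (l ^ mm (i, j)))"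
    for i j
  proof -
    have "bb j = (bb j - mm (i, j)) + mm (i, j)" by (auto simp: mm_def)
    then have "int (l ^ bb j) = int (l ^ (bb j - mm (i, j))) * int (l ^ mm (i, j))"
      by (metis of_nat_mult power_add)
    then show ?thesis
      using l0 by (simp add: pcoeff_def cong_iff_dvd_diff right_diff_distrib[symmetric] del: of_nat_power)
  qed
  show ?thesis
  proof
    assume L: "psi_of u = psi_of u'"
    show "\<forall>i<k. \<forall>j<k. [u (i, j) = u' (i, j)] (mod int (l ^ mm (i, j)))"
    proof (intro allI impI)
      fix i j assume ij: "i < k" "j < k"
      have s: "(\<Sum>i'<k. delta i i' * pcoeff v i' j) = pcoeff v i j" for v j
        using sum_delta[of "{..<k}" i "\<lambda>i'. pcoeff v i' j"] ij by (simp add: mult.commute)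
      have "tt (\<lambda>j. pcoeff u i j) = tt (\<lambda>j. pcoeff u' i j)"
        using psi_of_gd[of u "delta i"] psi_of_gd[of u' "delta i"] L unfolding s by simp
      then show "[u (i, j) = u' (i, j)] (mod int (l ^ mm (i, j)))"
        unfolding tt_eq e[symmetric] using ij by blast
    qed
  next
    assume R: "\<forall>i<k. \<forall>j<k. [u (i, j) = u' (i, j)] (mod int (l ^ mm (i, j)))"
    show "psi_of u = psi_of u'"
    proof (rule extensionalityI[OF psi_of_extensional psi_of_extensional])
      fix x assume "x \<in> carrier D"
      then obtain c where x: "x = gd c" using presentsD(3)[OF presents_D] by metis
      show "psi_of u x = psi_of u' x"
        unfolding x psi_of_gd tt_eq
      proof (intro allI impI cong_sum cong_mult cong_refl)
        fix j i assume "j < k" "i \<in> {..<k}"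
        then show "[pcoeff u i j = pcoeff u' i j] (mod int (l ^ bb j))" unfolding e using R by blast
      qed
    qed
  qed
qed

text \<open>The image of the i-th basis character is killed by \<open>l ^ bb i\<close>, which forces
  the divisibility of its coordinates that is built into \<open>pcoeff\<close>.\<close>

lemma psi_of_surj:
  assumes h: "\<psi> \<in> hom D (torsion G (l ^ n))" and ext: "\<psi> \<in> extensional (carrier D)"
  shows "\<exists>u. \<psi> = psi_of u"
proof -
  interpret DG: comm_group D by (rule comm_group_D)
  interpret TT: comm_group "torsion G (l ^ n)" by (rule comm_group_TG)
  interpret h: group_hom D "torsion G (l ^ n)" \<psi>
    by (intro group_hom.intro group_hom_axioms.intro DG.is_group TT.is_group h)
  have gdc: "gd c \<in> carrier D" for c by (rule presentsD(1)[OF presents_D])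
  have "\<exists>c. \<psi> (gd (delta i)) = tt c" for i
    by (rule presentsD(3)[OF presents_TG h.hom_closed[OF gdc]])
  then obtain p where p: "\<And>i. \<psi> (gd (delta i)) = tt (p i)" by metis
  have "\<exists>u. p i j = int (l ^ (bb j - mm (i, j))) * u" if ij: "i < k" "j < k" for i j
  proof -
    have "\<psi> (gd (delta i)) [^]\<^bsub>torsion G (l ^ n)\<^esub> (l ^ bb i) = \<psi> (gd (\<lambda>j. int (l ^ bb i) * delta i j))"
      unfolding presents_nat_pow[OF presents_D comm_group_D] by (rule h.hom_nat_pow[OF gdc, symmetric])
    also have "gd (\<lambda>j. int (l ^ bb i) * delta i j) = \<one>\<^bsub>D\<^esub>"
      unfolding presentsD(4)[OF presents_D] by (auto simp: delta_def)
    finally have "tt (p i) [^]\<^bsub>torsion G (l ^ n)\<^esub> (l ^ bb i) = \<one>\<^bsub>torsion G (l ^ n)\<^esub>"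
      unfolding p h.hom_one .
    then have "tt (\<lambda>j. int (l ^ bb i) * p i j) = \<one>\<^bsub>torsion G (l ^ n)\<^esub>"
      unfolding presents_nat_pow[OF presents_TG comm_group_TG] .
    then have "int (l ^ bb j) dvd int (l ^ bb i) * p i j"
      unfolding presentsD(4)[OF presents_TG] using ij by blast
    then have "int (l ^ (bb j - bb i)) dvd p i j" using prime_power_dvd_mult_iff[OF l0] by blast
    moreover have "bb j - bb i = bb j - mm (i, j)" by (simp add: mm_def)
    ultimately show ?thesis by (metis dvdE)
  qed
  then obtain u' where "\<And>i j. i < k \<Longrightarrow> j < k \<Longrightarrow> p i j = int (l ^ (bb j - mm (i, j))) * u' i j"
    by metis
  then have u: "p i j = pcoeff (\<lambda>(i, j). u' i j) i j" if "i < k" "j < k" for i j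
    using that by (simp add: pcoeff_def)
  have "\<psi> = psi_of (\<lambda>(i, j). u' i j)"
  proof (rule extensionalityI[OF ext psi_of_extensional])
    fix x assume "x \<in> carrier D"
    then obtain c where x: "x = gd c" using presentsD(3)[OF presents_D] by metis
    have "\<psi> x = lin (torsion G (l ^ n)) {..<k} (\<lambda>i. \<psi> (gd (delta i))) c"
      unfolding x presented_group.Phi_lin[OF presented_D, of c]
      by (rule DG.lin_hom[OF comm_group_TG h]) (auto simp: gdc)
    also have "\<dots> = tt (\<lambda>j. \<Sum>i<k. c i * p i j)"
      unfolding p by (rule presents_sum[OF presents_TG comm_group_TG, symmetric]) simp
    also have "\<dots> = psi_of (\<lambda>(i, j). u' i j) x"
      unfolding x psi_of_gd tt_eq
    proof (intro allI impI)
      fix j assume j: "j < k"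
      have "(\<Sum>i<k. c i * p i j) = (\<Sum>i<k. c i * pcoeff (\<lambda>(i, j). u' i j) i j)"
        using j by (intro sum.cong) (auto simp: u)
      then show "[\<Sum>i<k. c i * p i j = \<Sum>i<k. c i * pcoeff (\<lambda>(i, j). u' i j) i j] (mod int (l ^ bb j))"
        by simp
    qed
    finally show "\<psi> x = psi_of (\<lambda>(i, j). u' i j) x" .
  qed
  then show ?thesis by blast
qed

lemma chi_psi_of:
  "chi B (psi_of u (gd c)) = rat_class (\<Sum>(i, j)\<in>{..<k} \<times> {..<k}.
     of_int (c i) * of_int (B j) * (of_int (u (i, j)) / of_nat l ^ mm (i, j)))"
proof -
  let ?L = "of_nat l :: rat"
  have L: "?L \<noteq> 0" using l0 by simp
  \<comment> \<open>Since \<open>a j = dd j + bb j\<close>, the two scalings by powers of l cancel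
    down to the denominator \<open>l ^ mm (i, j)\<close>; the pairing has the plain matrix u(i, j) /
    l^mm(i, j).\<close>
  have pc: "?L ^ dd j * of_int (pcoeff u i j) / ?L ^ a j = of_int (u (i, j)) / ?L ^ mm (i, j)" for i j
  proof -
    have "bb j = (bb j - mm (i, j)) + mm (i, j)" by (auto simp: mm_def)
    then have "?L ^ a j = ?L ^ dd j * (?L ^ (bb j - mm (i, j)) * ?L ^ mm (i, j))"
      by (metis a_eq power_add)
    then show ?thesis using L by (simp add: pcoeff_def)
  qed
  have "(\<Sum>j<k. of_int (B j) * (of_int (int (l ^ dd j) * (\<Sum>i<k. c i * pcoeff u i j)) / of_nat (l ^ a j)))
      = (\<Sum>j<k. \<Sum>i<k. of_int (c i) * of_int (B j) * (?L ^ dd j * of_int (pcoeff u i j) / ?L ^ a j))"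
    by (simp add: sum_distrib_left sum_divide_distrib mult_ac)
  also have "\<dots> = (\<Sum>j<k. \<Sum>i<k. of_int (c i) * of_int (B j) * (of_int (u (i, j)) / ?L ^ mm (i, j)))"
    unfolding pc ..
  also have "\<dots> = (\<Sum>i<k. \<Sum>j<k. of_int (c i) * of_int (B j) * (of_int (u (i, j)) / ?L ^ mm (i, j)))"
    by (rule sum.swap)
  also have "\<dots> = (\<Sum>(i, j)\<in>{..<k} \<times> {..<k}. of_int (c i) * of_int (B j) * (of_int (u (i, j)) / ?L ^ mm (i, j)))"
    by (rule sum.cartesian_product)
  finally show ?thesis unfolding psi_of_gd tt_def chi_Phi by simp
qed

text \<open>The basis wedge of e_i and e_j has order \<open>l ^ min (a i) (a j)\<close>, so this
  scaling makes \<open>w (i, j)\<close> the coordinate on its l^n-torsion.\<close>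

definition we :: "(nat \<times> nat \<Rightarrow> int) \<Rightarrow> nat \<times> nat \<Rightarrow> int" where
  "we w = antisym_ext (\<lambda>(i, j). int (l ^ (min (a i) (a j) - n)) * w (i, j))"

lemma gm_eq: "gm = (\<lambda>p. l ^ (case p of (i, j) \<Rightarrow> min (a i) (a j)))"
proof
  fix p :: "nat \<times> nat"
  obtain i j where p: "p = (i, j)" by (cases p)
  show "gm p = l ^ (case p of (i, j) \<Rightarrow> min (a i) (a j))"
  proof (cases "a i \<le> a j")
    case True
    then show ?thesis by (simp add: p gm_def le_imp_power_dvd gcd_nat.absorb1)
  next
    case False
    then show ?thesis by (simp add: p gm_def le_imp_power_dvd gcd_nat.absorb2)
  qed
qed

lemma min_mm: "min (case p of (i, j) \<Rightarrow> min (a i) (a j)) n = mm p"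
  by (cases p) (simp add: mm_def bb_def)

lemma presents_wedge_torsion:
  "presents (torsion (wedge_square G) (l ^ n)) strict_pairs (\<lambda>p. l ^ mm p) (\<lambda>w. ts (we w))"
  using presents_prime_power_torsion[OF presents_wedge[unfolded gm_eq] comm_group_wedge_square[OF is_group] l0, of n]
  unfolding min_mm we_def[abs_def] by (simp add: case_prod_unfold)

lemma presents_sym_torsion:
  "\<exists>\<Psi>. presents (torsion (sym_square G) (l ^ n)) weak_pairs (\<lambda>p. l ^ mm p) \<Psi>"
proof -
  have "comm_group (sym_square G)"
    unfolding sym_square_def
    by (rule comm_group.abelian_FactGroup[OF comm_group_T subgroup_wedge_square[OF is_group]])
  then show ?thesis
    using presents_prime_power_torsion[OF presents_sym[unfolded gm_eq] _ l0, of n] unfolding min_mm by blast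
qed

text \<open>
  The difference of the two sides of the compatibility identity is a bilinear form in the coordinates
  of \<open>\<alpha>\<close> and \<open>\<beta>\<close>, with the following antisymmetric matrix up to the factor \<open>l^r\<close>.
\<close>

definition defect :: "(nat \<times> nat \<Rightarrow> int) \<Rightarrow> (nat \<times> nat \<Rightarrow> int) \<Rightarrow> nat \<times> nat \<Rightarrow> rat" where
  "defect w u = (\<lambda>(i, j). of_int (u (i, j)) / of_nat l ^ mm (i, j) / of_nat l ^ dd i
     - of_int (u (j, i)) / of_nat l ^ mm (j, i) / of_nat l ^ dd j
     - 2 * of_int (we w (i, j)) * of_nat l ^ n / (of_nat l ^ a i * of_nat l ^ a j))"

text \<open>For i < j, the numerator of \<open>defect w u (i, j)\<close>, up to sign, over the
  denominator \<open>l ^ dd i * l ^ bb j\<close>.\<close>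

definition cond :: "(nat \<times> nat \<Rightarrow> int) \<Rightarrow> (nat \<times> nat \<Rightarrow> int) \<Rightarrow> nat \<Rightarrow> nat \<Rightarrow> int" where
  "cond w u i j = int (l ^ (dd i - dd j)) * u (j, i) - u (i, j) + 2 * int (l ^ (n - bb i)) * w (i, j)"

lemma defect_antisym: "defect w u (j, i) = - defect w u (i, j)"
  by (simp add: defect_def we_def antisym_ext_def mult.commute)

lemma defect_diag: "defect w u (i, i) = 0"
  by (simp add: defect_def we_def antisym_ext_def)

lemma defect_less:
  assumes "i < j" "j < k"
  shows "defect w u (i, j) = - (of_int (cond w u i j) / of_nat l ^ bb j) / of_nat l ^ dd i"
proof -
  let ?L = "of_nat l :: rat"
  have L: "?L \<noteq> 0" using l0 by simp
  define x where "x = ?L ^ (dd i - dd j)"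
  define y where "y = ?L ^ dd j"
  define z where "z = ?L ^ bb j"
  define s where "s = ?L ^ (n - bb i)"
  define t where "t = ?L ^ bb i"
  have nz: "x \<noteq> 0" "y \<noteq> 0" "z \<noteq> 0" "s \<noteq> 0" "t \<noteq> 0"
    using L by (simp_all add: x_def y_def z_def s_def t_def)
  have 1: "?L ^ dd i = x * y"
    using dd_dec[of j i] assms by (simp add: x_def y_def flip: power_add)
  have 2: "?L ^ a i = x * y * t" "?L ^ a j = y * z"
    using 1 by (simp_all only: a_eq[of i] a_eq[of j] power_add y_def z_def t_def)
  have 3: "?L ^ n = s * t" using bb_le[of i] by (simp add: s_def t_def flip: power_add)
  have 4: "we w (i, j) = int (l ^ dd j) * w (i, j)"
    using assms dec[of j i] by (simp add: we_def antisym_ext_def dd_def)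
  have m: "mm (i, j) = bb j" "mm (j, i) = bb j" using mm_less[of j i] assms by auto
  show ?thesis
    unfolding defect_def cond_def prod.case m 1 2 3 4
    using nz by (simp add: x_def[symmetric] y_def[symmetric] z_def[symmetric] s_def[symmetric] field_simps)
qed

lemma chi_torsion_iff:
  "chi A \<in> carrier (torsion (dual G) (l ^ t)) \<longleftrightarrow> (\<forall>i<k. int (l ^ (a i - t)) dvd A i)"
proof -
  have "chi A \<in> carrier (torsion (dual G) (l ^ t)) \<longleftrightarrow> chi (\<lambda>i. int (l ^ t) * A i) = \<one>\<^bsub>dual G\<^esub>"
    unfolding presents_nat_pow[OF presents_dual comm_group_dual_G]
    by (simp add: carrier_torsion chi_in_dual)
  then show ?thesis
    unfolding presentsD(4)[OF presents_dual] prime_power_dvd_mult_iff[OF l0] by auto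
qed

lemma scaled_coefficient:
  assumes A: "chi A \<in> carrier (torsion (dual G) (l ^ (n + r)))" and i: "i < k"
  shows "int (l ^ dd i) dvd int (l ^ r) * A i"
proof -
  have "int (l ^ (a i - (n + r))) dvd A i" using A i chi_torsion_iff by blast
  then have "int (l ^ (dd i - r)) dvd A i" by (simp add: dd_def)
  then show ?thesis using prime_power_dvd_mult_iff[OF l0] by blast
qed

lemma beg_identity_iff:
  assumes A: "chi A \<in> carrier (torsion (dual G) (l ^ (n + r)))"
    and B: "chi B \<in> carrier (torsion (dual G) (l ^ (n + r)))"
  shows "chi B (psi_of u (chi A [^]\<^bsub>dual G\<^esub> (l ^ r))) =
        chi A (psi_of u (chi B [^]\<^bsub>dual G\<^esub> (l ^ r))) \<otimes>\<^bsub>Q_mod_Z\<^esub>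
          (tensor_form l G (ts (we w)) (n + r) (chi A) (chi B) [^]\<^bsub>Q_mod_Z\<^esub> (2::nat)) \<longleftrightarrow>
    (\<Sum>(i, j)\<in>{..<k} \<times> {..<k}. of_nat l ^ r * of_int (A i) * of_int (B j) * defect w u (i, j)) \<in> \<int>"
proof -
  let ?L = "of_nat l :: rat"
  have L: "?L \<noteq> 0" using l0 by simp
  \<comment> \<open>The l^r-th power of \<open>chi A\<close> lies in the l^n-torsion, and these are
    its coordinates for \<open>gd\<close>; the division is exact by
    \<open>scaled_coefficient\<close>.\<close>
  define q where "q A i = int (l ^ r) * A i div int (l ^ dd i)" for A i
  have qr: "of_int (q A i) = ?L ^ r * of_int (A i) / ?L ^ dd i"
    if "chi A \<in> carrier (torsion (dual G) (l ^ (n + r)))" "i < k" for A i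
  proof -
    have "int (l ^ r) * A i = int (l ^ dd i) * q A i"
      unfolding q_def using scaled_coefficient[OF that] by simp
    then have "(of_int (int (l ^ r) * A i) :: rat) = of_int (int (l ^ dd i) * q A i)" by simp
    then show ?thesis using L by (simp add: field_simps)
  qed
  have pw: "chi A [^]\<^bsub>dual G\<^esub> (l ^ r) = gd (q A)"
    if "chi A \<in> carrier (torsion (dual G) (l ^ (n + r)))" for A
    unfolding presents_nat_pow[OF presents_dual comm_group_dual_G, symmetric] gd_def
      presents_eq[OF presents_dual comm_group_dual_G]
    using scaled_coefficient[OF that] by (simp add: q_def)
  let ?I = "{..<k} \<times> {..<k}"
  let ?P = "\<lambda>p. of_int (u p) / ?L ^ mm p"
  define S1 where "S1 = (\<Sum>(i, j)\<in>?I. of_int (q A i) * of_int (B j) * ?P (i, j))"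
  define S2 where "S2 = (\<Sum>(i, j)\<in>?I. of_int (q B i) * of_int (A j) * ?P (i, j))"
  define S3 :: rat where "S3 = (\<Sum>(i, j)\<in>?I. of_int (we w (i, j)) *
     (of_nat (l ^ (n + r)) * (of_int (A i) / of_nat (l ^ a i) * (of_int (B j) / of_nat (l ^ a j)))))"
  \<comment> \<open>Transposed, so that in all three sums the term at \<open>(i, j)\<close> carries
    the product of \<open>A i\<close> and \<open>B j\<close>.\<close>
  have S2': "S2 = (\<Sum>(i, j)\<in>?I. of_int (A i) * of_int (q B j) * ?P (j, i))"
    unfolding S2_def
    by (rule sum.reindex_bij_witness[of _ "\<lambda>(i, j). (j, i)" "\<lambda>(i, j). (j, i)"]) auto
  have "S1 - (S2 + 2 * S3) = (\<Sum>(i, j)\<in>?I. ?L ^ r * of_int (A i) * of_int (B j) * defect w u (i, j))"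
    unfolding S1_def S2' S3_def sum_distrib_left sum.distrib[symmetric] sum_subtractf[symmetric]
    by (intro sum.cong[OF refl])
      (clarsimp simp: qr[OF A] qr[OF B] defect_def right_diff_distrib power_add mult_ac)
  moreover have "chi B (psi_of u (chi A [^]\<^bsub>dual G\<^esub> (l ^ r))) = rat_class S1"
    unfolding pw[OF A] chi_psi_of S1_def ..
  moreover have "chi A (psi_of u (chi B [^]\<^bsub>dual G\<^esub> (l ^ r))) = rat_class S2"
    unfolding pw[OF B] chi_psi_of S2_def ..
  moreover have "tensor_form l G (ts (we w)) (n + r) (chi A) (chi B) = rat_class S3"
    unfolding tensor_form_ts[OF A B] S3_def ..
  ultimately show ?thesis
    by (simp add: rat_class_nat_pow rat_class_add rat_class_eq)
qed

text \<open>Necessity needs one test pair of characters for each i < j, chosen so that the scaling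
  exactly cancels \<open>l ^ dd i\<close>. Conversely, for any r and any characters the factor
  \<open>l ^ r * A i\<close> (or \<open>l ^ r * B j\<close>, if j is the smaller index) contains
  that power of l.\<close>

lemma is_beg_coords_iff:
  assumes G: "finite_abelian_primary l G"
  shows "is_beg l n (G, ts (we w), psi_of u) \<longleftrightarrow>
    (\<forall>j<k. \<forall>i<j. int (l ^ bb j) dvd cond w u i j)"
proof
  have Lr: "(of_nat l :: rat) \<noteq> 0" using l0 by simp
  assume B: "is_beg l n (G, ts (we w), psi_of u)"
  show "\<forall>j<k. \<forall>i<j. int (l ^ bb j) dvd cond w u i j"
  proof (intro allI impI)
    fix i j assume ij: "j < k" "i < j"
    \<comment> \<open>With this r the j-th basis character is l^(n+r)-torsion, and
      \<open>l ^ (dd i - dd j)\<close> is the smallest power of l making the i-th one so too. The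
      scaling then amounts to \<open>l ^ dd i\<close>, which leaves the integrality of
      \<open>cond\<close> over \<open>l ^ bb j\<close>.\<close>
    define r where "r = dd j"
    define A where "A = (delta j :: nat \<Rightarrow> int)"
    define B' where "B' = (\<lambda>i'. int (l ^ (dd i - dd j)) * delta i i')"
    have tA: "chi A \<in> carrier (torsion (dual G) (l ^ (n + r)))"
      unfolding chi_torsion_iff A_def r_def delta_def by (auto simp: dd_def)
    have tB: "chi B' \<in> carrier (torsion (dual G) (l ^ (n + r)))"
      unfolding chi_torsion_iff B'_def r_def delta_def
      by (auto simp: dd_def intro!: le_imp_power_dvd)
    have "(\<Sum>(p, q)\<in>{..<k} \<times> {..<k}. of_nat l ^ r * of_int (A p) * of_int (B' q) * defect w u (p, q)) \<in> \<int>"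
      using is_beg_identity[OF B tA tB] unfolding beg_identity_iff[OF tA tB] .
    also have "(\<Sum>(p, q)\<in>{..<k} \<times> {..<k}. of_nat l ^ r * of_int (A p) * of_int (B' q) * defect w u (p, q))
       = (\<Sum>p\<in>{..<k} \<times> {..<k}. of_nat l ^ r * of_nat l ^ (dd i - dd j) * defect w u p * of_int (delta (j, i) p))"
      by (rule sum.cong) (auto simp: A_def B'_def delta_def split: if_splits)
    also have "\<dots> = of_nat l ^ r * of_nat l ^ (dd i - dd j) * defect w u (j, i)"
      using ij by (intro sum_delta) auto
    also have "\<dots> = of_nat l ^ dd i * (of_int (cond w u i j) / of_nat l ^ bb j / of_nat l ^ dd i)"
    proof -
      have "of_nat l ^ r * of_nat l ^ (dd i - dd j) = (of_nat l ^ dd i :: rat)"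
        using dd_dec[of j i] ij by (simp add: r_def flip: power_add)
      then show ?thesis
        unfolding defect_antisym[of w u j i] defect_less[OF ij(2,1)] by simp
    qed
    also have "\<dots> = of_int (cond w u i j) / of_nat (l ^ bb j)" using Lr by simp
    finally show "int (l ^ bb j) dvd cond w u i j"
      using of_int_div_in_Ints_iff[of "l ^ bb j" "cond w u i j"] l0 by simp
  qed
next
  assume C: "\<forall>j<k. \<forall>i<j. int (l ^ bb j) dvd cond w u i j"
  have Lr: "(of_nat l :: rat) \<noteq> 0" using l0 by simp
  have E: "(of_int (cond w u i j) / of_nat l ^ bb j :: rat) \<in> \<int>" if "i < j" "j < k" for i j
    using of_int_div_in_Ints_iff[of "l ^ bb j" "cond w u i j"] C that l0 by simp
  have "chi B (psi_of u (chi A [^]\<^bsub>dual G\<^esub> (l ^ r))) =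
        chi A (psi_of u (chi B [^]\<^bsub>dual G\<^esub> (l ^ r))) \<otimes>\<^bsub>Q_mod_Z\<^esub>
          (tensor_form l G (ts (we w)) (n + r) (chi A) (chi B) [^]\<^bsub>Q_mod_Z\<^esub> (2::nat))"
    if A: "chi A \<in> carrier (torsion (dual G) (l ^ (n + r)))"
      and B: "chi B \<in> carrier (torsion (dual G) (l ^ (n + r)))" for A B r
    unfolding beg_identity_iff[OF A B]
  proof (rule Ints_sum)
    fix p assume "p \<in> {..<k} \<times> {..<k}"
    then obtain i j where p: "p = (i, j)" and ij: "i \<in> {..<k}" "j \<in> {..<k}" by blast
    \<comment> \<open>The denominator of the defect involves \<open>dd\<close> only at the smaller
      index; it is absorbed by the coefficient of whichever character carries that index.\<close>
    have I: "(of_nat l ^ r * of_int (X i) / of_nat l ^ dd i :: rat) \<in> \<int>"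
      if "chi X \<in> carrier (torsion (dual G) (l ^ (n + r)))" "i < k" for X i
      using of_int_div_in_Ints_iff[of "l ^ dd i" "int (l ^ r) * X i"] scaled_coefficient[OF that] l0
      by simp
    have "of_nat l ^ r * of_int (A i) * of_int (B j) * defect w u (i, j) \<in> \<int>"
    proof (cases i j rule: linorder_cases)
      case less
      then have "of_nat l ^ r * of_int (A i) * of_int (B j) * defect w u (i, j)
          = - (of_nat l ^ r * of_int (A i) / of_nat l ^ dd i) * of_int (B j) * (of_int (cond w u i j) / of_nat l ^ bb j)"
        using ij by (simp add: defect_less)
      also have "\<dots> \<in> \<int>"
        by (intro Ints_mult Ints_minus Ints_of_int) (use I[OF A] E less ij in auto)
      finally show ?thesis .
    next
      case equal
      then show ?thesis by (simp add: defect_diag)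
    next
      case greater
      have ik: "i < k" using ij by simp
      have "of_nat l ^ r * of_int (A i) * of_int (B j) * defect w u (i, j)
          = (of_nat l ^ r * of_int (B j) / of_nat l ^ dd j) * of_int (A i) * (of_int (cond w u j i) / of_nat l ^ bb i)"
        unfolding defect_antisym[where j = i and i = j] defect_less[OF greater ik]
        by (simp add: mult_ac)
      also have "\<dots> \<in> \<int>"
        by (intro Ints_mult Ints_of_int) (use I[OF B] E greater ij in auto)
      finally show ?thesis .
    qed
    then show "(case p of (i, j) \<Rightarrow> of_nat l ^ r * of_int (A i) * of_int (B j) * defect w u (i, j)) \<in> \<int>"
      unfolding p by simp
  qed
  then have id: "\<beta> (psi_of u (\<alpha> [^]\<^bsub>dual G\<^esub> (l ^ r))) =
        \<alpha> (psi_of u (\<beta> [^]\<^bsub>dual G\<^esub> (l ^ r))) \<otimes>\<^bsub>Q_mod_Z\<^esub>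
          (tensor_form l G (ts (we w)) (n + r) \<alpha> \<beta> [^]\<^bsub>Q_mod_Z\<^esub> (2::nat))"
    if "\<alpha> \<in> carrier (torsion (dual G) (l ^ (n + r)))" "\<beta> \<in> carrier (torsion (dual G) (l ^ (n + r)))" for \<alpha> \<beta> r
    using that presentsD(3)[OF presents_dual] by (metis (no_types, lifting) carrier_torsion mem_Collect_eq)
  then show "is_beg l n (G, ts (we w), psi_of u)"
    unfolding is_beg_def
    using G presentsD(1)[OF presents_wedge_torsion] psi_of_hom psi_of_extensional by simp
qed

end

section \<open>Bijectivity of \<psi> as a condition on diagonal blocks modulo l\<close>

lemma nonsingD:
  "nonsing l I J M \<Longrightarrow> (\<And>j. j \<in> J \<Longrightarrow> int l dvd (\<Sum>i\<in>I. x i * M (i, j))) \<Longrightarrow> i \<in> I \<Longrightarrow> int l dvd x i"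
  unfolding nonsing_def by blast

text \<open>If the blocks are nonsingular, a kernel vector vanishes block by block. Conversely a
  kernel vector of block v is extended by zero to smaller values of \<beta> and, by solving a
  nonsingular system, to larger ones.\<close>

lemma nonsing_block_triangular:
  fixes \<beta> :: "'i \<Rightarrow> nat" and M :: "'i \<times> 'i \<Rightarrow> int"
  assumes l: "l > 0" and fin: "finite I"
  shows "nonsing l I I (\<lambda>(i, j). if \<beta> i \<le> \<beta> j then M (i, j) else 0) \<longleftrightarrow>
    (\<forall>v. nonsing l {i \<in> I. \<beta> i = v} {i \<in> I. \<beta> i = v} M)"
proof
  let ?M = "\<lambda>(i, j). if \<beta> i \<le> \<beta> j then M (i, j) else 0"
  assume R: "\<forall>v. nonsing l {i \<in> I. \<beta> i = v} {i \<in> I. \<beta> i = v} M"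
  show "nonsing l I I ?M"
    unfolding nonsing_def
  proof (intro allI impI)
    fix x assume x: "\<forall>j\<in>I. int l dvd (\<Sum>i\<in>I. x i * ?M (i, j))"
    \<comment> \<open>In the columns of block v, rows with smaller \<beta> contribute multiples of l
      by induction and rows with larger \<beta> have zero entries.\<close>
    have "\<forall>i\<in>{i \<in> I. \<beta> i = v}. int l dvd x i" for v
    proof (induction v rule: less_induct)
      case (less v)
      have "int l dvd (\<Sum>i\<in>{i \<in> I. \<beta> i = v}. x i * M (i, j))" if j: "j \<in> {i \<in> I. \<beta> i = v}" for j
      proof -
        have "(\<Sum>i\<in>I. x i * ?M (i, j)) = (\<Sum>i\<in>{i \<in> I. \<beta> i = v}. x i * ?M (i, j))
            + (\<Sum>i\<in>I - {i \<in> I. \<beta> i = v}. x i * ?M (i, j))"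
          using fin by (subst sum.subset_diff[of "{i \<in> I. \<beta> i = v}" I]) (auto simp: add.commute)
        also have "(\<Sum>i\<in>{i \<in> I. \<beta> i = v}. x i * ?M (i, j)) = (\<Sum>i\<in>{i \<in> I. \<beta> i = v}. x i * M (i, j))"
          using j by (intro sum.cong) auto
        finally have "(\<Sum>i\<in>I. x i * ?M (i, j)) = (\<Sum>i\<in>{i \<in> I. \<beta> i = v}. x i * M (i, j))
            + (\<Sum>i\<in>I - {i \<in> I. \<beta> i = v}. x i * ?M (i, j))" .
        moreover have "int l dvd (\<Sum>i\<in>I - {i \<in> I. \<beta> i = v}. x i * ?M (i, j))"
        proof (rule dvd_sum)
          fix i assume i: "i \<in> I - {i \<in> I. \<beta> i = v}"
          show "int l dvd x i * ?M (i, j)"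
          proof (cases "\<beta> i < v")
            case True
            then show ?thesis using less[OF True] i by auto
          next
            case False
            then show ?thesis using i j by auto
          qed
        qed
        ultimately show ?thesis using x j by (metis (no_types, lifting) dvd_add_left_iff mem_Collect_eq)
      qed
      then show ?case using nonsingD[OF spec[OF R, of v]] by blast
    qed
    then show "\<forall>i\<in>I. int l dvd x i" by blast
  qed
next
  let ?M = "\<lambda>(i, j). if \<beta> i \<le> \<beta> j then M (i, j) else 0"
  assume L: "nonsing l I I ?M"
  show "\<forall>v. nonsing l {i \<in> I. \<beta> i = v} {i \<in> I. \<beta> i = v} M"
    unfolding nonsing_def
  proof (intro allI impI)
    fix v x
    let ?V = "{i \<in> I. \<beta> i = v}" and ?J = "{i \<in> I. v < \<beta> i}"
    assume x: "\<forall>j\<in>?V. int l dvd (\<Sum>i\<in>?V. x i * M (i, j))"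
    have finJ: "finite ?J" "finite ?V" using fin by auto
    have split: "(\<Sum>i\<in>I. (if i \<in> ?V then x' i else if i \<in> ?J then z i else 0) * ?M (i, j))
        = (\<Sum>i\<in>?V. x' i * ?M (i, j)) + (\<Sum>i\<in>?J. z i * ?M (i, j))" for x' z :: "'i \<Rightarrow> int" and j
    proof -
      have "(\<Sum>i\<in>I. (if i \<in> ?V then x' i else if i \<in> ?J then z i else 0) * ?M (i, j))
          = (\<Sum>i\<in>?V \<union> ?J. (if i \<in> ?V then x' i else if i \<in> ?J then z i else 0) * ?M (i, j))"
        using fin by (intro sum.mono_neutral_right) auto
      also have "\<dots> = (\<Sum>i\<in>?V. (if i \<in> ?V then x' i else if i \<in> ?J then z i else 0) * ?M (i, j))
          + (\<Sum>i\<in>?J. (if i \<in> ?V then x' i else if i \<in> ?J then z i else 0) * ?M (i, j))"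
        using finJ by (intro sum.union_disjoint) auto
      also have "\<dots> = (\<Sum>i\<in>?V. x' i * ?M (i, j)) + (\<Sum>i\<in>?J. z i * ?M (i, j))"
        by (intro arg_cong2[of _ _ _ _ "(+)"] sum.cong) auto
      finally show ?thesis .
    qed
    have zero: "(\<Sum>i\<in>?J. z i * ?M (i, j)) = 0" if "j \<in> I" "j \<notin> ?J" for z :: "'i \<Rightarrow> int" and j
      using that by (intro sum.neutral) auto
    \<comment> \<open>A vector supported on \<open>?J\<close> produces nothing in columns outside
      \<open>?J\<close>, so a kernel vector here is one of the full matrix.\<close>
    have "nonsing l ?J ?J ?M"
      unfolding nonsing_def
    proof (intro allI impI ballI)
      fix z i assume z: "\<forall>j\<in>?J. int l dvd (\<Sum>i\<in>?J. z i * ?M (i, j))" and i: "i \<in> ?J"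
      have "int l dvd (\<Sum>i\<in>I. (if i \<in> ?V then 0 else if i \<in> ?J then z i else 0) * ?M (i, j))" if "j \<in> I" for j
        unfolding split[of "\<lambda>_. 0"] using z zero[of j z] that by (cases "j \<in> ?J") auto
      moreover have "i \<in> I" using i by simp
      ultimately have "int l dvd (if i \<in> ?V then 0 else if i \<in> ?J then z i else 0)"
        using nonsingD[OF L, of "\<lambda>i. if i \<in> ?V then 0 else if i \<in> ?J then z i else 0" i] by fast
      then show "int l dvd z i" using i by simp
    qed
    \<comment> \<open>\<open>z\<close> cancels what the vector on block v produces in the columns of
      \<open>?J\<close>.\<close>
    from nonsing_solvable[OF l finJ(1) finJ(1) refl this, of "\<lambda>j. - (\<Sum>i\<in>?V. x i * M (i, j))"]
    obtain z where z: "\<forall>j\<in>?J. [(\<Sum>i\<in>?J. z i * ?M (i, j)) = - (\<Sum>i\<in>?V. x i * M (i, j))] (mod int l)"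
      by blast
    have eq: "int l dvd (\<Sum>i\<in>I. (if i \<in> ?V then x i else if i \<in> ?J then z i else 0) * ?M (i, j))"
      if j: "j \<in> I" for j
    proof -
      consider "j \<in> ?J" | "j \<in> ?V" | "\<beta> j < v" using j by fastforce
      then show ?thesis
      proof cases
        case 1
        then have "(\<Sum>i\<in>?V. x i * ?M (i, j)) = (\<Sum>i\<in>?V. x i * M (i, j))" by (intro sum.cong) auto
        then show ?thesis
          unfolding split using bspec[OF z 1] by (simp add: cong_iff_dvd_diff add.commute)
      next
        case 2
        then have "(\<Sum>i\<in>?V. x i * ?M (i, j)) = (\<Sum>i\<in>?V. x i * M (i, j))" by (intro sum.cong) auto
        then show ?thesis unfolding split using zero[of j z] 2 x j by simp
      next
        case 3
        then have "(\<Sum>i\<in>?V. x i * ?M (i, j)) = 0" by (intro sum.neutral) auto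
        then show ?thesis unfolding split using zero[of j z] 3 j by simp
      qed
    qed
    show "\<forall>i\<in>?V. int l dvd x i"
    proof
      fix i assume i: "i \<in> ?V"
      have "i \<in> I" using i by simp
      then have "int l dvd (if i \<in> ?V then x i else if i \<in> ?J then z i else 0)"
        using nonsingD[OF L, of "\<lambda>i. if i \<in> ?V then x i else if i \<in> ?J then z i else 0" i] eq by fast
      then show "int l dvd x i" using i by simp
    qed
  qed
qed

context primary_coords
begin

text \<open>The action of \<psi> on the l-torsion, spanned by the elements with coordinate
  \<open>l ^ (bb i - 1)\<close>. For \<open>bb i \<le> bb j\<close> the exponents add up to
  \<open>bb j - 1\<close>; otherwise \<open>bb i - 1 \<ge> bb j\<close> and the entry vanishes,
  which is the block triangular shape.\<close>

lemma sum_pcoeff_cong: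
  "[(\<Sum>i<k. int (l ^ (bb i - 1)) * x i * pcoeff u i j) =
    int (l ^ (bb j - 1)) * (\<Sum>i<k. x i * (case (i, j) of (i, j) \<Rightarrow> if bb i \<le> bb j then u (i, j) else 0))]
    (mod int (l ^ bb j))" if j: "j < k"
  unfolding sum_distrib_left
proof (rule cong_sum)
  fix i assume i: "i \<in> {..<k}"
  show "[int (l ^ (bb i - 1)) * x i * pcoeff u i j =
      int (l ^ (bb j - 1)) * (x i * (case (i, j) of (i, j) \<Rightarrow> if bb i \<le> bb j then u (i, j) else 0))]
      (mod int (l ^ bb j))"
  proof (cases "bb i \<le> bb j")
    case True
    have "(bb i - 1) + (bb j - bb i) = bb j - 1" using True bb_pos[of i] i by simp
    then have "int (l ^ (bb i - 1)) * int (l ^ (bb j - bb i)) = int (l ^ (bb j - 1))"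
      by (metis of_nat_mult power_add)
    moreover have "mm (i, j) = bb i" using True by (simp add: mm_def)
    ultimately have e: "int (l ^ (bb i - 1)) * x i * pcoeff u i j = int (l ^ (bb j - 1)) * (x i * u (i, j))"
      unfolding pcoeff_def by (metis mult.assoc mult.left_commute)
    have "(case (i, j) of (i, j) \<Rightarrow> if bb i \<le> bb j then u (i, j) else 0) = u (i, j)"
      using True by simp
    then show ?thesis unfolding e by (simp only: cong_refl)
  next
    case False
    then have "int (l ^ bb j) dvd int (l ^ (bb i - 1))" by (simp add: le_imp_power_dvd)
    then show ?thesis using False by (simp add: cong_0_iff del: of_nat_power)
  qed
qed

lemma dvd_pred_power:
  assumes "1 \<le> e"
  shows "int (l ^ e) dvd int (l ^ (e - 1)) * z \<longleftrightarrow> int l dvd z"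
  using prime_power_dvd_mult_iff[OF l0, of e "e - 1" z] assms by simp

text \<open>Source and target have equal order, so bijectivity is injectivity, and a nontrivial
  kernel in an l-group contains an element of order l. Hence only the l-torsion matters, where
  \<open>sum_pcoeff_cong\<close> applies.\<close>

lemma psi_of_iso_iff:
  "psi_of u \<in> iso D (torsion G (l ^ n)) \<longleftrightarrow>
    nonsing l {..<k} {..<k} (\<lambda>(i, j). if bb i \<le> bb j then u (i, j) else 0)"
proof -
  interpret DG: comm_group D by (rule comm_group_D)
  interpret TT: comm_group "torsion G (l ^ n)" by (rule comm_group_TG)
  interpret h: group_hom D "torsion G (l ^ n)" "psi_of u"
    by (intro group_hom.intro group_hom_axioms.intro DG.is_group TT.is_group psi_of_hom)
  let ?M = "\<lambda>(i, j). if bb i \<le> bb j then u (i, j) else 0"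
  define ker where "ker c \<longleftrightarrow> (\<forall>j<k. int (l ^ bb j) dvd (\<Sum>i<k. c i * pcoeff u i j))" for c
  have cD: "card (carrier D) = card (carrier (torsion G (l ^ n)))"
    using presents_card[OF presents_D comm_group_D] presents_card[OF presents_TG comm_group_TG] l0 by simp
  have fT: "finite (carrier (torsion G (l ^ n)))" "finite (carrier D)"
    using presents_finite[OF presents_TG comm_group_TG] presents_finite[OF presents_D comm_group_D] l0 by auto
  have "psi_of u \<in> iso D (torsion G (l ^ n)) \<longleftrightarrow> inj_on (psi_of u) (carrier D)"
  proof
    assume inj: "inj_on (psi_of u) (carrier D)"
    have "psi_of u ` carrier D = carrier (torsion G (l ^ n))"
      using card_image[OF inj] cD fT h.hom_closed by (intro card_subset_eq) auto
    then show "psi_of u \<in> iso D (torsion G (l ^ n))"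
      using inj psi_of_hom by (simp add: iso_def bij_betw_def)
  qed (auto simp: iso_def bij_betw_def)
  also have "\<dots> \<longleftrightarrow> (\<forall>x\<in>carrier D. psi_of u x = \<one>\<^bsub>torsion G (l ^ n)\<^esub> \<longrightarrow> x = \<one>\<^bsub>D\<^esub>)"
    using h.inj_on_one_iff by blast
  also have "\<dots> \<longleftrightarrow> (\<forall>c. psi_of u (gd c) = \<one>\<^bsub>torsion G (l ^ n)\<^esub> \<longrightarrow> gd c = \<one>\<^bsub>D\<^esub>)"
    using presentsD(1)[OF presents_D] presentsD(3)[OF presents_D] by metis
  also have "\<dots> \<longleftrightarrow> (\<forall>c. ker c \<longrightarrow> (\<forall>i<k. int (l ^ bb i) dvd c i))"
    unfolding psi_of_gd presentsD(4)[OF presents_TG] presentsD(4)[OF presents_D] ker_def by auto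
  also have "\<dots> \<longleftrightarrow> nonsing l {..<k} {..<k} ?M"
  proof
    assume K: "\<forall>c. ker c \<longrightarrow> (\<forall>i<k. int (l ^ bb i) dvd c i)"
    show "nonsing l {..<k} {..<k} ?M"
      unfolding nonsing_def
    proof (intro allI impI ballI)
      fix x i assume x: "\<forall>j\<in>{..<k}. int l dvd (\<Sum>i<k. x i * ?M (i, j))" and i: "i \<in> {..<k}"
      have "ker (\<lambda>i. int (l ^ (bb i - 1)) * x i)"
        unfolding ker_def
      proof (intro allI impI)
        fix j assume j: "j < k"
        have "int (l ^ bb j) dvd int (l ^ (bb j - 1)) * (\<Sum>i<k. x i * ?M (i, j))"
          unfolding dvd_pred_power[OF bb_pos[OF j]] using x j by blast
        then show "int (l ^ bb j) dvd (\<Sum>i<k. int (l ^ (bb i - 1)) * x i * pcoeff u i j)"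
          using cong_dvd_iff[OF sum_pcoeff_cong[OF j]] by blast
      qed
      then have "int (l ^ bb i) dvd int (l ^ (bb i - 1)) * x i" using K i by blast
      then show "int l dvd x i" using dvd_pred_power bb_pos i by blast
    qed
  next
    assume N: "nonsing l {..<k} {..<k} ?M"
    \<comment> \<open>A kernel element killed by l has coordinates divisible by
      \<open>l ^ (bb i - 1)\<close>; the quotients form a kernel vector of the matrix modulo
      l.\<close>
    have step: "\<forall>i<k. int (l ^ bb i) dvd c i"
      if c: "ker c" and lc: "\<forall>i<k. int (l ^ bb i) dvd int l * c i" for c
    proof -
      have "int (l ^ (bb i - 1)) dvd c i" if "i < k" for i
        using prime_power_dvd_mult_iff[OF l0, of "bb i" 1 "c i"] lc that by simp
      then have cx: "c i = int (l ^ (bb i - 1)) * (c i div int (l ^ (bb i - 1)))" if "i < k" for i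
        using that by simp
      let ?x = "\<lambda>i. c i div int (l ^ (bb i - 1))"
      have dv: "int l dvd (\<Sum>i<k. ?x i * ?M (i, j))" if j: "j \<in> {..<k}" for j
      proof -
        have j': "j < k" using j by simp
        have "(\<Sum>i<k. c i * pcoeff u i j) = (\<Sum>i<k. int (l ^ (bb i - 1)) * ?x i * pcoeff u i j)"
        proof (rule sum.cong[OF refl])
          fix i assume "i \<in> {..<k}"
          then show "c i * pcoeff u i j = int (l ^ (bb i - 1)) * ?x i * pcoeff u i j"
            using cx[of i] by (metis lessThan_iff)
        qed
        then have "int (l ^ bb j) dvd (\<Sum>i<k. int (l ^ (bb i - 1)) * ?x i * pcoeff u i j)"
          using c j' unfolding ker_def by metis
        then have "int (l ^ bb j) dvd int (l ^ (bb j - 1)) * (\<Sum>i<k. ?x i * ?M (i, j))"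
          using cong_dvd_iff[OF sum_pcoeff_cong[OF j', where x = ?x and u = u]] by (rule iffD1[rotated])
        then show ?thesis unfolding dvd_pred_power[OF bb_pos[OF j']] .
      qed
      have "int l dvd ?x i" if "i < k" for i
        by (rule nonsingD[OF N, of ?x i, OF dv]) (use that in simp_all)
      then show ?thesis using cx dvd_pred_power bb_pos by metis
    qed
    show "\<forall>c. ker c \<longrightarrow> (\<forall>i<k. int (l ^ bb i) dvd c i)"
    proof (intro allI impI)
      fix c i assume c: "ker c" and i: "i < k"
      \<comment> \<open>All exponents are at most n, so l^n kills the element; \<open>step\<close>
        removes one factor l at a time.\<close>
      have "\<forall>i<k. int (l ^ bb i) dvd int (l ^ (n - s)) * c i" if "s \<le> n" for s
        using that
      proof (induction s)
        case 0
        then show ?case using bb_le by (auto intro!: dvd_mult2 simp: le_imp_power_dvd)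
      next
        case (Suc s)
        let ?c = "\<lambda>i. int (l ^ (n - Suc s)) * c i"
        have "n - s = Suc (n - Suc s)" using Suc.prems by simp
        then have "\<forall>i<k. int (l ^ bb i) dvd int l * ?c i"
          using Suc by (simp add: mult.assoc)
        moreover have "ker ?c"
          unfolding ker_def
        proof (intro allI impI)
          fix j assume "j < k"
          then have "int (l ^ bb j) dvd (\<Sum>i<k. c i * pcoeff u i j)" using c by (simp add: ker_def)
          then have "int (l ^ bb j) dvd int (l ^ (n - Suc s)) * (\<Sum>i<k. c i * pcoeff u i j)"
            by (rule dvd_mult)
          then show "int (l ^ bb j) dvd (\<Sum>i<k. ?c i * pcoeff u i j)"
            by (simp only: sum_distrib_left mult.assoc)
        qed
        ultimately show ?case by (rule step[rotated])
      qed
      from this[of n] show "int (l ^ bb i) dvd c i" using i by simp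
    qed
  qed
  finally show ?thesis .
qed

definition blk :: "nat \<Rightarrow> nat set" where
  "blk v = {i \<in> {..<k}. bb i = v}"

lemma psi_iso_iff:
  "psi_iso l n (G, ts (we w), psi_of u) \<longleftrightarrow> (\<forall>v\<in>{1..n}. nonsing l (blk v) (blk v) u)"
proof -
  have "nonsing l (blk v) (blk v) u" if "v \<notin> {1..n}" for v
  proof -
    have "blk v = {}" using that bb_le bb_pos by (force simp: blk_def)
    then show ?thesis by (simp add: nonsing_def)
  qed
  then show ?thesis
    unfolding psi_iso_def prod.case psi_of_iso_iff nonsing_block_triangular[OF l0 finite_lessThan] blk_def
    by blast
qed

text \<open>
  Free parameters for the BEG structures: below the diagonal and on it, the entries of \<open>\<psi>\<close>; above the
  diagonal, an entry of \<open>\<psi>\<close> in the top block, where it determines the entry of \<open>\<omega>\<close> because 2 is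
  invertible, and otherwise the entry of \<open>\<omega>\<close>, which determines that of \<open>\<psi>\<close>.
\<close>

abbreviation sq where "sq \<equiv> {..<k} \<times> {..<k}"

definition enc :: "(nat \<times> nat \<Rightarrow> int) \<Rightarrow> (nat \<times> nat \<Rightarrow> int) \<Rightarrow> nat \<times> nat \<Rightarrow> int" where
  "enc w u = (\<lambda>p\<in>sq. case p of (i, j) \<Rightarrow> if i < j \<and> bb j < n then w (i, j) else u (i, j))"

definition half :: int where "half = (int (l ^ n) + 1) div 2"

text \<open>For \<open>bb j = n\<close> also \<open>bb i = n\<close>, and the congruence is 2 w(i,
  j) = u(i, j) - l^(dd i - dd j) u(j, i) modulo l^n; \<open>half\<close> is the inverse of 2
  there.\<close>

definition dec_w :: "(nat \<times> nat \<Rightarrow> int) \<Rightarrow> nat \<times> nat \<Rightarrow> int" where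
  "dec_w f = (\<lambda>p\<in>strict_pairs. case p of (i, j) \<Rightarrow> if bb j < n then f (i, j)
     else (half * (f (i, j) - int (l ^ (dd i - dd j)) * f (j, i))) mod int (l ^ n))"

text \<open>In \<open>cond\<close> the entry \<open>u (i, j)\<close> has coefficient -1, so below
  the top exponent the congruence is solved for it.\<close>

definition dec_u :: "(nat \<times> nat \<Rightarrow> int) \<Rightarrow> nat \<times> nat \<Rightarrow> int" where
  "dec_u f = (\<lambda>p\<in>sq. case p of (i, j) \<Rightarrow> if i < j \<and> bb j < n
     then (int (l ^ (dd i - dd j)) * f (j, i) + 2 * int (l ^ (n - bb i)) * f (i, j)) mod int (l ^ bb j)
     else f (i, j))"

definition WW where "WW = PiE strict_pairs (\<lambda>p. {0..<int (l ^ mm p)})"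
definition FF where "FF = PiE sq (\<lambda>p. {0..<int (l ^ mm p)})"

lemma half: "[2 * half = 1] (mod int (l ^ n))"
proof -
  have "odd (l ^ n)" using odd by simp
  then have "even (int (l ^ n) + 1)" by simp
  then have "2 * half = int (l ^ n) + 1" unfolding half_def by (rule dvd_mult_div_cancel)
  then show ?thesis by (simp add: cong_iff_dvd_diff)
qed

lemma strict_pairs_iff: "(i, j) \<in> strict_pairs \<longleftrightarrow> i < j \<and> j < k"
  by (auto simp: strict_pairs_def)

lemma strict_pairs_cases:
  assumes "(i, j) \<in> strict_pairs"
  shows "mm (i, j) = bb j" "mm (j, i) = bb j" "bb j < n \<or> (bb j = n \<and> bb i = n)" "(i, j) \<in> sq" "(j, i) \<in> sq"
proof -
  have ij: "i < j" "j < k" using assms by (auto simp: strict_pairs_iff)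
  then show "mm (i, j) = bb j" "mm (j, i) = bb j" using mm_less[of j i] by auto
  show "bb j < n \<or> (bb j = n \<and> bb i = n)" using bb_le[of i] bb_le[of j] bb_dec[of j i] ij by auto
  show "(i, j) \<in> sq" "(j, i) \<in> sq" using ij by auto
qed

lemma FF_range: "f \<in> FF \<Longrightarrow> p \<in> sq \<Longrightarrow> f p \<in> {0..<int (l ^ mm p)}"
  unfolding FF_def by (rule PiE_mem)

lemma WW_range: "w \<in> WW \<Longrightarrow> p \<in> strict_pairs \<Longrightarrow> w p \<in> {0..<int (l ^ mm p)}"
  unfolding WW_def by (rule PiE_mem)

lemma pow_pos: "(0::int) < int (l ^ e)"
  using l0 by simp

lemma dec_w_mem:
  assumes f: "f \<in> FF"
  shows "dec_w f \<in> WW"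
  unfolding WW_def
proof (rule PiE_I)
  fix p assume p: "p \<in> strict_pairs"
  obtain i j where ij: "p = (i, j)" by (cases p)
  note c = strict_pairs_cases[OF p[unfolded ij]]
  show "dec_w f p \<in> {0..<int (l ^ mm p)}"
  proof (cases "bb j < n")
    case True
    then show ?thesis using FF_range[OF f c(4)] p by (simp add: dec_w_def ij)
  next
    case False
    then have "mm p = n" using c by (simp add: ij)
    then show ?thesis using False p pow_pos[of n] by (simp add: dec_w_def ij del: of_nat_power)
  qed
qed (simp add: dec_w_def)

lemma dec_u_mem:
  assumes f: "f \<in> FF"
  shows "dec_u f \<in> FF"
  unfolding FF_def
proof (rule PiE_I)
  fix p assume p: "p \<in> sq"
  obtain i j where ij: "p = (i, j)" by (cases p)
  show "dec_u f p \<in> {0..<int (l ^ mm p)}"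
  proof (cases "i < j \<and> bb j < n")
    case True
    then have "(i, j) \<in> strict_pairs" using p by (simp add: ij strict_pairs_iff)
    then have "mm p = bb j" using strict_pairs_cases(1) ij by blast
    then show ?thesis using True p pow_pos[of "bb j"] by (simp add: dec_u_def ij del: of_nat_power)
  next
    case False
    then show ?thesis using FF_range[OF f p] p by (auto simp: dec_u_def ij)
  qed
qed (simp add: dec_u_def)

lemma enc_mem:
  assumes "w \<in> WW" "u \<in> FF"
  shows "enc w u \<in> FF"
  unfolding FF_def
proof (rule PiE_I)
  fix p assume p: "p \<in> sq"
  obtain i j where ij: "p = (i, j)" by (cases p)
  show "enc w u p \<in> {0..<int (l ^ mm p)}"
  proof (cases "i < j \<and> bb j < n")
    case True
    then have "p \<in> strict_pairs" using p by (simp add: ij strict_pairs_iff)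
    then show ?thesis using True p WW_range[OF assms(1)] by (simp add: enc_def ij)
  next
    case False
    then show ?thesis using FF_range[OF assms(2) p] p by (auto simp: enc_def ij)
  qed
qed (simp add: enc_def)

lemma cond_dec:
  assumes "i < j" "j < k"
  shows "int (l ^ bb j) dvd cond (dec_w f) (dec_u f) i j"
proof -
  have s: "(i, j) \<in> strict_pairs" using assms by (simp add: strict_pairs_iff)
  note c = strict_pairs_cases[OF s]
  have ji: "dec_u f (j, i) = f (j, i)" using c(5) assms by (simp add: dec_u_def)
  show ?thesis
  proof (cases "bb j < n")
    case True
    let ?y = "int (l ^ (dd i - dd j)) * f (j, i) + 2 * int (l ^ (n - bb i)) * f (i, j)"
    have "cond (dec_w f) (dec_u f) i j = ?y - ?y mod int (l ^ bb j)"
      using True s c(4) assms unfolding cond_def ji by (simp add: dec_w_def dec_u_def)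
    then show ?thesis by (simp add: mod_eq_dvd_iff[symmetric])
  next
    case False
    then have n: "bb j = n" "bb i = n" using c(3) by auto
    let ?y = "f (i, j) - int (l ^ (dd i - dd j)) * f (j, i)"
    have "cond (dec_w f) (dec_u f) i j = 2 * ((half * ?y) mod int (l ^ n)) - ?y"
      using False s c(4) assms n unfolding cond_def ji by (simp add: dec_w_def dec_u_def)
    moreover have "[2 * ((half * ?y) mod int (l ^ n)) = ?y] (mod int (l ^ n))"
    proof -
      have "[2 * ((half * ?y) mod int (l ^ n)) = 2 * (half * ?y)] (mod int (l ^ n))"
        by (intro cong_mult cong_refl) (simp add: cong_def)
      also have "2 * (half * ?y) = (2 * half) * ?y" by simp
      also have "[(2 * half) * ?y = 1 * ?y] (mod int (l ^ n))"
        by (intro cong_mult half cong_refl)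
      finally show ?thesis by simp
    qed
    ultimately show ?thesis using n by (simp add: cong_iff_dvd_diff)
  qed
qed

lemma enc_dec:
  assumes f: "f \<in> FF"
  shows "enc (dec_w f) (dec_u f) = f"
proof (rule extensionalityI[of _ sq])
  show "enc (dec_w f) (dec_u f) \<in> extensional sq" by (simp add: enc_def)
  show "f \<in> extensional sq" using f by (simp add: FF_def PiE_def)
  fix p assume p: "p \<in> sq"
  obtain i j where ij: "p = (i, j)" by (cases p)
  show "enc (dec_w f) (dec_u f) p = f p"
    using p by (auto simp: ij enc_def dec_w_def dec_u_def strict_pairs_iff)
qed

text \<open>The congruences determine the entries omitted by \<open>enc\<close>; all entries are
  reduced residues, so the recovered ones agree exactly and not just modulo powers of l.\<close>

lemma dec_enc:
  assumes w: "w \<in> WW" and u: "u \<in> FF" and C: "\<And>i j. i < j \<Longrightarrow> j < k \<Longrightarrow> int (l ^ bb j) dvd cond w u i j"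
  shows "dec_w (enc w u) = w" "dec_u (enc w u) = u"
proof -
  show "dec_w (enc w u) = w"
  proof (rule extensionalityI[of _ strict_pairs])
    show "dec_w (enc w u) \<in> extensional strict_pairs" by (simp add: dec_w_def)
    show "w \<in> extensional strict_pairs" using w by (simp add: WW_def PiE_def)
    fix p assume p: "p \<in> strict_pairs"
    obtain i j where ij: "p = (i, j)" by (cases p)
    note c = strict_pairs_cases[OF p[unfolded ij]]
    have lt: "i < j" "j < k" using p by (auto simp: ij strict_pairs_iff)
    show "dec_w (enc w u) p = w p"
    proof (cases "bb j < n")
      case True
      then show ?thesis using p c(4) lt by (simp add: ij dec_w_def enc_def)
    next
      case False
      then have n: "bb j = n" "bb i = n" using c(3) by auto
      let ?y = "u (i, j) - int (l ^ (dd i - dd j)) * u (j, i)"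
      have "dec_w (enc w u) p = (half * ?y) mod int (l ^ n)"
        using False p c(4,5) lt by (simp add: ij dec_w_def enc_def)
      also have "\<dots> = w p mod int (l ^ n)"
      proof -
        have "cond w u i j = 2 * w (i, j) - ?y" using n by (simp add: cond_def)
        then have "[2 * w (i, j) = ?y] (mod int (l ^ n))"
          using C[OF lt] n by (simp add: cong_iff_dvd_diff)
        then have "[half * ?y = half * (2 * w (i, j))] (mod int (l ^ n))"
          by (intro cong_mult cong_refl) (rule cong_sym)
        also have "half * (2 * w (i, j)) = (2 * half) * w (i, j)" by simp
        also have "[(2 * half) * w (i, j) = 1 * w (i, j)] (mod int (l ^ n))"
          by (intro cong_mult half cong_refl)
        finally show ?thesis by (simp add: cong_def ij)
      qed
      also have "\<dots> = w p"
        using WW_range[OF w p] c(1) n by (intro mod_pos_pos_trivial) (auto simp: ij)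
      finally show ?thesis .
    qed
  qed
  show "dec_u (enc w u) = u"
  proof (rule extensionalityI[of _ sq])
    show "dec_u (enc w u) \<in> extensional sq" by (simp add: dec_u_def)
    show "u \<in> extensional sq" using u by (simp add: FF_def PiE_def)
    fix p assume p: "p \<in> sq"
    obtain i j where ij: "p = (i, j)" by (cases p)
    show "dec_u (enc w u) p = u p"
    proof (cases "i < j \<and> bb j < n")
      case True
      then have lt: "i < j" "j < k" using p by (auto simp: ij)
      then have s: "(i, j) \<in> strict_pairs" by (simp add: strict_pairs_iff)
      note c = strict_pairs_cases[OF s]
      let ?y = "int (l ^ (dd i - dd j)) * u (j, i) + 2 * int (l ^ (n - bb i)) * w (i, j)"
      have "dec_u (enc w u) p = ?y mod int (l ^ bb j)"
        using True p c(5) by (simp add: ij dec_u_def enc_def)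
      also have "\<dots> = u p mod int (l ^ bb j)"
      proof -
        have "cond w u i j = ?y - u (i, j)" by (simp add: cond_def)
        then show ?thesis using C[OF lt] by (simp add: mod_eq_dvd_iff ij)
      qed
      also have "\<dots> = u p"
        using FF_range[OF u p] c(1) by (intro mod_pos_pos_trivial) (auto simp: ij)
      finally show ?thesis .
    next
      case False
      then show ?thesis using p by (auto simp: ij dec_u_def enc_def)
    qed
  qed
qed

text \<open>The condition on block v in terms of the free parameters: for v < n only the entries on
  and below the diagonal are entries of \<psi>, and they are reflected to a symmetric
  matrix.\<close>

definition blk_nonsing :: "nat \<Rightarrow> (nat \<times> nat \<Rightarrow> int) \<Rightarrow> bool" where
  "blk_nonsing v f \<longleftrightarrow>
    nonsing l (blk v) (blk v) (if v < n then (\<lambda>(i, j). f (max i j, min i j)) else f)"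

text \<open>For \<open>v < n\<close> the block has \<open>a i = v\<close>, so \<open>dd\<close>
  vanishes, and the \<omega> term carries the factor l^(n-v), divisible by l; entries above the
  diagonal are then congruent to their mirror images. For v = n all entries of \<psi> are
  free.\<close>

lemma blk_nonsing_iff:
  assumes v: "v \<in> {1..n}"
  shows "nonsing l (blk v) (blk v) (dec_u f) \<longleftrightarrow> blk_nonsing v f"
  unfolding blk_nonsing_def
proof (rule nonsing_cong)
  fix i j assume ij: "i \<in> blk v" "j \<in> blk v"
  then have b: "bb i = v" "bb j = v" "i < k" "j < k" by (auto simp: blk_def)
  then have p: "(i, j) \<in> sq" by simp
  show "[dec_u f (i, j) = (if v < n then (\<lambda>(i, j). f (max i j, min i j)) else f) (i, j)] (mod int l)"
  proof (cases "i < j \<and> v < n")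
    case True
    have d: "dd i = 0" "dd j = 0" using b True by (auto simp: bb_def dd_def min_def split: if_splits)
    have "n - v \<noteq> 0" using True by simp
    then have ln: "int l dvd int (l ^ (n - v))" by simp
    have lv: "int l dvd int (l ^ v)" using v by simp
    have "dec_u f (i, j) = (f (j, i) + 2 * int (l ^ (n - v)) * f (i, j)) mod int (l ^ v)"
      using True p b d by (simp add: dec_u_def)
    also have "[\<dots> = f (j, i) + 2 * int (l ^ (n - v)) * f (i, j)] (mod int (l ^ v))"
      by (simp add: cong_def)
    finally have "[dec_u f (i, j) = f (j, i) + 2 * int (l ^ (n - v)) * f (i, j)] (mod int l)"
      using lv by (rule cong_dvd_modulus)
    also have "[f (j, i) + 2 * int (l ^ (n - v)) * f (i, j) = f (j, i)] (mod int l)"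
      using ln by (simp add: cong_iff_dvd_diff)
    finally show ?thesis using True by (simp add: max_def min_def)
  next
    case False
    have "dec_u f (i, j) = f (i, j)" using False p b by (auto simp: dec_u_def)
    then show ?thesis using False by (auto simp: max_def min_def not_less)
  qed
qed

text \<open>Reduced residues are normal forms both for torsion wedges and for the matrix of \<psi>;
  the congruences leave exactly the parameters in \<open>FF\<close> free.\<close>

lemma beg_structures:
  assumes G: "finite_abelian_primary l G"
  shows "bij_betw (\<lambda>f. (ts (we (dec_w f)), psi_of (dec_u f))) FF {x. is_beg l n (G, x)}"
  unfolding bij_betw_def
proof
  have bw: "bij_betw (\<lambda>w. ts (we w)) WW (carrier (torsion (wedge_square G) (l ^ n)))"
    unfolding WW_def
    by (rule presents_bij[OF presents_wedge_torsion comm_group_torsion[OF comm_group_wedge_square[OF is_group]]])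
      (simp add: l0)
  show "inj_on (\<lambda>f. (ts (we (dec_w f)), psi_of (dec_u f))) FF"
  proof (rule inj_onI)
    fix f g assume fg: "f \<in> FF" "g \<in> FF"
      and "(ts (we (dec_w f)), psi_of (dec_u f)) = (ts (we (dec_w g)), psi_of (dec_u g))"
    then have e: "ts (we (dec_w f)) = ts (we (dec_w g))" "psi_of (dec_u f) = psi_of (dec_u g)" by simp_all
    have w: "dec_w f = dec_w g"
      using bij_betw_imp_inj_on[OF bw] e(1) dec_w_mem fg by (simp add: inj_on_def)
    have u: "dec_u f = dec_u g"
    proof (rule extensionalityI[of _ sq])
      show "dec_u f \<in> extensional sq" "dec_u g \<in> extensional sq" by (simp_all add: dec_u_def)
      fix p assume p: "p \<in> sq"
      have "[dec_u f p = dec_u g p] (mod int (l ^ mm p))"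
        using e(2) p unfolding psi_of_eq by auto
      moreover have "dec_u f p mod int (l ^ mm p) = dec_u f p" "dec_u g p mod int (l ^ mm p) = dec_u g p"
        using FF_range[OF dec_u_mem[OF fg(1)] p] FF_range[OF dec_u_mem[OF fg(2)] p]
        by (auto intro!: mod_pos_pos_trivial)
      ultimately show "dec_u f p = dec_u g p" unfolding cong_def by argo
    qed
    show "f = g" using enc_dec[OF fg(1)] enc_dec[OF fg(2)] unfolding w u by (rule trans[OF sym])
  qed
  show "(\<lambda>f. (ts (we (dec_w f)), psi_of (dec_u f))) ` FF = {x. is_beg l n (G, x)}"
  proof (intro equalityI subsetI)
    fix x assume "x \<in> (\<lambda>f. (ts (we (dec_w f)), psi_of (dec_u f))) ` FF"
    then obtain f where x: "x = (ts (we (dec_w f)), psi_of (dec_u f))" by (elim imageE)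
    have "is_beg l n (G, x)"
      unfolding x is_beg_coords_iff[OF G] by (intro allI impI cond_dec)
    then show "x \<in> {x. is_beg l n (G, x)}" by simp
  next
    fix x assume "x \<in> {x. is_beg l n (G, x)}"
    then have B: "is_beg l n (G, fst x, snd x)" by simp
    have "fst x \<in> (\<lambda>w. ts (we w)) ` WW"
      unfolding bij_betw_imp_surj_on[OF bw] by (rule is_begD(5)[OF B])
    then obtain w where w: "w \<in> WW" "fst x = ts (we w)" by (elim imageE)
    obtain u0 where u0: "snd x = psi_of u0" using psi_of_surj[OF is_begD(8,9)[OF B]] by (elim exE)
    define u where "u = (\<lambda>p\<in>sq. u0 p mod int (l ^ mm p))"
    have u: "u \<in> FF" unfolding FF_def u_def using pow_pos by (intro PiE_I) (simp_all del: of_nat_power)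
    have "psi_of u0 = psi_of u" unfolding psi_of_eq u_def by (simp add: cong_def)
    then have su: "snd x = psi_of u" using u0 by simp
    have "is_beg l n (G, ts (we w), psi_of u)" using B unfolding w(2) su .
    then have C: "int (l ^ bb j) dvd cond w u i j" if "i < j" "j < k" for i j
      unfolding is_beg_coords_iff[OF G] using that by blast
    have "dec_w (enc w u) = w" "dec_u (enc w u) = u"
      by (rule dec_enc[OF w(1) u]; rule C; assumption)+
    then have "x = (ts (we (dec_w (enc w u))), psi_of (dec_u (enc w u)))"
      using w(2) su by (simp only: prod_eq_iff fst_conv snd_conv simp_thms)
    then show "x \<in> (\<lambda>f. (ts (we (dec_w f)), psi_of (dec_u f))) ` FF"
      using enc_mem[OF w(1) u] by (rule image_eqI)
  qed
qed

lemma finite_FF: "finite FF"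
  unfolding FF_def by (intro finite_PiE) auto

lemma finite_beg_structures:
  assumes "finite_abelian_primary l G"
  shows "finite {x. is_beg l n (G, x)}"
  using bij_betw_finite[OF beg_structures[OF assms]] finite_FF by blast

lemma card_iso_structures:
  assumes G: "finite_abelian_primary l G"
  shows "card {x. is_beg l n (G, x) \<and> psi_iso l n (G, x)} = card {f \<in> FF. \<forall>v\<in>{1..n}. blk_nonsing v f}"
proof -
  let ?h = "\<lambda>f. (ts (we (dec_w f)), psi_of (dec_u f))"
  let ?S = "{f \<in> FF. \<forall>v\<in>{1..n}. blk_nonsing v f}"
  have iff: "psi_iso l n (G, ?h f) \<longleftrightarrow> (\<forall>v\<in>{1..n}. blk_nonsing v f)" for f
    unfolding psi_iso_iff by (rule ball_cong[OF refl]) (rule blk_nonsing_iff)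
  note surj = bij_betw_imp_surj_on[OF beg_structures[OF G]]
  have "{x. is_beg l n (G, x) \<and> psi_iso l n (G, x)} = ?h ` ?S"
  proof (intro equalityI subsetI)
    fix x assume x: "x \<in> {x. is_beg l n (G, x) \<and> psi_iso l n (G, x)}"
    then have "x \<in> ?h ` FF" unfolding surj by simp
    then obtain f where f: "f \<in> FF" "x = ?h f" by (elim imageE)
    then have "f \<in> ?S" using x iff[of f] by simp
    then show "x \<in> ?h ` ?S" unfolding f(2) by (rule imageI)
  next
    fix x assume "x \<in> ?h ` ?S"
    then obtain f where f: "f \<in> ?S" "x = ?h f" by (elim imageE)
    then have "f \<in> FF" by simp
    then have "x \<in> ?h ` FF" unfolding f(2) by (rule imageI)
    then show "x \<in> {x. is_beg l n (G, x) \<and> psi_iso l n (G, x)}"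
      unfolding surj using f iff[of f] by simp
  qed
  then show ?thesis
    using card_image[OF inj_on_subset[OF bij_betw_imp_inj_on[OF beg_structures[OF G]]], of ?S] by simp
qed

end

subsection \<open>Counting block by block\<close>

text \<open>Independence: conditions that see disjoint sets of coordinates have proportions that
  multiply, with \<open>\<rho> v\<close> the proportion for block v.\<close>

lemma card_PiE_blocks:
  fixes B :: "'v \<Rightarrow> 'i set"
  assumes "finite V" "finite A" and X: "\<And>i. finite (X i)"
    and B: "\<And>v. v \<in> V \<Longrightarrow> B v \<subseteq> A"
    and disj: "\<And>v v'. v \<in> V \<Longrightarrow> v' \<in> V \<Longrightarrow> v \<noteq> v' \<Longrightarrow> B v \<inter> B v' = {}"
    and dep: "\<And>v f f'. v \<in> V \<Longrightarrow> (\<And>p. p \<in> B v \<Longrightarrow> f p = f' p) \<Longrightarrow> \<Psi> v f = \<Psi> v f'"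
    and cnt: "\<And>v. v \<in> V \<Longrightarrow>
      real (card {g \<in> PiE (B v) X. \<Psi> v g}) = \<rho> v * real (card (PiE (B v) X))"
  shows "real (card {f \<in> PiE A X. \<forall>v\<in>V. \<Psi> v f}) = real (card (PiE A X)) * (\<Prod>v\<in>V. \<rho> v)"
  using assms(1,2) B disj dep cnt
proof (induction V arbitrary: A rule: finite_induct)
  case empty
  then show ?case by simp
next
  case (insert v V)
  let ?B = "B v" let ?P = "PiE ?B X"
  let ?c = "card {h \<in> PiE (A - ?B) X. \<forall>v'\<in>V. \<Psi> v' h}"
  have BA: "?B \<subseteq> A" using insert.prems(2)[of v] by simp
  have finP: "finite ?P" using finite_subset[OF BA insert.prems(1)] X by (intro finite_PiE) auto
  \<comment> \<open>The condition of block v sees only \<open>g\<close>, the others see only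
    \<open>h\<close>.\<close>
  have "card {h \<in> PiE (A - ?B) X. \<forall>v'\<in>insert v V. \<Psi> v' (merge_on ?B g h)} = (if \<Psi> v g then ?c else 0)" for g
  proof -
    have "\<Psi> v (merge_on ?B g h) = \<Psi> v g" for h
      by (rule insert.prems(4)) (auto simp: merge_on_def)
    moreover have "\<Psi> v' (merge_on ?B g h) = \<Psi> v' h" if "v' \<in> V" for v' h
    proof (rule insert.prems(4))
      show "v' \<in> insert v V" using that by simp
      fix p assume "p \<in> B v'"
      moreover have "B v \<inter> B v' = {}" using insert.prems(3)[of v v'] insert.hyps(2) that by auto
      ultimately show "merge_on ?B g h p = h p" by (auto simp: merge_on_def)
    qed
    ultimately show ?thesis by auto
  qed
  then have "card {f \<in> PiE A X. \<forall>v\<in>insert v V. \<Psi> v f} = (\<Sum>g\<in>?P. if \<Psi> v g then ?c else 0)"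
    using card_PiE_split[OF insert.prems(1) BA X, where \<Phi> = "\<lambda>f. \<forall>v\<in>insert v V. \<Psi> v f"]
    by (simp only:)
  also have "\<dots> = card {g \<in> ?P. \<Psi> v g} * ?c"
    using finP by (simp add: sum.If_cases Int_def)
  finally have "real (card {f \<in> PiE A X. \<forall>v\<in>insert v V. \<Psi> v f})
      = real (card {g \<in> ?P. \<Psi> v g}) * real ?c" by simp
  also have "real ?c = real (card (PiE (A - ?B) X)) * (\<Prod>v\<in>V. \<rho> v)"
  proof (rule insert.IH)
    show "B v' \<subseteq> A - ?B" if "v' \<in> V" for v'
      using insert.prems(2)[of v'] insert.prems(3)[of v v'] insert.hyps(2) that by auto
    show "finite (A - ?B)" using insert.prems(1) by simp
    show "B v' \<inter> B v'' = {}" if "v' \<in> V" "v'' \<in> V" "v' \<noteq> v''" for v' v''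
      using that by (intro insert.prems(3)) simp_all
    show "\<Psi> v' f = \<Psi> v' f'" if "v' \<in> V" "\<And>p. p \<in> B v' \<Longrightarrow> f p = f' p" for v' f f'
      by (rule insert.prems(4)) (use that in simp_all)
    show "real (card {g \<in> PiE (B v') X. \<Psi> v' g}) = \<rho> v' * real (card (PiE (B v') X))" if "v' \<in> V" for v'
      by (rule insert.prems(5)) (use that in simp)
  qed
  also have "real (card {g \<in> ?P. \<Psi> v g}) = \<rho> v * real (card ?P)"
    by (rule insert.prems(5)) simp
  finally have "real (card {f \<in> PiE A X. \<forall>v\<in>insert v V. \<Psi> v f})
      = real (card ?P * card (PiE (A - ?B) X)) * (\<rho> v * (\<Prod>v\<in>V. \<rho> v))" by simp
  moreover have "card ?P * card (PiE (A - ?B) X) = card (PiE A X)"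
    using insert.prems(1) BA finite_subset[OF BA]
    by (simp add: card_PiE prod.subset_diff[OF BA] mult.commute)
  ultimately show ?case using insert.hyps by simp
qed

lemma int_div_less_of_mult:
  fixes x y q :: int
  assumes "0 < q" "x < y * q"
  shows "x div q < y"
proof (rule ccontr)
  assume "\<not> x div q < y"
  then have "y * q \<le> x div q * q" using assms(1) by (intro mult_right_mono) auto
  also have "\<dots> \<le> x" using div_mult_mod_eq[of x q] pos_mod_sign[OF assms(1), of x] by linarith
  finally show False using assms(2) by simp
qed

text \<open>A residue modulo \<open>l ^ e p\<close> is its lowest digit in base l together with an
  arbitrary higher part, which a condition modulo l does not see.\<close>

lemma card_PiE_mod:
  assumes l: "l > 0" and fin: "finite B" and e: "\<And>p. p \<in> B \<Longrightarrow> 1 \<le> e p"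
    and dep: "\<And>f f'. (\<And>p. p \<in> B \<Longrightarrow> [f p = f' p] (mod int l)) \<Longrightarrow> \<Psi> f = \<Psi> f'"
  shows "card {g \<in> PiE B (\<lambda>p. {0..<int (l ^ e p)}). \<Psi> g} =
    card {g \<in> PiE B (\<lambda>_. {0..<int l}). \<Psi> g} * (\<Prod>p\<in>B. l ^ (e p - 1))"
proof -
  let ?Y = "PiE B (\<lambda>p. {0..<int (l ^ (e p - 1))})"
  have le: "int (l ^ e p) = int l * int (l ^ (e p - 1))" if "p \<in> B" for p
    using e[OF that] by (cases "e p") simp_all
  have il: "int l > 0" using l by simp
  have "bij_betw (\<lambda>g. (\<lambda>p\<in>B. g p mod int l, \<lambda>p\<in>B. g p div int l))
     {g \<in> PiE B (\<lambda>p. {0..<int (l ^ e p)}). \<Psi> g} ({g \<in> PiE B (\<lambda>_. {0..<int l}). \<Psi> g} \<times> ?Y)"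
  proof (rule bij_betw_byWitness[where f' = "\<lambda>(x, y). \<lambda>p\<in>B. x p + int l * y p"])
    show "\<forall>g\<in>{g \<in> PiE B (\<lambda>p. {0..<int (l ^ e p)}). \<Psi> g}.
       (case (\<lambda>p\<in>B. g p mod int l, \<lambda>p\<in>B. g p div int l) of (x, y) \<Rightarrow> \<lambda>p\<in>B. x p + int l * y p) = g"
      by (auto simp: fun_eq_iff PiE_def extensional_def)
    show "\<forall>z\<in>{g \<in> PiE B (\<lambda>_. {0..<int l}). \<Psi> g} \<times> ?Y.
       (\<lambda>p\<in>B. (case z of (x, y) \<Rightarrow> \<lambda>p\<in>B. x p + int l * y p) p mod int l,
        \<lambda>p\<in>B. (case z of (x, y) \<Rightarrow> \<lambda>p\<in>B. x p + int l * y p) p div int l) = z"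
    proof (rule ballI)
      fix z assume "z \<in> {g \<in> PiE B (\<lambda>_. {0..<int l}). \<Psi> g} \<times> ?Y"
      then obtain x y where z: "z = (x, y)" and x: "x \<in> PiE B (\<lambda>_. {0..<int l})" and y: "y \<in> ?Y"
        by blast
      have "(x p + int l * y p) mod int l = x p \<and> (x p + int l * y p) div int l = y p" if "p \<in> B" for p
      proof -
        have "x p \<in> {0..<int l}" using x that by (rule PiE_mem)
        then show ?thesis by (auto simp: div_pos_pos_trivial mod_pos_pos_trivial)
      qed
      then show "(\<lambda>p\<in>B. (case z of (x, y) \<Rightarrow> \<lambda>p\<in>B. x p + int l * y p) p mod int l,
        \<lambda>p\<in>B. (case z of (x, y) \<Rightarrow> \<lambda>p\<in>B. x p + int l * y p) p div int l) = z"
        unfolding z prod.case using x y by (auto simp: fun_eq_iff PiE_def extensional_def)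
    qed
    show "(\<lambda>g. (\<lambda>p\<in>B. g p mod int l, \<lambda>p\<in>B. g p div int l)) `
        {g \<in> PiE B (\<lambda>p. {0..<int (l ^ e p)}). \<Psi> g} \<subseteq> {g \<in> PiE B (\<lambda>_. {0..<int l}). \<Psi> g} \<times> ?Y"
    proof (rule image_subsetI)
      fix g assume "g \<in> {g \<in> PiE B (\<lambda>p. {0..<int (l ^ e p)}). \<Psi> g}"
      then have g: "g \<in> PiE B (\<lambda>p. {0..<int (l ^ e p)})" "\<Psi> g" by auto
      have "\<Psi> (\<lambda>p\<in>B. g p mod int l) = \<Psi> g" by (rule dep) (simp add: cong_def)
      moreover have "g p div int l \<in> {0..<int (l ^ (e p - 1))}" if "p \<in> B" for p
      proof -
        have "0 \<le> g p" "g p < int (l ^ (e p - 1)) * int l"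
          using PiE_mem[OF g(1) that] le[OF that] by (simp_all add: mult.commute)
        then show ?thesis
          using il by (simp add: pos_imp_zdiv_nonneg_iff int_div_less_of_mult)
      qed
      ultimately show "(\<lambda>p\<in>B. g p mod int l, \<lambda>p\<in>B. g p div int l) \<in> {g \<in> PiE B (\<lambda>_. {0..<int l}). \<Psi> g} \<times> ?Y"
        using g il by auto
    qed
    show "(\<lambda>(x, y). \<lambda>p\<in>B. x p + int l * y p) ` ({g \<in> PiE B (\<lambda>_. {0..<int l}). \<Psi> g} \<times> ?Y)
      \<subseteq> {g \<in> PiE B (\<lambda>p. {0..<int (l ^ e p)}). \<Psi> g}"
    proof (rule image_subsetI)
      fix z assume "z \<in> {g \<in> PiE B (\<lambda>_. {0..<int l}). \<Psi> g} \<times> ?Y"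
      then obtain x y where z: "z = (x, y)" and x: "x \<in> PiE B (\<lambda>_. {0..<int l})" "\<Psi> x" and y: "y \<in> ?Y"
        by blast
      have "\<Psi> (\<lambda>p\<in>B. x p + int l * y p) = \<Psi> x" by (rule dep) (simp add: cong_def)
      moreover have "(\<lambda>p\<in>B. x p + int l * y p) \<in> PiE B (\<lambda>p. {0..<int (l ^ e p)})"
      proof (rule restrict_PiE_iff[THEN iffD2], intro ballI)
        fix p assume p: "p \<in> B"
        have xp: "0 \<le> x p" "x p < int l" using PiE_mem[OF x(1) p] by auto
        have yp: "0 \<le> y p" "y p \<le> int (l ^ (e p - 1)) - 1" using PiE_mem[OF y p] by auto
        have "int l * y p \<le> int l * (int (l ^ (e p - 1)) - 1)" using yp il by (intro mult_left_mono) auto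
        then have "x p + int l * y p < int (l ^ e p)"
          using xp unfolding le[OF p] by (simp add: right_diff_distrib)
        then show "x p + int l * y p \<in> {0..<int (l ^ e p)}" using xp yp il by simp
      qed
      ultimately show "(case z of (x, y) \<Rightarrow> \<lambda>p\<in>B. x p + int l * y p)
          \<in> {g \<in> PiE B (\<lambda>p. {0..<int (l ^ e p)}). \<Psi> g}"
        unfolding z prod.case using x(2) by blast
    qed
  qed
  then have "card {g \<in> PiE B (\<lambda>p. {0..<int (l ^ e p)}). \<Psi> g}
      = card ({g \<in> PiE B (\<lambda>_. {0..<int l}). \<Psi> g} \<times> ?Y)"
    by (rule bij_betw_same_card)
  then show ?thesis using fin by (simp add: card_cartesian_product card_PiE del: of_nat_power)
qed

lemma card_lower_triangle:
  fixes I :: "nat set"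
  assumes "finite I"
  shows "card {(i, j). i \<in> I \<and> j \<in> I \<and> j \<le> i} = card I * (card I + 1) div 2"
proof -
  let ?L = "{(i, j). i \<in> I \<and> j \<in> I \<and> j \<le> i}" and ?U = "{(i, j). i \<in> I \<and> j \<in> I \<and> i < j}"
    and ?L' = "{(i, j). i \<in> I \<and> j \<in> I \<and> j < i}"
  have sub: "?L \<subseteq> I \<times> I" "?U \<subseteq> I \<times> I" "?L' \<subseteq> I \<times> I" by auto
  have fin: "finite ?L" "finite ?U" "finite ?L'"
    using sub[THEN finite_subset] assms by auto
  have "?L \<union> ?U = I \<times> I" by auto
  moreover have "?L \<inter> ?U = {}" by auto
  ultimately have 1: "card ?L + card ?U = card I * card I"
    using card_Un_disjoint[OF fin(1,2)] by (simp add: card_cartesian_product)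
  have "bij_betw (\<lambda>(i, j). (j, i)) ?U ?L'"
    by (rule bij_betw_byWitness[where f' = "\<lambda>(i, j). (j, i)"]) auto
  then have 2: "card ?U = card ?L'" by (rule bij_betw_same_card)
  have "?L = ?L' \<union> (\<lambda>i. (i, i)) ` I" by auto
  moreover have "?L' \<inter> (\<lambda>i. (i, i)) ` I = {}" by auto
  moreover have "card ((\<lambda>i. (i, i)) ` I) = card I" by (rule card_image) (simp add: inj_on_def)
  ultimately have 3: "card ?L = card ?L' + card I"
    using card_Un_disjoint[OF fin(3), of "(\<lambda>i. (i, i)) ` I"] assms by simp
  have "2 * card ?L = card I * (card I + 1)" using 1 2 3 by simp
  then show ?thesis by simp
qed

text \<open>Passes between two encodings of symmetric matrices: functions on unordered pairs, suited
  to elimination, and entries on and below the diagonal, in which the BEG parameters are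
  given.\<close>

lemma card_nonsing_triangle:
  fixes I :: "nat set"
  assumes l: "prime l" and fin: "finite I"
  shows "real (card {g \<in> PiE {(i, j). i \<in> I \<and> j \<in> I \<and> j \<le> i} (\<lambda>_. {0..<int l}).
      nonsing l I I (\<lambda>(i, j). g (max i j, min i j))}) = nonsing_symm_count (real l) (card I)"
proof -
  let ?B = "{(i, j). i \<in> I \<and> j \<in> I \<and> j \<le> i}" and ?X = "\<lambda>_. {0..<int l}"
  have mm: "(Max {i, j}, Min {i, j}) \<in> ?B" "Max {i, j} = max i j" "Min {i, j} = min i j"
    if "i \<in> I" "j \<in> I" for i j :: nat
    using that by (auto simp: max_def min_def)
  have set: "{max i j, min i j} = {i, j}" for i j :: nat by (auto simp: max_def min_def)
  have up: "\<exists>i\<in>I. \<exists>j\<in>I. s = {i, j}" if "s \<in> upairs I" for s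
    using that by (auto simp: upairs_def)
  have "bij_betw (\<lambda>h. \<lambda>p\<in>?B. case p of (i, j) \<Rightarrow> h {i, j})
     {h \<in> PiE (upairs I) ?X. nonsing l I I (symm h)}
     {g \<in> PiE ?B ?X. nonsing l I I (\<lambda>(i, j). g (max i j, min i j))}"
  proof (rule bij_betw_byWitness[where f' = "\<lambda>g. \<lambda>s\<in>upairs I. g (Max s, Min s)"])
    show "\<forall>h\<in>{h \<in> PiE (upairs I) ?X. nonsing l I I (symm h)}.
        (\<lambda>s\<in>upairs I. (\<lambda>p\<in>?B. case p of (i, j) \<Rightarrow> h {i, j}) (Max s, Min s)) = h"
    proof
      fix h assume "h \<in> {h \<in> PiE (upairs I) ?X. nonsing l I I (symm h)}"
      then have h: "h \<in> extensional (upairs I)" by (simp add: PiE_def)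
      show "(\<lambda>s\<in>upairs I. (\<lambda>p\<in>?B. case p of (i, j) \<Rightarrow> h {i, j}) (Max s, Min s)) = h"
      proof (rule extensionalityI[OF restrict_extensional h])
        fix s assume s: "s \<in> upairs I"
        then obtain i j where ij: "i \<in> I" "j \<in> I" "s = {i, j}" using up by blast
        show "(\<lambda>s\<in>upairs I. (\<lambda>p\<in>?B. case p of (i, j) \<Rightarrow> h {i, j}) (Max s, Min s)) s = h s"
          using s mm(1)[OF ij(1,2)] set[of i j] mm(2,3)[OF ij(1,2)] ij(3) by simp
      qed
    qed
    show "\<forall>g\<in>{g \<in> PiE ?B ?X. nonsing l I I (\<lambda>(i, j). g (max i j, min i j))}.
        (\<lambda>p\<in>?B. case p of (i, j) \<Rightarrow> (\<lambda>s\<in>upairs I. g (Max s, Min s)) {i, j}) = g"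
    proof
      fix g assume "g \<in> {g \<in> PiE ?B ?X. nonsing l I I (\<lambda>(i, j). g (max i j, min i j))}"
      then have g: "g \<in> extensional ?B" by (simp add: PiE_def)
      show "(\<lambda>p\<in>?B. case p of (i, j) \<Rightarrow> (\<lambda>s\<in>upairs I. g (Max s, Min s)) {i, j}) = g"
      proof (rule extensionalityI[OF restrict_extensional g])
        fix p assume p: "p \<in> ?B"
        then obtain i j where ij: "p = (i, j)" "i \<in> I" "j \<in> I" "j \<le> i" by blast
        then show "(\<lambda>p\<in>?B. case p of (i, j) \<Rightarrow> (\<lambda>s\<in>upairs I. g (Max s, Min s)) {i, j}) p = g p"
          using upairs_mem[OF ij(2,3)] by (simp add: max_def min_def)
      qed
    qed
    show "(\<lambda>h. \<lambda>p\<in>?B. case p of (i, j) \<Rightarrow> h {i, j}) `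
        {h \<in> PiE (upairs I) ?X. nonsing l I I (symm h)}
      \<subseteq> {g \<in> PiE ?B ?X. nonsing l I I (\<lambda>(i, j). g (max i j, min i j))}"
    proof (rule image_subsetI, intro CollectI conjI)
      fix h assume "h \<in> {h \<in> PiE (upairs I) ?X. nonsing l I I (symm h)}"
      then have h: "h \<in> PiE (upairs I) ?X" "nonsing l I I (symm h)" by auto
      have "h {i, j} \<in> {0..<int l}" if "i \<in> I" "j \<in> I" for i j
        using PiE_mem[OF h(1) upairs_mem[OF that]] .
      then show "(\<lambda>p\<in>?B. case p of (i, j) \<Rightarrow> h {i, j}) \<in> PiE ?B ?X" by auto
      have "nonsing l I I (\<lambda>(i, j). (\<lambda>p\<in>?B. case p of (i, j) \<Rightarrow> h {i, j}) (max i j, min i j))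
          \<longleftrightarrow> nonsing l I I (symm h)"
      proof (rule nonsing_cong)
        fix i j assume ij: "i \<in> I" "j \<in> I"
        show "[(\<lambda>(i, j). (\<lambda>p\<in>?B. case p of (i, j) \<Rightarrow> h {i, j}) (max i j, min i j)) (i, j) = symm h (i, j)] (mod int l)"
          using mm[OF ij] set[of i j] by (simp add: symm_def)
      qed
      then show "nonsing l I I (\<lambda>(i, j). (\<lambda>p\<in>?B. case p of (i, j) \<Rightarrow> h {i, j}) (max i j, min i j))"
        using h(2) by blast
    qed
    show "(\<lambda>g. \<lambda>s\<in>upairs I. g (Max s, Min s)) `
        {g \<in> PiE ?B ?X. nonsing l I I (\<lambda>(i, j). g (max i j, min i j))}
      \<subseteq> {h \<in> PiE (upairs I) ?X. nonsing l I I (symm h)}"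
    proof (rule image_subsetI, intro CollectI conjI)
      fix g assume "g \<in> {g \<in> PiE ?B ?X. nonsing l I I (\<lambda>(i, j). g (max i j, min i j))}"
      then have g: "g \<in> PiE ?B ?X" "nonsing l I I (\<lambda>(i, j). g (max i j, min i j))" by auto
      have "g (Max s, Min s) \<in> {0..<int l}" if s: "s \<in> upairs I" for s
      proof -
        obtain i j where ij: "i \<in> I" "j \<in> I" "s = {i, j}" using up[OF s] by (elim bexE)
        show ?thesis unfolding ij(3) by (rule PiE_mem[OF g(1) mm(1)[OF ij(1,2)]])
      qed
      then show "(\<lambda>s\<in>upairs I. g (Max s, Min s)) \<in> PiE (upairs I) ?X" by (intro restrict_PiE_iff[THEN iffD2] ballI)
      have "nonsing l I I (symm (\<lambda>s\<in>upairs I. g (Max s, Min s)))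
          \<longleftrightarrow> nonsing l I I (\<lambda>(i, j). g (max i j, min i j))"
        by (rule nonsing_cong) (simp add: symm_def upairs_mem)
      then show "nonsing l I I (symm (\<lambda>s\<in>upairs I. g (Max s, Min s)))" using g(2) by blast
    qed
  qed
  from bij_betw_same_card[OF this] show ?thesis
    unfolding card_nonsing_symm[OF l fin, symmetric] by (rule arg_cong[OF sym])
qed

context primary_coords
begin

definition blk_pairs :: "nat \<Rightarrow> (nat \<times> nat) set" where
  "blk_pairs v = (if v < n then {(i, j). i \<in> blk v \<and> j \<in> blk v \<and> j \<le> i} else blk v \<times> blk v)"

text \<open>The proportion of nonsingular matrices among those of the size of block v over the field
  with l elements, symmetric ones for v < n.\<close>

definition blk_density :: "nat \<Rightarrow> real" where
  "blk_density v = (if v < n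
     then qpochhammer (inverse (real l)) (inverse (real l) ^ 2) ((card (blk v) + 1) div 2)
     else qpochhammer (inverse (real l)) (inverse (real l)) (card (blk v)))"

lemma finite_blk: "finite (blk v)"
  by (simp add: blk_def)

lemma blk_pairs_subset: "blk_pairs v \<subseteq> blk v \<times> blk v"
  by (auto simp: blk_pairs_def)

lemma finite_blk_pairs: "finite (blk_pairs v)"
  using finite_subset[OF blk_pairs_subset] finite_blk by simp

lemma mm_pos: "p \<in> sq \<Longrightarrow> 1 \<le> mm p"
  using bb_pos by (auto simp: mm_def)

lemma blk_nonsing_cong:
  assumes "\<And>p. p \<in> blk_pairs v \<Longrightarrow> [f p = f' p] (mod int l)"
  shows "blk_nonsing v f = blk_nonsing v f'"
  unfolding blk_nonsing_def
proof (rule nonsing_cong)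
  fix i j assume ij: "i \<in> blk v" "j \<in> blk v"
  show "[(if v < n then (\<lambda>(i, j). f (max i j, min i j)) else f) (i, j) =
      (if v < n then (\<lambda>(i, j). f' (max i j, min i j)) else f') (i, j)] (mod int l)"
    using ij assms[of "(max i j, min i j)"] assms[of "(i, j)"]
    by (auto simp: blk_pairs_def max_def min_def split: if_splits)
qed

lemma card_blk_nonsing:
  "real (card {g \<in> PiE (blk_pairs v) (\<lambda>p. {0..<int (l ^ mm p)}). blk_nonsing v g}) =
    blk_density v * real (card (PiE (blk_pairs v) (\<lambda>p. {0..<int (l ^ mm p)})))"
proof -
  let ?B = "blk_pairs v"
  let ?q = "inverse (real l)"
  have "blk v \<subseteq> {..<k}" by (auto simp: blk_def)
  then have Bsq: "?B \<subseteq> sq" using blk_pairs_subset[of v] by blast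
  have e: "1 \<le> mm p" if "p \<in> ?B" for p using mm_pos that Bsq by blast
  have lp: "real l > 0" using l0 by simp
  have base: "real (card {g \<in> PiE ?B (\<lambda>_. {0..<int l}). blk_nonsing v g}) = blk_density v * real l ^ card ?B"
  proof (cases "v < n")
    case True
    then have "real (card {g \<in> PiE ?B (\<lambda>_. {0..<int l}). blk_nonsing v g})
        = nonsing_symm_count (real l) (card (blk v))"
      using card_nonsing_triangle[OF prime finite_blk[of v]] by (simp add: blk_pairs_def blk_nonsing_def)
    then show ?thesis
      using True card_lower_triangle[OF finite_blk[of v]]
      by (simp add: nonsing_symm_count_def blk_density_def blk_pairs_def)
  next
    case False
    then show ?thesis
      using card_nonsing[OF prime finite_blk finite_blk refl refl, of v]
      by (simp add: blk_pairs_def blk_nonsing_def blk_density_def card_cartesian_product)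
  qed
  have "card {g \<in> PiE ?B (\<lambda>p. {0..<int (l ^ mm p)}). blk_nonsing v g}
      = card {g \<in> PiE ?B (\<lambda>_. {0..<int l}). blk_nonsing v g} * (\<Prod>p\<in>?B. l ^ (mm p - 1))"
    by (rule card_PiE_mod[OF l0 finite_blk_pairs e blk_nonsing_cong])
  then have "real (card {g \<in> PiE ?B (\<lambda>p. {0..<int (l ^ mm p)}). blk_nonsing v g})
      = blk_density v * (real l ^ card ?B * real (\<Prod>p\<in>?B. l ^ (mm p - 1)))"
    by (simp add: base)
  also have "real l ^ card ?B * real (\<Prod>p\<in>?B. l ^ (mm p - 1)) = real (\<Prod>p\<in>?B. l * l ^ (mm p - 1))"
    by (simp add: prod.distrib)
  also have "(\<Prod>p\<in>?B. l * l ^ (mm p - 1)) = (\<Prod>p\<in>?B. l ^ mm p)"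
  proof (rule prod.cong[OF refl])
    fix p assume "p \<in> ?B"
    then show "l * l ^ (mm p - 1) = l ^ mm p" using e[of p] by (cases "mm p") simp_all
  qed
  also have "(\<Prod>p\<in>?B. l ^ mm p) = card (PiE ?B (\<lambda>p. {0..<int (l ^ mm p)}))"
    using finite_blk_pairs by (simp add: card_PiE del: of_nat_power)
  finally show ?thesis .
qed

lemma card_wedge_torsion:
  "card (carrier (torsion (wedge_square G) (l ^ n))) = (\<Prod>p\<in>strict_pairs. l ^ mm p)"
proof (rule presents_card[OF presents_wedge_torsion comm_group_torsion[OF comm_group_wedge_square[OF is_group]]])
  show "finite strict_pairs" by (rule finite_subset[of _ sq]) (auto simp: strict_pairs_def)
qed (simp add: l0)

lemma card_sym_torsion:
  "card (carrier (torsion (sym_square G) (l ^ n))) = (\<Prod>p\<in>weak_pairs. l ^ mm p)"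
proof -
  obtain \<Psi> where \<Psi>: "presents (torsion (sym_square G) (l ^ n)) weak_pairs (\<lambda>p. l ^ mm p) \<Psi>"
    using presents_sym_torsion by blast
  have "comm_group (sym_square G)"
    unfolding sym_square_def
    by (rule comm_group.abelian_FactGroup[OF comm_group_T subgroup_wedge_square[OF is_group]])
  from presents_card[OF \<Psi> comm_group_torsion[OF this]] show ?thesis
    using finite_subset[of weak_pairs sq] l0 by (auto simp: weak_pairs_def)
qed

text \<open>The total number of BEG structures on the group. Its symmetric factor is the one that
  the normalization of the measure divides out.\<close>

lemma card_FF:
  "card FF = card (carrier (torsion (wedge_square G) (l ^ n))) * card (carrier (torsion (sym_square G) (l ^ n)))"
proof -
  have s: "strict_pairs \<subseteq> sq" by (auto simp: strict_pairs_def)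
  have "card FF = (\<Prod>p\<in>sq. l ^ mm p)" unfolding FF_def by (simp add: card_PiE del: of_nat_power)
  also have "\<dots> = (\<Prod>p\<in>sq - strict_pairs. l ^ mm p) * (\<Prod>p\<in>strict_pairs. l ^ mm p)"
    by (rule prod.subset_diff[OF s]) simp
  \<comment> \<open>Transposition carries the lower triangle with its diagonal to the upper one and
    preserves \<open>mm\<close>.\<close>
  also have "(\<Prod>p\<in>sq - strict_pairs. l ^ mm p) = (\<Prod>p\<in>weak_pairs. l ^ mm p)"
    by (rule prod.reindex_bij_witness[of _ "\<lambda>(i, j). (j, i)" "\<lambda>(i, j). (j, i)"])
      (auto simp: strict_pairs_def weak_pairs_def mm_def min.commute)
  finally show ?thesis unfolding card_wedge_torsion card_sym_torsion by simp
qed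

lemma card_iso_structures_eq:
  assumes G: "finite_abelian_primary l G"
  shows "real (card {x. is_beg l n (G, x) \<and> psi_iso l n (G, x)}) =
    real (card (carrier (torsion (wedge_square G) (l ^ n)))) *
    real (card (carrier (torsion (sym_square G) (l ^ n)))) * (\<Prod>v\<in>{1..n}. blk_density v)"
proof -
  have "real (card {f \<in> FF. \<forall>v\<in>{1..n}. blk_nonsing v f}) = real (card FF) * (\<Prod>v\<in>{1..n}. blk_density v)"
    unfolding FF_def
  proof (rule card_PiE_blocks[where B = blk_pairs])
    show "blk_pairs v \<subseteq> sq" for v
      using blk_pairs_subset[of v] by (auto simp: blk_def)
    show "blk_pairs v \<inter> blk_pairs v' = {}" if "v \<noteq> v'" for v v'
      using blk_pairs_subset[of v] blk_pairs_subset[of v'] that by (auto simp: blk_def)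
    show "blk_nonsing v f = blk_nonsing v f'" if "\<And>p. p \<in> blk_pairs v \<Longrightarrow> f p = f' p" for v f f'
      by (rule blk_nonsing_cong) (simp add: that)
    show "real (card {g \<in> PiE (blk_pairs v) (\<lambda>p. {0..<int (l ^ mm p)}). blk_nonsing v g}) =
      blk_density v * real (card (PiE (blk_pairs v) (\<lambda>p. {0..<int (l ^ mm p)})))" for v
      by (rule card_blk_nonsing)
  qed simp_all
  then show ?thesis unfolding card_iso_structures[OF G] card_FF by simp
qed

end

subsection \<open>The type of the torsion subgroup\<close>

text \<open>The order of K[l^t] is l to the sum of the min(e i, t). First differences in t count the
  exponents above t, second differences those equal to v; so the multiplicities are invariants of
  the group.\<close>

lemma presents_prime_power_type:
  assumes l: "l \<ge> 2" and K: "comm_group K"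
    and P: "presents K I (\<lambda>i. l ^ e i) \<Phi>" "finite I"
    and Q: "presents K J (\<lambda>j. l ^ e' j) \<Psi>" "finite J"
    and v: "v \<ge> 1"
  shows "card {i \<in> I. e i = v} = card {j \<in> J. e' j = v}"
proof -
  have l0: "l > 0" using l by simp
  have card: "card (carrier (torsion K (l ^ t))) = l ^ (\<Sum>i\<in>I. min (e i) t)"
    if "presents K I (\<lambda>i. l ^ e i) \<Phi>" "finite I" for t and I :: "'x set" and e \<Phi>
    using presents_card[OF presents_prime_power_torsion[OF that(1) K l0] comm_group_torsion[OF K] that(2)] l0
    by (simp add: power_sum)
  have sums: "(\<Sum>i\<in>I. min (e i) t) = (\<Sum>j\<in>J. min (e' j) t)" for t
  proof -
    have "l ^ (\<Sum>i\<in>I. min (e i) t) = l ^ (\<Sum>j\<in>J. min (e' j) t)"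
      using card[OF P] card[OF Q] by metis
    then show ?thesis using l power_inject_exp[of l] by simp
  qed
  have step: "(\<Sum>i\<in>I. min (e i) (Suc t)) = (\<Sum>i\<in>I. min (e i) t) + card {i \<in> I. t < e i}"
    if "finite I" for I :: "'x set" and e t
  proof -
    have "(\<Sum>i\<in>I. min (e i) (Suc t)) = (\<Sum>i\<in>I. min (e i) t + (if t < e i then 1 else 0))"
      by (rule sum.cong) auto
    also have "\<dots> = (\<Sum>i\<in>I. min (e i) t) + card {i \<in> I. t < e i}"
      using that by (simp add: sum.distrib sum.If_cases Int_def)
    finally show ?thesis .
  qed
  have gt: "card {i \<in> I. t < e i} = card {j \<in> J. t < e' j}" for t
    using step[OF P(2), of e t] step[OF Q(2), of e' t] sums[of t] sums[of "Suc t"] by simp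
  have eq: "card {i \<in> I. v - 1 < e i} = card {i \<in> I. e i = v} + card {i \<in> I. v < e i}"
    if "finite I" for I :: "'x set" and e
  proof -
    have "{i \<in> I. v - 1 < e i} = {i \<in> I. e i = v} \<union> {i \<in> I. v < e i}" using v by auto
    moreover have "{i \<in> I. e i = v} \<inter> {i \<in> I. v < e i} = {}" by auto
    ultimately show ?thesis using that by (simp add: card_Un_disjoint)
  qed
  show ?thesis
    using eq[OF P(2), of e] eq[OF Q(2), of e'] gt[of "v - 1"] gt[of v] by simp
qed

lemma comm_group_sum_integer_mod_group:
  "comm_group (sum_group J (\<lambda>j. integer_mod_group (N j)))"
proof (rule group.group_comm_groupI)
  show "group (sum_group J (\<lambda>j. integer_mod_group (N j)))" by (rule sum_group) simp
  show "x \<otimes>\<^bsub>sum_group J (\<lambda>j. integer_mod_group (N j))\<^esub> y = y \<otimes>\<^bsub>sum_group J (\<lambda>j. integer_mod_group (N j))\<^esub> x" for x y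
    unfolding mult_sum_group
    by (rule restrict_ext) (simp add: integer_mod_group_def integer_group_def add.commute)
qed

lemma presents_sum_integer_mod_group:
  assumes "finite J" and N: "\<And>j. j \<in> J \<Longrightarrow> N j > 0"
  shows "presents (sum_group J (\<lambda>j. integer_mod_group (N j))) J N (\<lambda>c. \<lambda>j\<in>J. c j mod int (N j))"
  unfolding presents_def
proof (intro conjI allI ballI)
  fix c d :: "'a \<Rightarrow> int"
  show "(\<lambda>j\<in>J. c j mod int (N j)) \<in> carrier (sum_group J (\<lambda>j. integer_mod_group (N j)))"
    using assms by (auto simp: carrier_sum_group carrier_integer_mod_group)
  show "(\<lambda>j\<in>J. (c j + d j) mod int (N j)) = (\<lambda>j\<in>J. c j mod int (N j))
      \<otimes>\<^bsub>sum_group J (\<lambda>j. integer_mod_group (N j))\<^esub> (\<lambda>j\<in>J. d j mod int (N j))"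
    using N by (auto simp: fun_eq_iff integer_mod_group_def mod_add_eq)
  show "(\<lambda>j\<in>J. c j mod int (N j)) = \<one>\<^bsub>sum_group J (\<lambda>j. integer_mod_group (N j))\<^esub> \<longleftrightarrow>
      (\<forall>j\<in>J. int (N j) dvd c j)"
    by (auto simp: fun_eq_iff integer_mod_group_def dvd_eq_mod_eq_0)
next
  fix x assume x: "x \<in> carrier (sum_group J (\<lambda>j. integer_mod_group (N j)))"
  have "x = (\<lambda>j\<in>J. x j mod int (N j))"
  proof (rule extensionalityI[of _ J])
    show "x \<in> extensional J" using x by (simp add: carrier_sum_group PiE_def)
    fix j assume j: "j \<in> J"
    then have "x j \<in> carrier (integer_mod_group (N j))" using x by (auto simp: carrier_sum_group)
    then show "x j = (\<lambda>j\<in>J. x j mod int (N j)) j"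
      using N[OF j] j by (simp add: carrier_integer_mod_group)
  qed simp
  then show "\<exists>c. x = (\<lambda>j\<in>J. c j mod int (N j))" by blast
qed

lemma nat_ceiling_half: "nat \<lceil>real m / 2\<rceil> = (m + 1) div 2"
proof (cases "even m")
  case True
  then obtain t where "m = 2 * t" by (elim evenE)
  then show ?thesis by simp
next
  case False
  then obtain t where t: "m = 2 * t + 1" by (elim oddE)
  have "\<lceil>real m / 2\<rceil> = int t + 1" unfolding t by (rule ceiling_unique) simp_all
  then show ?thesis using t by simp
qed

subsection \<open>The measure of the BEGs on a group\<close>

theorem proposition8p23:
  fixes l n :: nat and G :: "('a, 'b) monoid_scheme" and m :: "nat \<Rightarrow> nat"
  assumes "prime l" and "odd l" and "n \<ge> 1"
    and "finite_abelian_primary l G"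
    and "torsion G (l ^ n) \<cong>
         sum_group (SIGMA i:{1..n}. {..<m i}) (\<lambda>(i, j). integer_mod_group (l ^ i))"
  shows "measure (beg_measure l n) {C \<in> beg_classes l n. \<exists>(H, \<omega>, \<psi>) \<in> C. H \<cong> G} =
         prodinf (\<lambda>i. inverse (1 + inverse (real l) ^ (i + 1))) / real (card (auto G))
         * real (card (carrier (torsion (wedge_square G) (l ^ n))))
         * qpochhammer (inverse (real l)) (inverse (real l)) (m n)
         * (\<Prod>i = 1..n - 1. qpochhammer (inverse (real l)) (inverse (real l) ^ 2)
              (nat \<lceil>real (m i) / 2\<rceil>))"
proof -
  interpret G: comm_group G using assms(4) by (simp add: finite_abelian_primary_def)
  have l1: "l > 1" using assms(1) prime_gt_1_nat by blast
  \<comment> \<open>BEGs are built on plain monoid records, so the extra fields of \<open>G\<close>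
    are dropped first; the groups and counts in the statement are unaffected.\<close>
  define G0 where "G0 = \<lparr>carrier = carrier G, monoid.mult = mult G, one = one G\<rparr>"
  have sel: "carrier G0 = carrier G" "mult G0 = mult G" "one G0 = one G" by (simp_all add: G0_def)
  have G0: "comm_group G0"
    by (rule comm_groupI) (auto simp: sel G.m_ac G.l_inv_ex)
  interpret G0: comm_group G0 by (rule G0)
  have prim: "finite_abelian_primary l G0"
    using assms(4) G0 by (simp add: finite_abelian_primary_def sel order_def)
  have fin: "finite (carrier G0)" using prim by (simp add: finite_abelian_primary_def)
  have id: "(\<lambda>x. x) \<in> iso G G0" "(\<lambda>x. x) \<in> iso G0 G"
    by (auto simp: iso_def hom_def sel bij_betw_def)
  then have isos: "G \<cong> G0" "G0 \<cong> G" by (auto simp: is_iso_def)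
  have same: "wedge_square G0 = wedge_square G" "auto G0 = auto G"
    by (simp_all add: wedge_square_def wedge_def tensor_def tensor_square_def bilinear_kernel_def
        bilinear_relations_def auto_def hom_def sel)
  obtain k :: nat and a e where a1: "\<And>i. i < k \<Longrightarrow> 1 \<le> a i"
    and dec: "\<And>i j. j < k \<Longrightarrow> i \<le> j \<Longrightarrow> a j \<le> a i"
    and pres: "presents G0 {..<k} (\<lambda>i. l ^ a i) (lin G0 {..<k} e)"
    using primary_group_basis[OF assms(1) prim] by metis
  have coords: "primary_coords H k l a \<Phi> n"
    if "comm_group H" "presents H {..<k} (\<lambda>i. l ^ a i) \<Phi>" for H :: "'x monoid" and \<Phi>
    using that assms(1-3) a1 dec l1
    by (intro primary_coords.intro presented_group.intro presented_group_axioms.intro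
        primary_coords_axioms.intro) auto
  interpret C: primary_coords G0 k l a "lin G0 {..<k} e" n by (rule coords[OF G0 pres])
  \<comment> \<open>An isomorphism carries the presentation over with the same exponents
    \<open>a\<close>, and these alone determine the order.\<close>
  have sym: "card (carrier (torsion (sym_square H) (l ^ n))) = card (carrier (torsion (sym_square G0) (l ^ n)))"
    if H: "finite_abelian_primary l H" "H \<cong> G0" for H :: "nat monoid"
  proof -
    have cH: "comm_group H" using H(1) by (simp add: finite_abelian_primary_def)
    have "G0 \<cong> H" using group.iso_sym[OF comm_group.axioms(2)[OF cH] H(2)] .
    then obtain f where f: "f \<in> iso G0 H" by (auto simp: is_iso_def)
    interpret H: primary_coords H k l a "\<lambda>c. f (lin G0 {..<k} e c)" n
      by (rule coords[OF cH presents_iso[OF pres G0 cH f]])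
    show ?thesis unfolding H.card_sym_torsion C.card_sym_torsion ..
  qed
  \<comment> \<open>The l^n-torsion is presented both by the exponents \<open>bb\<close> and by the
    given direct sum; equal multiplicities identify block sizes with the m_v.\<close>
  have type: "card (C.blk v) = m v" if v: "v \<in> {1..n}" for v
  proof -
    let ?J = "SIGMA i:{1..n}. {..<m i}"
    let ?S = "sum_group ?J (\<lambda>p. integer_mod_group (l ^ fst p))"
    have "(\<lambda>(i, j). integer_mod_group (l ^ i)) = (\<lambda>p :: nat \<times> nat. integer_mod_group (l ^ fst p))"
      by (simp add: fun_eq_iff)
    then obtain f where f: "f \<in> iso (torsion G (l ^ n)) ?S"
      using assms(5) by (auto simp: is_iso_def)
    have pow: "x [^]\<^bsub>G0\<^esub> z = x [^]\<^bsub>G\<^esub> z" for x and z :: nat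
      by (induction z) (simp_all add: sel)
    have i: "(\<lambda>x. x) \<in> iso (torsion G0 (l ^ n)) (torsion G (l ^ n))"
      by (auto simp: iso_def hom_def bij_betw_def carrier_torsion sel pow)
    have P1: "presents (torsion G (l ^ n)) {..<k} (\<lambda>i. l ^ C.bb i) C.tt"
      by (rule presents_iso[OF C.presents_TG C.comm_group_TG comm_group_torsion[OF G.comm_group_axioms] i])
    have cS: "comm_group ?S" by (rule comm_group_sum_integer_mod_group)
    have P2: "presents ?S {..<k} (\<lambda>i. l ^ C.bb i) (\<lambda>c. f (C.tt c))"
      by (rule presents_iso[OF P1 comm_group_torsion[OF G.comm_group_axioms] cS f])
    have P3: "presents ?S ?J (\<lambda>p. l ^ fst p) (\<lambda>c. \<lambda>p\<in>?J. c p mod int (l ^ fst p))"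
      by (rule presents_sum_integer_mod_group) (use l1 in auto)
    have "card {i \<in> {..<k}. C.bb i = v} = card {p \<in> ?J. fst p = v}"
      by (rule presents_prime_power_type[OF _ cS P2 _ P3]) (use l1 v in auto)
    moreover have "{p \<in> ?J. fst p = v} = Pair v ` {..<m v}" using v by auto
    moreover have "card (Pair v ` {..<m v}) = m v" by (subst card_image) (auto simp: inj_on_def)
    ultimately show ?thesis by (simp add: C.blk_def)
  qed
  let ?P = "prodinf (\<lambda>i. 1 - inverse (real l) ^ (2 * i + 1))"
  let ?s = "card (carrier (torsion (sym_square G0) (l ^ n)))"
  have s0: "?s > 0"
    unfolding C.card_sym_torsion using l1 by (intro prod_pos) simp
  have "{C \<in> beg_classes l n. \<exists>(H, \<omega>, \<psi>) \<in> C. H \<cong> G} = {C \<in> beg_classes l n. \<exists>(H, \<omega>, \<psi>) \<in> C. H \<cong> G0}"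
    using iso_trans[OF _ isos(1)] iso_trans[OF _ isos(2)] by fast
  then have "measure (beg_measure l n) {C \<in> beg_classes l n. \<exists>(H, \<omega>, \<psi>) \<in> C. H \<cong> G} =
      ?P * real (card {x. is_beg l n (G0, x) \<and> psi_iso l n (G0, x)}) / (real (card (auto G0)) * real ?s)"
    using measure_beg_measure[OF l1 G0 fin sym C.finite_beg_structures[OF prim]] by simp
  \<comment> \<open>The order of the torsion of the symmetric square cancels against the number of
    structures.\<close>
  also have "\<dots> = ?P / real (card (auto G)) * real (card (carrier (torsion (wedge_square G) (l ^ n))))
      * (\<Prod>v\<in>{1..n}. C.blk_density v)"
    unfolding C.card_iso_structures_eq[OF prim] same using s0 by (simp add: field_simps)
  also have "(\<Prod>v\<in>{1..n}. C.blk_density v) = qpochhammer (inverse (real l)) (inverse (real l)) (m n)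
      * (\<Prod>i = 1..n - 1. qpochhammer (inverse (real l)) (inverse (real l) ^ 2) (nat \<lceil>real (m i) / 2\<rceil>))"
  proof -
    have "{1..n} = insert n {1..n - 1}" using assms(3) by auto
    then have "(\<Prod>v\<in>{1..n}. C.blk_density v) = C.blk_density n * (\<Prod>v\<in>{1..n - 1}. C.blk_density v)"
      using assms(3) by simp
    also have "C.blk_density n = qpochhammer (inverse (real l)) (inverse (real l)) (m n)"
      using type[of n] assms(3) by (simp add: C.blk_density_def)
    also have "(\<Prod>v\<in>{1..n - 1}. C.blk_density v)
        = (\<Prod>i = 1..n - 1. qpochhammer (inverse (real l)) (inverse (real l) ^ 2) (nat \<lceil>real (m i) / 2\<rceil>))"
    proof (rule prod.cong[OF refl])
      fix v assume v: "v \<in> {1..n - 1}"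
      then have "v \<in> {1..n}" "v < n" by auto
      then show "C.blk_density v = qpochhammer (inverse (real l)) (inverse (real l) ^ 2) (nat \<lceil>real (m v) / 2\<rceil>)"
        using type[of v] by (simp add: C.blk_density_def nat_ceiling_half)
    qed
    finally show ?thesis .
  qed
  also have "?P = prodinf (\<lambda>i. inverse (1 + inverse (real l) ^ (i + 1)))"
    using prodinf_inverse_one_plus_power[of "inverse (real l)"] l1 by (simp add: field_simps)
  finally show ?thesis by (simp only: mult.assoc)
qed

end
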